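(* Let $\ell$ be a prime and let $t,r$ be positive integers with $t\ge2$. Then \[ \sum_{n=0}^{\infty}b_t(rn+s)q^{n}\not\equiv 0\pmod{\ell} \] for every $s\in\{0,1,\ldots,r-1\}$ such that $s\equiv (t-1)\frac{d^{2}-1}{24}\pmod r$ for some integer $d$ with $\gcd(d,6tr)=1$.
   Context: For an integer $t\ge 2$, $b_t(n)$ is the number of partitions of $n$ none of whose parts is divisible by $t$; equivalently $\sum_{n\ge0}b_t(n)q^n=f_t/f_1$ with $f_k=\prod_{j\ge1}(1-q^{jk})$. A power series is $\not\equiv0\pmod\ell$ if at least one coefficient is not divisible by $\ell$. *)

theory Defs
  imports
    "HOL-Library.Multiset"
    "HOL-Computational_Algebra.Formal_Power_Series"
    "HOL-Computational_Algebra.Primes"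
    "HOL-Number_Theory.Cong"
begin

definition partitions_of :: "nat \<Rightarrow> nat multiset set" where
  "partitions_of n = {P. (\<forall>p\<in>#P. 0 < p) \<and> sum_mset P = n}"

definition regular_partitions :: "nat \<Rightarrow> nat \<Rightarrow> nat multiset set" where
  "regular_partitions t n = {P \<in> partitions_of n. \<forall>p\<in>#P. \<not> t dvd p}"

definition num_regular_partitions :: "nat \<Rightarrow> nat \<Rightarrow> nat" where
  "num_regular_partitions t n = card (regular_partitions t n)"

definition fps_zero_mod :: "int \<Rightarrow> int fps \<Rightarrow> bool" where
  "fps_zero_mod m F \<longleftrightarrow> (\<forall>n. m dvd fps_nth F n)"

text \<open>The counted set is finite, so \<open>card\<close> does not take its default value 0.\<close>

lemma finite_partitions_of: "finite (partitions_of n)"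
proof (rule finite_subset)
  show "partitions_of n \<subseteq> mset ` {xs. set xs \<subseteq> {..n} \<and> length xs \<le> n}"
  proof
    fix P assume P: "P \<in> partitions_of n"
    obtain xs where xs: "P = mset xs" by (metis ex_mset)
    have sum: "sum_list xs = n" and pos: "\<forall>x\<in>set xs. 0 < x"
      using P by (auto simp: partitions_of_def xs sum_mset_sum_list)
    have "length xs \<le> sum_list xs"
      using pos by (induction xs) auto
    moreover have "set xs \<subseteq> {..n}"
      using member_le_sum_list sum by blast
    ultimately show "P \<in> mset ` {xs. set xs \<subseteq> {..n} \<and> length xs \<le> n}"
      using xs sum by blast
  qed
  show "finite (mset ` {xs. set xs \<subseteq> {..n} \<and> length xs \<le> n})"
    by (intro finite_imageI finite_lists_length_le) simp
qed

lemma finite_regular_partitions: "finite (regular_partitions t n)"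
  unfolding regular_partitions_def using finite_partitions_of by simp

end

theory Submission
  imports "HOL-Complex_Analysis.Complex_Analysis" Defs
begin

text \<open>
  Up to a factor that is an integral power series in \<open>q\<^sup>r\<close> with constant term 1, the quotient
  \<open>f\<^sub>t / f\<^sub>1\<close> is a product of inverse Klein forms at torsion points. Multiplied by a form proportional
  to the discriminant it is a modular form \<open>\<phi>\<close> of some weight \<open>k\<close> that decays at all cusps. Klein
  forms are functions of a lattice and a point of it, so Hecke operators \<open>T\<^sub>p\<close>, being sums over
  overlattices of index \<open>p\<close>, map \<open>\<phi>\<close> into one fixed space of forms of level \<open>\<Gamma>(M)\<close> with \<open>M\<close>
  independent of \<open>p\<close>, and on coefficients \<open>T\<^sub>p\<close> is \<open>c(n) \<mapsto> \<plusminus>c(p n) + p\<^sup>k\<^sup>-\<^sup>1 c(n / p)\<close>.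

  Call \<open>x\<close> good if some \<open>c(n)\<close> with \<open>n\<close> in the class of \<open>(t - 1) x\<^sup>2\<close> is not divisible by \<open>l\<close>. If \<open>x\<close> is
  good and \<open>p x\<close> is bad, then the part of \<open>T\<^sub>p \<phi>\<close> in the class of \<open>(t - 1) p x\<^sup>2\<close> is congruent modulo \<open>l\<close>
  to a unit times \<open>f (q\<^sup>p)\<close>, where \<open>f\<close> is a nonconstant series depending on \<open>x\<close> only. For different
  primes these are linearly independent modulo \<open>l\<close>, whereas Sturm's bound limits the number of
  independent integral forms. So all but finitely many primes preserve goodness. Every class prime
  to \<open>6 t r\<close> contains a product of such primes, and 1 is good because \<open>b\<^sub>t(0) = 1\<close>.
\<close>

section \<open>Infinite products and the q-Pochhammer symbol\<close>

text \<open>Squares enter through the exponents. Written in u =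
  \<open>qe (\<tau> / of_nat (24 * N))\<close>, the coefficient of index m in the product of f_t /
  f_1 with the auxiliary series sits at u^(E0 + 24 m), where E0 is congruent to t - 1 modulo 24 r.
  So the class of (t - 1) d^2 modulo 24 r for exponents is the class of (t - 1)(d^2 - 1) / 24 modulo
  r for indices, and multiplying x by p matches the relation between the exponents n and p n. The
  obstacle is that p runs over primes without any congruence condition while the images must be
  sieved for a class and still share one level. Translation by an integer only moves the torsion
  point to another N-division point, so sieving and Hecke sums both stay among forms of the same
  level. Finite dimension is exploited in characteristic 0 only. Enough integral series satisfy an
  integral relation on an initial segment of coefficients; dividing by powers of l makes some
  coefficient of the relation prime to l, Sturm's bound makes the relation exact, and only then is
  it read modulo l, at the lowest exponent that survives.\<close>

lemma
  fixes f :: "nat \<Rightarrow> complex \<Rightarrow> complex"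
  assumes S: "open S" and hol: "\<And>n. f n holomorphic_on S"
    and bd: "\<And>x. x \<in> S \<Longrightarrow> \<exists>d>0. \<exists>M. summable M \<and> (\<forall>z\<in>cball x d \<inter> S. \<forall>n. norm (f n z) \<le> M n)"
  shows convergent_prod_locally_bounded: "\<And>z. z \<in> S \<Longrightarrow> convergent_prod (\<lambda>n. 1 + f n z)"
    and uniform_limit_prodinf_locally_bounded:
      "\<And>x. x \<in> S \<Longrightarrow> \<exists>d>0. cball x d \<subseteq> S \<and>
        uniform_limit (cball x d) (\<lambda>N z. \<Prod>n<N. 1 + f n z) (\<lambda>z. \<Prod>n. 1 + f n z) sequentially"
    and holomorphic_on_prodinf_locally_bounded: "(\<lambda>z. \<Prod>n. 1 + f n z) holomorphic_on S"
proof -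
  show conv: "convergent_prod (\<lambda>n. 1 + f n z)" if z: "z \<in> S" for z
  proof -
    obtain d M where "d > 0" "summable M" and M: "\<forall>z\<in>cball z d \<inter> S. \<forall>n. norm (f n z) \<le> M n"
      using bd[OF z] by blast
    then have "norm (norm (f n z)) \<le> M n" for n
      using z by simp
    then have "summable (\<lambda>n. norm (f n z))"
      using \<open>summable M\<close> summable_comparison_test'[of M 0 "\<lambda>n. norm (f n z)"] by blast
    then show ?thesis
      by (intro abs_convergent_prod_imp_convergent_prod summable_imp_abs_convergent_prod) auto
  qed
  show ul: "\<exists>d>0. cball x d \<subseteq> S \<and>
      uniform_limit (cball x d) (\<lambda>N z. \<Prod>n<N. 1 + f n z) (\<lambda>z. \<Prod>n. 1 + f n z) sequentially"
    if x: "x \<in> S" for x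
  proof -
    obtain d M where d: "d > 0" and M: "summable M" "\<And>z n. z \<in> cball x d \<Longrightarrow> z \<in> S \<Longrightarrow> norm (f n z) \<le> M n"
      using bd[OF x] by blast
    obtain e where e: "e > 0" "cball x e \<subseteq> S"
      using S x open_contains_cball by blast
    define r where "r = min d e"
    have r: "r > 0" "cball x r \<subseteq> S" "cball x r \<subseteq> cball x d"
      using d e by (auto simp: r_def)
    have "uniformly_convergent_on (cball x r) (\<lambda>N z. \<Prod>n<N. 1 + f n z)"
    proof (rule uniformly_convergent_on_prod)
      show "continuous_on (cball x r) (f n)" for n
        using hol[of n] r(2) holomorphic_on_imp_continuous_on holomorphic_on_subset by blast
      show "uniformly_convergent_on (cball x r) (\<lambda>N x. \<Sum>n<N. norm (f n x))"
        by (rule Weierstrass_m_test'_ev[OF _ M(1)])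
           (use r in \<open>auto intro!: always_eventually M(2)\<close>)
    qed simp
    then obtain g where g: "uniform_limit (cball x r) (\<lambda>N z. \<Prod>n<N. 1 + f n z) g sequentially"
      by (auto simp: uniformly_convergent_on_def)
    have geq: "g z = (\<Prod>n. 1 + f n z)" if z: "z \<in> cball x r" for z
    proof -
      have "(\<lambda>N. \<Prod>n<N. 1 + f n z) \<longlonglongrightarrow> g z"
        by (rule tendsto_uniform_limitI[OF g z])
      moreover have "(\<lambda>N. \<Prod>n<Suc N. 1 + f n z) \<longlonglongrightarrow> (\<Prod>n. 1 + f n z)"
        using convergent_prod_LIMSEQ[OF conv[of z]] z r unfolding lessThan_Suc_atMost by auto
      ultimately show ?thesis
        using LIMSEQ_unique by (subst (asm) filterlim_sequentially_Suc) blast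
    qed
    have "uniform_limit (cball x r) (\<lambda>N z. \<Prod>n<N. 1 + f n z) (\<lambda>z. \<Prod>n. 1 + f n z) sequentially"
      by (rule uniform_limit_cong'[THEN iffD1, OF _ _ g]) (auto simp: geq)
    then show ?thesis using r by blast
  qed
  show "(\<lambda>z. \<Prod>n. 1 + f n z) holomorphic_on S"
    by (rule holomorphic_uniform_sequence[OF S _ ul]) (auto intro!: holomorphic_intros hol)
qed

text \<open>The symbol (X; q)_infinity, with the base as first argument. Both arguments are allowed
  to vary holomorphically.\<close>

definition qpoch :: "complex \<Rightarrow> complex \<Rightarrow> complex" where
  "qpoch q X = (\<Prod>n. 1 - X * q ^ n)"

text \<open>A geometric majorant works near x: its ratio \<rho> lies halfway between
  \<open>norm (q x)\<close> and 1, and \<open>X\<close> is bounded by its size at x plus 1.\<close>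

lemma qpoch_family_bound:
  assumes "open S" "q holomorphic_on S" "X holomorphic_on S" "\<And>z. z \<in> S \<Longrightarrow> norm (q z) < 1" "x \<in> S"
  shows "\<exists>d>0. \<exists>M. summable M \<and> (\<forall>z\<in>cball x d \<inter> S. \<forall>n. norm (- (X z * q z ^ n)) \<le> M n)"
proof -
  define \<rho> where "\<rho> = (1 + norm (q x)) / 2"
  have \<rho>: "norm (q x) < \<rho>" "0 < \<rho>" "\<rho> < 1"
    using assms(4)[OF assms(5)] by (auto simp: \<rho>_def field_simps intro: add_pos_nonneg)
  have cont: "continuous_on S (\<lambda>z. norm (q z))" "continuous_on S (\<lambda>z. norm (X z))"
    using assms holomorphic_on_imp_continuous_on by (auto intro!: continuous_intros)
  have "\<forall>\<^sub>F z in at x. norm (q z) < \<rho>"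
    using cont(1) assms(1,5) \<rho>(1) by (metis at_within_open continuous_on_def order_tendstoD(2))
  moreover have "\<forall>\<^sub>F z in at x. norm (X z) < norm (X x) + 1"
    using cont(2) assms(1,5) by (metis at_within_open continuous_on_def order_tendstoD(2) less_add_one)
  ultimately have "\<forall>\<^sub>F z in at x. norm (q z) < \<rho> \<and> norm (X z) < norm (X x) + 1"
    by eventually_elim auto
  then obtain d where d: "d > 0" and *: "\<And>z. z \<noteq> x \<Longrightarrow> dist z x \<le> d \<Longrightarrow> norm (q z) < \<rho> \<and> norm (X z) < norm (X x) + 1"
    unfolding eventually_at_le by auto
  have **: "norm (q z) \<le> \<rho> \<and> norm (X z) \<le> norm (X x) + 1" if "z \<in> cball x d" for z
    using *[of z] that \<rho> by (cases "z = x") (auto simp: dist_commute less_imp_le)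
  have "norm (- (X z * q z ^ n)) \<le> (norm (X x) + 1) * \<rho> ^ n" if "z \<in> cball x d \<inter> S" for z n
    using **[of z] that unfolding norm_minus_cancel norm_mult norm_power by (intro mult_mono power_mono) auto
  moreover have "summable (\<lambda>n. (norm (X x) + 1) * \<rho> ^ n)"
    using \<rho> by (intro summable_mult summable_geometric) auto
  ultimately show ?thesis using d by blast
qed

lemma holomorphic_on_qpoch [holomorphic_intros]:
  assumes "open S" "q holomorphic_on S" "X holomorphic_on S" "\<And>z. z \<in> S \<Longrightarrow> norm (q z) < 1"
  shows "(\<lambda>z. qpoch (q z) (X z)) holomorphic_on S"
proof -
  have "(\<lambda>z. \<Prod>n. 1 + - (X z * q z ^ n)) holomorphic_on S"
    using qpoch_family_bound[OF assms] assms
    by (intro holomorphic_on_prodinf_locally_bounded) (auto intro!: holomorphic_intros)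
  then show ?thesis by (simp add: qpoch_def)
qed

lemma convergent_prod_qpoch:
  fixes q X :: complex
  assumes "norm q < 1"
  shows "convergent_prod (\<lambda>n. 1 - X * q ^ n)"
proof -
  have "summable (\<lambda>n. norm (X * q ^ n))"
    using assms unfolding norm_mult norm_power by (intro summable_mult summable_geometric) simp
  then have "convergent_prod (\<lambda>n. 1 + - (X * q ^ n))"
    by (intro abs_convergent_prod_imp_convergent_prod summable_imp_abs_convergent_prod) auto
  then show ?thesis by simp
qed

lemma has_prod_qpoch: "norm q < 1 \<Longrightarrow> (\<lambda>n. 1 - X * q ^ n) has_prod qpoch q X"
  unfolding qpoch_def by (intro convergent_prod_has_prod convergent_prod_qpoch)

lemma LIMSEQ_qpoch: "norm q < 1 \<Longrightarrow> (\<lambda>m. \<Prod>n<m. 1 - X * q ^ n) \<longlonglongrightarrow> qpoch q X"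
  using convergent_prod_LIMSEQ[OF convergent_prod_qpoch[of q X]]
  unfolding qpoch_def lessThan_Suc_atMost[symmetric] by (subst (asm) filterlim_sequentially_Suc)

lemma qpoch_0_iff: "norm q < 1 \<Longrightarrow> qpoch q X = 0 \<longleftrightarrow> (\<exists>n. X * q ^ n = 1)"
  using has_prod_eq_0_iff[OF has_prod_qpoch[of q X]] by auto

lemma qpoch_rec:
  assumes "norm q < 1"
  shows "qpoch q X = (1 - X) * qpoch q (q * X)"
proof -
  have "(\<lambda>m. \<Prod>n<Suc m. 1 - X * q ^ n) = (\<lambda>m. (1 - X) * (\<Prod>n<m. 1 - (q * X) * q ^ n))"
    by (subst prod.lessThan_Suc_shift) (simp add: algebra_simps)
  moreover have "(\<lambda>m. \<Prod>n<Suc m. 1 - X * q ^ n) \<longlonglongrightarrow> qpoch q X"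
    using LIMSEQ_qpoch[OF assms] by (rule LIMSEQ_Suc)
  moreover have "(\<lambda>m. (1 - X) * (\<Prod>n<m. 1 - (q * X) * q ^ n)) \<longlonglongrightarrow> (1 - X) * qpoch q (q * X)"
    by (intro tendsto_intros LIMSEQ_qpoch assms)
  ultimately show ?thesis by (metis LIMSEQ_unique)
qed

text \<open>Each factor has modulus at least 1 - \<rho> r^n, so the worst case is the real one, q =
  r and X = \<rho>, whose product is positive. This gives a bound uniform in q and X.\<close>

lemma norm_qpoch_ge:
  assumes "0 \<le> r" "r < 1" "0 \<le> \<rho>" "\<rho> < 1"
  obtains c where "c > 0" "\<And>q X. norm q \<le> r \<Longrightarrow> norm X \<le> \<rho> \<Longrightarrow> c \<le> norm (qpoch q X)"
proof
  let ?c = "norm (qpoch (of_real r) (of_real \<rho>))"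
  have small: "\<rho> * r ^ n < 1" for n
    using assms by (metis mult_left_le order_le_less_trans power_le_one less_imp_le)
  show "?c > 0"
  proof -
    have "(of_real \<rho> :: complex) * of_real r ^ n \<noteq> 1" for n
    proof
      assume "(of_real \<rho> :: complex) * of_real r ^ n = 1"
      then have "complex_of_real (\<rho> * r ^ n) = of_real 1" by simp
      then show False using small[of n] of_real_eq_iff by (metis less_irrefl)
    qed
    then show ?thesis using qpoch_0_iff[of "of_real r" "of_real \<rho>"] assms by simp
  qed
  fix q X :: complex assume q: "norm q \<le> r" and X: "norm X \<le> \<rho>"
  have le: "norm (\<Prod>n<m. 1 - complex_of_real \<rho> * of_real r ^ n) \<le> norm (\<Prod>n<m. 1 - X * q ^ n)" for m
  proof -
    have "norm (1 - complex_of_real \<rho> * of_real r ^ n) \<le> norm (1 - X * q ^ n)" for n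
    proof -
      have "1 - complex_of_real \<rho> * of_real r ^ n = of_real (1 - \<rho> * r ^ n)" by simp
      then have "norm (1 - complex_of_real \<rho> * of_real r ^ n) = 1 - \<rho> * r ^ n"
        using small[of n] by (metis abs_of_pos diff_gt_0_iff_gt norm_of_real)
      also have "\<dots> \<le> 1 - norm (X * q ^ n)"
        using q X assms unfolding norm_mult norm_power by (intro diff_left_mono mult_mono power_mono) auto
      also have "\<dots> \<le> norm (1 - X * q ^ n)"
        by (metis norm_one norm_triangle_ineq2)
      finally show ?thesis .
    qed
    then show ?thesis unfolding prod_norm[symmetric] by (intro prod_mono) auto
  qed
  show "?c \<le> norm (qpoch q X)"
  proof (rule LIMSEQ_le)
    show "(\<lambda>m. norm (\<Prod>n<m. 1 - complex_of_real \<rho> * of_real r ^ n)) \<longlonglongrightarrow> ?c"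
      using assms by (intro tendsto_intros LIMSEQ_qpoch) auto
    show "(\<lambda>m. norm (\<Prod>n<m. 1 - X * q ^ n)) \<longlonglongrightarrow> norm (qpoch q X)"
      using assms q by (intro tendsto_intros LIMSEQ_qpoch) auto
  qed (use le in auto)
qed

text \<open>From 1 + r^n \<le> exp (r^n); the exponents add up to the geometric series 1 / (1 -
  r).\<close>

lemma norm_qpoch_le:
  assumes "0 \<le> r" "r < 1"
  obtains C where "C > 0" "\<And>q X. norm q \<le> r \<Longrightarrow> norm X \<le> 1 \<Longrightarrow> norm (qpoch q X) \<le> C"
proof
  let ?C = "exp (1 / (1 - r))"
  show "?C > 0" by simp
  fix q X :: complex assume q: "norm q \<le> r" and X: "norm X \<le> 1"
  have "norm (\<Prod>n<m. 1 - X * q ^ n) \<le> ?C" for m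
  proof -
    have "norm (\<Prod>n<m. 1 - X * q ^ n) = (\<Prod>n<m. norm (1 - X * q ^ n))"
      by (rule prod_norm[symmetric])
    also have "\<dots> \<le> (\<Prod>n<m. 1 + r ^ n)"
    proof (intro prod_mono conjI)
      fix n
      have "norm (1 - X * q ^ n) \<le> 1 + norm (X * q ^ n)"
        by (metis norm_one norm_triangle_ineq4)
      also have "norm (X * q ^ n) \<le> 1 * r ^ n"
        using q X assms unfolding norm_mult norm_power by (intro mult_mono power_mono) auto
      finally show "norm (1 - X * q ^ n) \<le> 1 + r ^ n" by simp
    qed simp
    also have "\<dots> \<le> exp (\<Sum>n<m. r ^ n)"
      using assms by (intro prod_le_exp_sum) auto
    also have "(\<Sum>n<m. r ^ n) \<le> (\<Sum>n. r ^ n)"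
      using assms by (intro sum_le_suminf summable_geometric) auto
    also have "\<dots> = 1 / (1 - r)" using assms by (simp add: suminf_geometric)
    finally show ?thesis by simp
  qed
  moreover have "(\<lambda>m. norm (\<Prod>n<m. 1 - X * q ^ n)) \<longlonglongrightarrow> norm (qpoch q X)"
    using assms q by (intro tendsto_intros LIMSEQ_qpoch) auto
  ultimately show "norm (qpoch q X) \<le> ?C"
    by (intro LIMSEQ_le_const2) auto
qed

section \<open>The theta function and its inversion formula\<close>

definition qe :: "complex \<Rightarrow> complex" where
  "qe z = exp (2 * of_real pi * \<i> * z)"

lemma qe_0 [simp]: "qe 0 = 1"
  by (simp add: qe_def)

lemma qe_nonzero [simp]: "qe z \<noteq> 0"
  by (simp add: qe_def)

lemma qe_add: "qe (x + y) = qe x * qe y"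
  by (simp add: qe_def exp_add[symmetric] algebra_simps)

lemma qe_minus: "qe (- x) = inverse (qe x)"
  by (simp add: qe_def exp_minus[symmetric])

lemma qe_diff: "qe (x - y) = qe x / qe y"
  by (simp add: qe_def exp_diff[symmetric] algebra_simps)

lemma norm_qe: "norm (qe z) = exp (- 2 * pi * Im z)"
  by (simp add: qe_def)

lemma qe_power: "qe z ^ n = qe (of_nat n * z)"
  by (simp add: qe_def exp_of_nat_mult[symmetric] mult_ac)

lemma qe_eq_1_iff: "qe z = 1 \<longleftrightarrow> z \<in> \<int>"
proof -
  have "qe z = 1 \<longleftrightarrow> (\<exists>n::int. 2 * of_real pi * \<i> * z = of_int (2 * n) * of_real pi * \<i>)"
    unfolding qe_def exp_eq_1 by (auto simp: complex_eq_iff)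
  also have "\<dots> \<longleftrightarrow> (\<exists>n::int. z = of_int n)"
    by (intro ex_cong1) (auto simp: mult_ac)
  finally show ?thesis by (auto elim: Ints_cases)
qed

lemma qe_of_int [simp]: "qe (of_int n) = 1"
  by (simp add: qe_eq_1_iff)

lemma qe_of_nat [simp]: "qe (of_nat n) = 1"
  using qe_of_int[of "int n"] by simp

lemma qe_1 [simp]: "qe 1 = 1"
  using qe_of_nat[of 1] by simp

lemma qe_half [simp]: "qe (1 / 2) = - 1"
  by (simp add: qe_def)

lemma norm_qe_less_1 [simp]: "Im z > 0 \<Longrightarrow> norm (qe z) < 1"
  by (simp add: norm_qe)

lemma holomorphic_on_qe [holomorphic_intros]:
  "f holomorphic_on S \<Longrightarrow> (\<lambda>z. qe (f z)) holomorphic_on S"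
  unfolding qe_def by (intro holomorphic_intros)

lemma has_field_derivative_qe [derivative_intros]:
  "(f has_field_derivative D) (at z within S) \<Longrightarrow>
    ((\<lambda>z. qe (f z)) has_field_derivative (2 * of_real pi * \<i> * D * qe (f z))) (at z within S)"
  unfolding qe_def by (auto intro!: derivative_eq_intros)

text \<open>This is - 2 pi i times the Jacobi function \<theta>_1 (u) divided by its derivative at u
  = 0. Dividing by the derivative removes the eta factor, so that no eighth roots of unity appear
  under inversion.\<close>

definition theta :: "complex \<Rightarrow> complex \<Rightarrow> complex" where
  "theta u \<tau> = qe (- u / 2) * qpoch (qe \<tau>) (qe u) * qpoch (qe \<tau>) (qe (\<tau> - u)) / qpoch (qe \<tau>) (qe \<tau>) ^ 2"

lemma qpoch_qe_nonzero:
  assumes "Im \<tau> > 0" "Im z > 0"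
  shows "qpoch (qe \<tau>) (qe z) \<noteq> 0"
proof -
  have "norm (qe z * qe \<tau> ^ n) < 1" for n
    using assms by (simp add: norm_mult norm_power norm_qe exp_of_nat_mult[symmetric] exp_add[symmetric])
      (smt (verit) mult_nonneg_nonneg of_nat_0_le_iff pi_gt_zero zero_less_mult_iff)
  then show ?thesis
    using qpoch_0_iff[of "qe \<tau>" "qe z"] assms by (metis norm_one norm_qe_less_1 order_less_irrefl)
qed

lemma holomorphic_on_theta [holomorphic_intros]:
  assumes "open S" "f holomorphic_on S" "g holomorphic_on S" "\<And>z. z \<in> S \<Longrightarrow> Im (g z) > 0"
  shows "(\<lambda>z. theta (f z) (g z)) holomorphic_on S"
  unfolding theta_def using assms qpoch_qe_nonzero
  by (intro holomorphic_intros) auto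

text \<open>The factor 1 - \<open>qe u\<close> leaves one product and 1 - \<open>qe (- u)\<close>
  joins the other; their quotient is - \<open>qe u\<close>. Both quasi-periodicity in \<tau> and
  oddness of \<open>theta\<close> rest on this exchange.\<close>

lemma qpoch_shift_pair:
  assumes "Im \<tau> > 0"
  shows "qpoch (qe \<tau>) (qe (u + \<tau>)) * qpoch (qe \<tau>) (qe (- u)) =
         - qe (- u) * (qpoch (qe \<tau>) (qe u) * qpoch (qe \<tau>) (qe (\<tau> - u)))"
proof -
  have 1: "qpoch (qe \<tau>) (qe u) = (1 - qe u) * qpoch (qe \<tau>) (qe (u + \<tau>))"
    using qpoch_rec[of "qe \<tau>" "qe u"] assms by (simp add: qe_add mult.commute)
  have 2: "qpoch (qe \<tau>) (qe (- u)) = (1 - qe (- u)) * qpoch (qe \<tau>) (qe (\<tau> - u))"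
    using qpoch_rec[of "qe \<tau>" "qe (- u)"] assms by (simp add: qe_diff qe_minus field_simps)
  show ?thesis unfolding 1 2 by (simp add: qe_minus field_simps)
qed

context
  fixes \<tau> :: complex assumes \<tau>: "Im \<tau> > 0"
begin

lemma theta_plus_1: "theta (u + 1) \<tau> = - theta u \<tau>"
proof -
  have "qe (- (u + 1) / 2) = qe (- u / 2) * inverse (qe (1 / 2))"
    unfolding qe_minus[symmetric] qe_add[symmetric] by (simp add: field_simps)
  moreover have "qe (u + 1) = qe u" "qe (\<tau> - (u + 1)) = qe (\<tau> - u)"
    by (simp_all add: qe_add qe_diff)
  ultimately show ?thesis by (simp add: theta_def)
qed

lemma theta_plus_tau: "theta (u + \<tau>) \<tau> = - qe (- \<tau> / 2 - u) * theta u \<tau>"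
proof -
  have "theta (u + \<tau>) \<tau> = qe (- (u + \<tau>) / 2) *
      (qpoch (qe \<tau>) (qe (u + \<tau>)) * qpoch (qe \<tau>) (qe (- u))) / qpoch (qe \<tau>) (qe \<tau>) ^ 2"
    by (simp add: theta_def)
  also have "\<dots> = - (qe (- (u + \<tau>) / 2) * qe (- u)) *
      (qpoch (qe \<tau>) (qe u) * qpoch (qe \<tau>) (qe (\<tau> - u))) / qpoch (qe \<tau>) (qe \<tau>) ^ 2"
    by (subst qpoch_shift_pair[OF \<tau>]) simp
  also have "qe (- (u + \<tau>) / 2) * qe (- u) = qe (- \<tau> / 2 - u) * qe (- u / 2)"
    unfolding qe_add[symmetric] by (intro arg_cong[where f = qe]) (simp add: field_simps)
  finally show ?thesis by (simp add: theta_def)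
qed

lemma theta_minus: "theta (- u) \<tau> = - theta u \<tau>"
proof -
  have "theta (- u) \<tau> = qe (u / 2) *
      (qpoch (qe \<tau>) (qe (u + \<tau>)) * qpoch (qe \<tau>) (qe (- u))) / qpoch (qe \<tau>) (qe \<tau>) ^ 2"
    by (simp add: theta_def add.commute mult_ac)
  also have "\<dots> = - (qe (u / 2) * qe (- u)) *
      (qpoch (qe \<tau>) (qe u) * qpoch (qe \<tau>) (qe (\<tau> - u))) / qpoch (qe \<tau>) (qe \<tau>) ^ 2"
    by (subst qpoch_shift_pair[OF \<tau>]) simp
  also have "qe (u / 2) * qe (- u) = qe (- u / 2)"
    unfolding qe_add[symmetric] by (simp add: field_simps)
  finally show ?thesis by (simp add: theta_def)
qed

lemma theta_minus_tau: "theta (u - \<tau>) \<tau> = - qe (u - \<tau> / 2) * theta u \<tau>"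
proof -
  have "theta u \<tau> = - qe (- \<tau> / 2 - (u - \<tau>)) * theta (u - \<tau>) \<tau>"
    using theta_plus_tau[of "u - \<tau>"] by simp
  also have "qe (- \<tau> / 2 - (u - \<tau>)) = inverse (qe (u - \<tau> / 2))"
    unfolding qe_minus[symmetric] by (intro arg_cong[where f = qe]) (simp add: field_simps)
  finally show ?thesis by (simp add: field_simps)
qed

text \<open>The first Pochhammer factor vanishes at m + n \<tau> with n \<le> 0, the second at those
  with n \<ge> 1; together they give the whole lattice.\<close>

lemma theta_0_iff: "theta u \<tau> = 0 \<longleftrightarrow> (\<exists>m n :: int. u = of_int m + of_int n * \<tau>)"
proof -
  have *: "qe z * qe \<tau> ^ n = 1 \<longleftrightarrow> (\<exists>m::int. z = of_int m - of_nat n * \<tau>)" for z n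
  proof -
    have "qe z * qe \<tau> ^ n = qe (z + of_nat n * \<tau>)" by (simp add: qe_add qe_power)
    then show ?thesis by (auto simp: qe_eq_1_iff algebra_simps elim!: Ints_cases)
  qed
  have "theta u \<tau> = 0 \<longleftrightarrow> qpoch (qe \<tau>) (qe u) = 0 \<or> qpoch (qe \<tau>) (qe (\<tau> - u)) = 0"
    using qpoch_qe_nonzero[OF \<tau> \<tau>] by (simp add: theta_def)
  also have "\<dots> \<longleftrightarrow> (\<exists>n. \<exists>m::int. u = of_int m - of_nat n * \<tau>) \<or> (\<exists>n. \<exists>m::int. \<tau> - u = of_int m - of_nat n * \<tau>)"
    using \<tau> by (simp add: qpoch_0_iff *)
  also have "\<dots> \<longleftrightarrow> (\<exists>m n :: int. u = of_int m + of_int n * \<tau>)"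
  proof (intro iffI; elim disjE exE)
    fix n :: nat and m :: int assume "u = of_int m - of_nat n * \<tau>"
    then have "u = of_int m + of_int (- int n) * \<tau>" by simp
    then show "\<exists>m n :: int. u = of_int m + of_int n * \<tau>" by blast
  next
    fix n :: nat and m :: int assume "\<tau> - u = of_int m - of_nat n * \<tau>"
    then have "u = of_int (- m) + of_int (int (Suc n)) * \<tau>" by (simp add: algebra_simps)
    then show "\<exists>m n :: int. u = of_int m + of_int n * \<tau>" by blast
  next
    fix m n :: int assume u: "u = of_int m + of_int n * \<tau>"
    show "(\<exists>n. \<exists>m::int. u = of_int m - of_nat n * \<tau>) \<or> (\<exists>n. \<exists>m::int. \<tau> - u = of_int m - of_nat n * \<tau>)"
    proof (cases "n \<le> 0")
      case True
      then have "u = of_int m - of_nat (nat (- n)) * \<tau>" using u by simp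
      then show ?thesis by blast
    next
      case False
      then have "\<tau> - u = of_int (- m) - of_nat (nat (n - 1)) * \<tau>" using u by (simp add: algebra_simps)
      then show ?thesis by blast
    qed
  qed
  finally show ?thesis .
qed

text \<open>The zero at u = 0 is carried by the factor 1 - \<open>qe u\<close>; the cofactor
  \<open>E\<close> equals 1 there.\<close>

lemma has_field_derivative_theta_0: "((\<lambda>u. theta u \<tau>) has_field_derivative - 2 * of_real pi * \<i>) (at 0)"
proof -
  define E where "E = (\<lambda>u. qe (- u / 2) * qpoch (qe \<tau>) (qe (u + \<tau>)) * qpoch (qe \<tau>) (qe (\<tau> - u)) / qpoch (qe \<tau>) (qe \<tau>) ^ 2)"
  have "E holomorphic_on UNIV"
    unfolding E_def using \<tau> qpoch_qe_nonzero[OF \<tau> \<tau>] by (intro holomorphic_intros) auto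
  then obtain E' where E': "(E has_field_derivative E') (at 0)"
    by (metis UNIV_I holomorphic_derivI open_UNIV)
  have "E 0 = 1" using qpoch_qe_nonzero[OF \<tau> \<tau>] by (simp add: E_def power2_eq_square)
  have "((\<lambda>u. (1 - qe u) * E u) has_field_derivative - 2 * of_real pi * \<i>) (at 0)"
    by (auto intro!: derivative_eq_intros E' simp: \<open>E 0 = 1\<close>)
  moreover have "theta u \<tau> = (1 - qe u) * E u" for u
    using qpoch_rec[of "qe \<tau>" "qe u"] \<tau> by (simp add: theta_def E_def qe_add mult_ac)
  ultimately show ?thesis by simp
qed

end

text \<open>The quotient of the two sides is an elliptic function without poles. Its value is read
  off at the common zero \<open>u = 0\<close>, where both sides have a known derivative.\<close>

theorem theta_inversion:
  assumes \<tau>: "Im \<tau> > 0"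
  shows "theta (u / \<tau>) (- 1 / \<tau>) = qe (u ^ 2 / (2 * \<tau>)) / \<tau> * theta u \<tau>"
proof -
  define \<sigma> where "\<sigma> = - 1 / \<tau>"
  have \<tau>0: "\<tau> \<noteq> 0" using \<tau> by auto
  have \<sigma>: "Im \<sigma> > 0"
    using \<tau> \<tau>0 by (simp add: \<sigma>_def Im_divide field_simps sum_power2_gt_zero_iff complex_eq_iff)
  define f where "f = (\<lambda>u. theta u \<tau>)"
  define g where "g = (\<lambda>u. theta (u / \<tau>) \<sigma> * qe (- (u ^ 2) / (2 * \<tau>)))"
  \<comment> \<open>Both functions vanish on the lattice. The value filled in there is the quotient
    of their derivatives at 0, which makes the singularity at 0 removable; periodicity carries this
    to the other lattice points.\<close>
  define G where "G = (\<lambda>u. if f u = 0 then 1 / \<tau> else g u / f u)"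
  have f1: "f (u + 1) = - f u" for u
    by (simp add: f_def theta_plus_1[OF \<tau>])
  have f\<tau>: "f (u + \<tau>) = - qe (- \<tau> / 2 - u) * f u" for u
    by (simp add: f_def theta_plus_tau[OF \<tau>])
  have g1: "g (u + 1) = - g u" for u
  proof -
    have "(u + 1) / \<tau> = u / \<tau> - \<sigma>" by (simp add: \<sigma>_def add_divide_distrib)
    then have "theta ((u + 1) / \<tau>) \<sigma> = - qe (u / \<tau> - \<sigma> / 2) * theta (u / \<tau>) \<sigma>"
      by (simp only: theta_minus_tau[OF \<sigma>])
    moreover have "qe (u / \<tau> - \<sigma> / 2) * qe (- ((u + 1) ^ 2) / (2 * \<tau>)) = qe (- (u ^ 2) / (2 * \<tau>))"
      unfolding qe_add[symmetric] using \<tau>0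
      by (intro arg_cong[where f = qe]) (simp add: \<sigma>_def field_simps power2_eq_square)
    ultimately show ?thesis by (simp add: g_def mult_ac)
  qed
  have g\<tau>: "g (u + \<tau>) = - qe (- \<tau> / 2 - u) * g u" for u
  proof -
    have "(u + \<tau>) / \<tau> = u / \<tau> + 1" using \<tau>0 by (simp add: add_divide_distrib)
    then have "theta ((u + \<tau>) / \<tau>) \<sigma> = - theta (u / \<tau>) \<sigma>"
      by (simp only: theta_plus_1[OF \<sigma>])
    moreover have "qe (- ((u + \<tau>) ^ 2) / (2 * \<tau>)) = qe (- \<tau> / 2 - u) * qe (- (u ^ 2) / (2 * \<tau>))"
      unfolding qe_add[symmetric] using \<tau>0
      by (intro arg_cong[where f = qe]) (simp add: field_simps power2_eq_square)
    ultimately show ?thesis by (simp add: g_def mult_ac)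
  qed
  have G1: "G (u + 1) = G u" for u
    by (simp add: G_def f1 g1)
  have G\<tau>: "G (u + \<tau>) = G u" for u
    by (simp add: G_def f\<tau> g\<tau>)
  have Gn1: "G (u + of_nat n) = G u" for u n
    using G1[of "u + of_nat _"] by (induction n) (simp_all add: add_ac)
  have Gn\<tau>: "G (u + of_nat n * \<tau>) = G u" for u n
    using G\<tau>[of "u + of_nat _ * \<tau>"] by (induction n) (simp_all add: algebra_simps)
  have Gper: "G (u + of_int m + of_int n * \<tau>) = G u" for u m n
  proof -
    have 1: "G (v + of_int m) = G v" for v
    proof (cases "m \<ge> 0")
      case True then show ?thesis using Gn1[of v "nat m"] by simp
    next
      case False then show ?thesis using Gn1[of "v + of_int m" "nat (- m)"] by simp
    qed
    have 2: "G (v + of_int n * \<tau>) = G v" for v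
    proof (cases "n \<ge> 0")
      case True then show ?thesis using Gn\<tau>[of v "nat n"] by simp
    next
      case False then show ?thesis using Gn\<tau>[of "v + of_int n * \<tau>" "nat (- n)"] by simp
    qed
    show ?thesis using 1 2 by metis
  qed
  have fhol: "f holomorphic_on UNIV" and ghol: "g holomorphic_on UNIV"
    unfolding f_def g_def using \<tau> \<sigma> \<tau>0 by (auto intro!: holomorphic_intros)
  have f': "(f has_field_derivative - 2 * of_real pi * \<i>) (at 0)"
    unfolding f_def by (rule has_field_derivative_theta_0[OF \<tau>])
  have f0: "f 0 = 0" unfolding f_def using theta_0_iff[OF \<tau>] by (metis add_0 mult_zero_left of_int_0)
  have "theta 0 \<sigma> = 0" using theta_0_iff[OF \<sigma>] by (metis add_0 mult_zero_left of_int_0)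
  have g0: "g 0 = 0" by (simp add: g_def \<open>theta 0 \<sigma> = 0\<close>)
  have "((\<lambda>u. theta (u / \<tau>) \<sigma>) has_field_derivative - 2 * of_real pi * \<i> * (1 / \<tau>)) (at 0)"
  proof (rule DERIV_chain2[where f = "\<lambda>u. theta u \<sigma>"])
    show "((\<lambda>u. theta u \<sigma>) has_field_derivative - 2 * of_real pi * \<i>) (at (0 / \<tau>))"
      using has_field_derivative_theta_0[OF \<sigma>] by simp
    show "((\<lambda>u. u / \<tau>) has_field_derivative 1 / \<tau>) (at 0)"
      using \<tau>0 by (auto intro!: derivative_eq_intros)
  qed
  then have g': "(g has_field_derivative - 2 * of_real pi * \<i> * (1 / \<tau>)) (at 0)"
    unfolding g_def by (auto intro!: derivative_eq_intros simp: \<open>theta 0 \<sigma> = 0\<close> \<tau>0)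
  \<comment> \<open>Dividing f and g by z leaves entire functions with \<open>G\<close> =
    \<open>h2\<close> / \<open>h1\<close> wherever \<open>h1\<close> is nonzero, in particular
    around 0, where \<open>h1\<close> takes the nonzero value of the derivative of f.\<close>
  define h1 where "h1 = (\<lambda>z. if z = 0 then deriv f 0 else (f z - f 0) / (z - 0))"
  define h2 where "h2 = (\<lambda>z. if z = 0 then deriv g 0 else (g z - g 0) / (z - 0))"
  have h1: "h1 holomorphic_on UNIV" and h2: "h2 holomorphic_on UNIV"
    unfolding h1_def h2_def using fhol ghol by (auto intro: pole_lemma)
  have Gh: "G z = h2 z / h1 z" if "h1 z \<noteq> 0" for z
    using that DERIV_imp_deriv[OF f'] DERIV_imp_deriv[OF g'] f0 g0 \<tau>0
    by (auto simp: G_def h1_def h2_def split: if_splits)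
  have diff: "G field_differentiable at z" if "h1 z \<noteq> 0" for z
  proof -
    have op: "open {z. h1 z \<noteq> 0}"
      using h1 holomorphic_on_imp_continuous_on by (intro open_Collect_neq) auto
    have "(\<lambda>z. h2 z / h1 z) holomorphic_on {z. h1 z \<noteq> 0}"
      using holomorphic_on_subset[OF h1] holomorphic_on_subset[OF h2] by (intro holomorphic_intros) auto
    then have "G holomorphic_on {z. h1 z \<noteq> 0}"
      by (rule holomorphic_transform) (simp add: Gh)
    then show ?thesis using op that holomorphic_on_imp_differentiable_at by blast
  qed
  have Ghol: "G holomorphic_on UNIV"
  proof -
    have "G field_differentiable at z" for z
    proof (cases "f z = 0")
      case False
      then have "h1 z \<noteq> 0" using f0 by (auto simp: h1_def)
      then show ?thesis by (rule diff)
    next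
      case True
      then obtain m n :: int where z: "z = of_int m + of_int n * \<tau>"
        using theta_0_iff[OF \<tau>] by (auto simp: f_def)
      have "h1 0 \<noteq> 0" using DERIV_imp_deriv[OF f'] by (simp add: h1_def)
      then obtain D where D: "(G has_field_derivative D) (at (z + (- z)))"
        using diff[of 0] by (auto simp: field_differentiable_def)
      have "((\<lambda>w. G (w + (- z))) has_field_derivative D) (at z)"
        using D DERIV_shift by blast
      moreover have "G (w + (- z)) = G w" for w
        using Gper[of w "- m" "- n"] by (simp add: z algebra_simps)
      ultimately show ?thesis by (auto simp: field_differentiable_def)
    qed
    then show ?thesis by (simp add: holomorphic_on_def field_differentiable_at_within)
  qed
  have "bounded (range G)"
  proof -
    let ?F = "\<lambda>p::real \<times> real. of_real (fst p) + of_real (snd p) * \<tau>"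
    have "compact (?F ` ({0..1} \<times> {0..1}))"
      by (intro compact_continuous_image continuous_intros compact_Times) auto
    then have "compact (G ` ?F ` ({0..1} \<times> {0..1}))"
      by (rule compact_continuous_image[OF holomorphic_on_imp_continuous_on[OF holomorphic_on_subset[OF Ghol]], rotated]) simp
    moreover have "range G \<subseteq> G ` ?F ` ({0..1} \<times> {0..1})"
    proof
      fix y assume "y \<in> range G"
      then obtain u where u: "y = G u" by blast
      define b where "b = Im u / Im \<tau>"
      define a where "a = Re u - b * Re \<tau>"
      have "u = of_real a + of_real b * \<tau>"
        using \<tau> by (simp add: complex_eq_iff a_def b_def)
      then have "u = ?F (frac a, frac b) + of_int \<lfloor>a\<rfloor> + of_int \<lfloor>b\<rfloor> * \<tau>"
        by (simp add: frac_def complex_eq_iff algebra_simps)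
      then have "y = G (?F (frac a, frac b))" using Gper u by metis
      moreover have "(frac a, frac b) \<in> {0..1} \<times> {0..1}"
        by (auto simp: less_imp_le frac_lt_1)
      ultimately show "y \<in> G ` ?F ` ({0..1} \<times> {0..1})" by blast
    qed
    ultimately show ?thesis using compact_imp_bounded bounded_subset by blast
  qed
  then obtain c where c: "\<And>z. G z = c"
    using Liouville_theorem[OF Ghol] by (auto simp: constant_on_def)
  have "c = 1 / \<tau>" using c[of 0] f0 by (simp add: G_def)
  have "g u = f u / \<tau>"
  proof (cases "f u = 0")
    case False
    then show ?thesis using c[of u] \<open>c = 1 / \<tau>\<close> \<tau>0 by (auto simp: G_def field_simps)
  next
    case True
    then obtain m n :: int where z: "u = of_int m + of_int n * \<tau>"
      using theta_0_iff[OF \<tau>] by (auto simp: f_def)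
    then have "u / \<tau> = of_int n + of_int (- m) * \<sigma>"
      using \<tau>0 by (simp add: \<sigma>_def field_simps)
    then have "theta (u / \<tau>) \<sigma> = 0" using theta_0_iff[OF \<sigma>] by blast
    then show ?thesis using True by (simp add: g_def)
  qed
  then have "theta (u / \<tau>) \<sigma> * (qe (- (u ^ 2) / (2 * \<tau>)) * qe (u ^ 2 / (2 * \<tau>))) = f u / \<tau> * qe (u ^ 2 / (2 * \<tau>))"
    by (simp add: g_def mult.assoc[symmetric])
  also have "qe (- (u ^ 2) / (2 * \<tau>)) * qe (u ^ 2 / (2 * \<tau>)) = 1"
    unfolding qe_add[symmetric] by simp
  finally show ?thesis by (simp add: f_def \<sigma>_def)
qed

section \<open>The modular group and Klein forms\<close>

text \<open>The determinant is left open: matrices of determinant 1 describe the modular group,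
  those of determinant p describe lattices of index p.\<close>

definition mob :: "int \<Rightarrow> int \<Rightarrow> int \<Rightarrow> int \<Rightarrow> complex \<Rightarrow> complex" where
  "mob a b c d \<tau> = (of_int a * \<tau> + of_int b) / (of_int c * \<tau> + of_int d)"

definition jfac :: "int \<Rightarrow> int \<Rightarrow> complex \<Rightarrow> complex" where
  "jfac c d \<tau> = of_int c * \<tau> + of_int d"

lemma jfac_nonzero: "Im \<tau> > 0 \<Longrightarrow> c \<noteq> 0 \<or> d \<noteq> 0 \<Longrightarrow> jfac c d \<tau> \<noteq> 0"
  by (auto simp: jfac_def complex_eq_iff)

lemma jfac_nonzero_det: "Im \<tau> > 0 \<Longrightarrow> a * d - b * c \<noteq> 0 \<Longrightarrow> jfac c d \<tau> \<noteq> 0"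
  by (rule jfac_nonzero) auto

lemma Im_mob:
  assumes "Im \<tau> > 0"
  shows "Im (mob a b c d \<tau>) = of_int (a * d - b * c) * Im \<tau> / norm (jfac c d \<tau>) ^ 2"
  unfolding mob_def jfac_def by (simp add: Im_divide cmod_power2 algebra_simps)

lemma Im_mob_pos:
  assumes "Im \<tau> > 0" "a * d - b * c > 0"
  shows "Im (mob a b c d \<tau>) > 0"
proof -
  have "of_int (a * d - b * c) * Im \<tau> > 0"
    using assms by (intro mult_pos_pos) (simp_all only: of_int_0_less_iff)
  then show ?thesis
    unfolding Im_mob[OF assms(1)] using assms jfac_nonzero_det[of \<tau> a d b c] by (intro divide_pos_pos) auto
qed

lemma
  assumes "Im \<tau> > 0" "a' * d' - b' * c' > 0"
  shows mob_mob: "mob a b c d (mob a' b' c' d' \<tau>) = mob (a*a'+b*c') (a*b'+b*d') (c*a'+d*c') (c*b'+d*d') \<tau>"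
    and jfac_mob: "jfac c d (mob a' b' c' d' \<tau>) * jfac c' d' \<tau> = jfac (c*a'+d*c') (c*b'+d*d') \<tau>"
proof -
  have nz: "of_int c' * \<tau> + of_int d' \<noteq> 0"
    using jfac_nonzero_det[OF assms(1), of a' d' b' c'] assms(2) by (simp add: jfac_def)
  show "jfac c d (mob a' b' c' d' \<tau>) * jfac c' d' \<tau> = jfac (c*a'+d*c') (c*b'+d*d') \<tau>"
    using nz by (simp add: jfac_def mob_def field_simps)
  have "mob a b c d (mob a' b' c' d' \<tau>) =
      ((of_int a * ((of_int a' * \<tau> + of_int b') / (of_int c' * \<tau> + of_int d')) + of_int b) * (of_int c' * \<tau> + of_int d')) /
      ((of_int c * ((of_int a' * \<tau> + of_int b') / (of_int c' * \<tau> + of_int d')) + of_int d) * (of_int c' * \<tau> + of_int d'))"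
    using nz by (simp add: mob_def)
  also have "\<dots> = mob (a*a'+b*c') (a*b'+b*d') (c*a'+d*c') (c*b'+d*d') \<tau>"
  proof -
    have *: "(A * (X / D) + B) * D = A * X + B * D" if "D \<noteq> 0" for A X D B :: complex
      using that by (simp add: field_simps)
    show ?thesis unfolding *[OF nz] by (simp add: mob_def algebra_simps)
  qed
  finally show "mob a b c d (mob a' b' c' d' \<tau>) = mob (a*a'+b*c') (a*b'+b*d') (c*a'+d*c') (c*b'+d*d') \<tau>" .
qed

lemma mob_translate [simp]: "mob 1 n 0 1 \<tau> = \<tau> + of_int n"
  by (simp add: mob_def)

lemma mob_invert [simp]: "mob 0 (-1) 1 0 \<tau> = - 1 / \<tau>"
  by (simp add: mob_def)

lemma jfac_simps [simp]: "jfac 0 1 \<tau> = 1" "jfac 1 0 \<tau> = \<tau>"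
  by (simp_all add: jfac_def)

lemma SL2_induct [consumes 1, case_names S T mult]:
  fixes a b c d :: int
  assumes "a * d - b * c = 1"
    and S: "P 0 (-1) 1 0"
    and T: "\<And>n. P 1 n 0 1"
    and mult: "\<And>a b c d a' b' c' d'. a * d - b * c = 1 \<Longrightarrow> a' * d' - b' * c' = 1 \<Longrightarrow> P a b c d \<Longrightarrow> P a' b' c' d' \<Longrightarrow>
       P (a*a'+b*c') (a*b'+b*d') (c*a'+d*c') (c*b'+d*d')"
  shows "P a b c d"
  using assms(1)
proof (induction "nat \<bar>c\<bar>" arbitrary: a b c d rule: less_induct)
  case less
  show ?case
  proof (cases "c = 0")
    case True
    then have "a * d = 1" using less.prems by simp
    then consider "a = 1" "d = 1" | "a = -1" "d = -1"
      using zmult_eq_1_iff by blast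
    then show ?thesis
    proof cases
      case 1 then show ?thesis using T True by simp
    next
      case 2
      have "P (-1) 0 0 (-1)" using mult[OF _ _ S S] by simp
      from mult[OF _ _ this T[of "- b"]] show ?thesis using 2 True by simp
    qed
  next
    case False
    define e where "e = a - (a div c) * c"
    define f where "f = b - (a div c) * d"
    have e: "e = a mod c" by (simp add: e_def minus_div_mult_eq_mod)
    have det: "c * (- f) - d * (- e) = 1"
      using less.prems by (simp add: e_def f_def algebra_simps)
    have "nat \<bar>- e\<bar> < nat \<bar>c\<bar>" using False e abs_mod_less[of c a] by simp
    then have "P c d (- e) (- f)" using less.hyps det by simp
    from mult[OF _ det S this] have "P e f c d" by simp
    moreover have "e * d - f * c = 1" using det by (simp add: algebra_simps)
    ultimately have "P (1 * e + (a div c) * c) (1 * f + (a div c) * d) (0 * e + 1 * c) (0 * f + 1 * d)"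
      using mult[OF _ _ T[of "a div c"]] by fastforce
    then show ?thesis by (simp add: e_def f_def)
  qed
qed

text \<open>\<open>F x y \<tau>\<close> stands for a function of the lattice Z \<tau> + Z and its
  point x \<tau> + y, homogeneous of degree - k. Rescaling by c \<tau> + d turns coordinates in the
  new basis into the row vector (x, y) times the matrix.\<close>

definition modular_family :: "nat \<Rightarrow> (real \<Rightarrow> real \<Rightarrow> complex \<Rightarrow> complex) \<Rightarrow> bool" where
  "modular_family k F \<longleftrightarrow> (\<forall>a b c d x y \<tau>. a * d - b * c = (1::int) \<longrightarrow> Im \<tau> > 0 \<longrightarrow>
     F x y (mob a b c d \<tau>) = jfac c d \<tau> ^ k * F (x * of_int a + y * of_int c) (x * of_int b + y * of_int d) \<tau>)"

lemma modular_familyD: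
  "modular_family k F \<Longrightarrow> a * d - b * c = 1 \<Longrightarrow> Im \<tau> > 0 \<Longrightarrow>
     F x y (mob a b c d \<tau>) = jfac c d \<tau> ^ k * F (x * of_int a + y * of_int c) (x * of_int b + y * of_int d) \<tau>"
  unfolding modular_family_def by blast

lemma modular_familyI:
  assumes T: "\<And>x y \<tau> n. Im \<tau> > 0 \<Longrightarrow> F x y (\<tau> + of_int n) = F x (x * of_int n + y) \<tau>"
    and S: "\<And>x y \<tau>. Im \<tau> > 0 \<Longrightarrow> F x y (- 1 / \<tau>) = \<tau> ^ k * F y (- x) \<tau>"
  shows "modular_family k F"
  unfolding modular_family_def
proof (intro allI impI)
  fix a b c d :: int and x y \<tau> assume "a * d - b * c = 1" "Im \<tau> > 0"
  then show "F x y (mob a b c d \<tau>) = jfac c d \<tau> ^ k * F (x * of_int a + y * of_int c) (x * of_int b + y * of_int d) \<tau>"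
  proof (induction arbitrary: x y \<tau> rule: SL2_induct)
    case S then show ?case using assms(2) by simp
  next
    case (T n) then show ?case using assms(1) by simp
  next
    case (mult a b c d a' b' c' d')
    have "Im (mob a' b' c' d' \<tau>) > 0" using mult by (intro Im_mob_pos) auto
    then have "F x y (mob a b c d (mob a' b' c' d' \<tau>)) = jfac c d (mob a' b' c' d' \<tau>) ^ k * (jfac c' d' \<tau> ^ k *
      F ((x * of_int a + y * of_int c) * of_int a' + (x * of_int b + y * of_int d) * of_int c')
        ((x * of_int a + y * of_int c) * of_int b' + (x * of_int b + y * of_int d) * of_int d') \<tau>)"
      using mult by simp
    also have "\<dots> = (jfac c d (mob a' b' c' d' \<tau>) * jfac c' d' \<tau>) ^ k *
      F ((x * of_int a + y * of_int c) * of_int a' + (x * of_int b + y * of_int d) * of_int c')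
        ((x * of_int a + y * of_int c) * of_int b' + (x * of_int b + y * of_int d) * of_int d') \<tau>"
      by (simp add: power_mult_distrib)
    also have "\<dots> = jfac (c*a'+d*c') (c*b'+d*d') \<tau> ^ k *
      F (x * of_int (a*a'+b*c') + y * of_int (c*a'+d*c')) (x * of_int (a*b'+b*d') + y * of_int (c*b'+d*d')) \<tau>"
      using mult by (subst jfac_mob) (auto simp: algebra_simps)
    finally show ?case using mult by (subst (asm) mob_mob) auto
  qed
qed

text \<open>While Im \<tau> < 1/2, translating to |Re| \<le> 1/2 makes the squared modulus at most
  1/2, so inversion at least doubles the imaginary part. The exponent n counts the doublings still
  allowed.\<close>

lemma exists_mob_Im_ge_half:
  assumes "Im \<tau> > 0"
  shows "\<exists>a b c d. a * d - b * c = 1 \<and> Im (mob a b c d \<tau>) \<ge> 1 / 2"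
proof -
  have "\<exists>a b c d. a * d - b * c = 1 \<and> Im (mob a b c d \<tau>) \<ge> 1 / 2"
    if "Im \<tau> > 0" "2 ^ n * Im \<tau> \<ge> 1 / 2" for n \<tau>
    using that
  proof (induction n arbitrary: \<tau>)
    case 0
    then show ?case by (intro exI[of _ 1] exI[of _ 0]) (simp add: mob_def)
  next
    case (Suc n)
    define m where "m = - round (Re \<tau>)"
    define \<tau>' where "\<tau>' = \<tau> + of_int m"
    have im: "Im \<tau>' = Im \<tau>" by (simp add: \<tau>'_def)
    have re: "\<bar>Re \<tau>'\<bar> \<le> 1 / 2"
      using of_int_round_abs_le[of "Re \<tau>"] by (simp add: \<tau>'_def m_def abs_minus_commute)
    show ?case
    proof (cases "Im \<tau> \<ge> 1 / 2")
      case True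
      then show ?thesis by (intro exI[of _ 1] exI[of _ 0]) (simp add: mob_def)
    next
      case False
      have "norm \<tau>' ^ 2 \<le> (1 / 2) ^ 2 + (1 / 2) ^ 2"
        unfolding cmod_power2 using False re Suc.prems im
        by (intro add_mono power2_le_iff_abs_le[THEN iffD2]) auto
      then have n2: "norm \<tau>' ^ 2 \<le> 1 / 2" by (simp add: power2_eq_square)
      have n0: "norm \<tau>' > 0" using Suc.prems im by auto
      have Im_S: "Im (mob 0 (-1) 1 0 \<tau>') = Im \<tau> / norm \<tau>' ^ 2"
        using Im_mob[of \<tau>' 0 "-1" 1 0] Suc.prems im by simp
      have "2 * Im \<tau> * norm \<tau>' ^ 2 \<le> 2 * Im \<tau> * (1 / 2)"
        using n2 Suc.prems by (intro mult_left_mono) auto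
      then have ge: "Im (mob 0 (-1) 1 0 \<tau>') \<ge> 2 * Im \<tau>"
        unfolding Im_S using n0 by (simp add: field_simps)
      have "2 ^ n * (2 * Im \<tau>) \<le> 2 ^ n * Im (mob 0 (-1) 1 0 \<tau>')"
        using ge by (intro mult_left_mono) auto
      then have "2 ^ n * Im (mob 0 (-1) 1 0 \<tau>') \<ge> 1 / 2" using Suc.prems(2) by simp
      moreover have "Im (mob 0 (-1) 1 0 \<tau>') > 0" using ge Suc.prems by linarith
      ultimately obtain a b c d where 1: "a * d - b * c = 1" "Im (mob a b c d (mob 0 (-1) 1 0 \<tau>')) \<ge> 1 / 2"
        using Suc.IH by blast
      have "\<tau>' = mob 1 m 0 1 \<tau>" by (simp add: \<tau>'_def)
      then have "mob a b c d (mob 0 (-1) 1 0 \<tau>') = mob a b c d (mob 0 (-1) 1 m \<tau>)"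
        using mob_mob[of \<tau> 1 1 m 0 0 "-1" 1 0] Suc.prems by simp
      also have "\<dots> = mob b (- a + b * m) d (- c + d * m) \<tau>"
        using mob_mob[of \<tau> 0 m "-1" 1 a b c d] Suc.prems by simp
      finally have "Im (mob b (- a + b * m) d (- c + d * m) \<tau>) \<ge> 1 / 2"
        using 1(2) by simp
      moreover have "b * (- c + d * m) - (- a + b * m) * d = 1"
        using 1(1) by (simp add: algebra_simps)
      ultimately show ?thesis by blast
    qed
  qed
  moreover obtain n where "1 / Im \<tau> < 2 ^ n"
    using real_arch_pow[of 2 "1 / Im \<tau>"] by auto
  then have "2 ^ n * Im \<tau> \<ge> 1 / 2" using assms by (simp add: field_simps)
  ultimately show ?thesis using assms by blast
qed

text \<open>The classical Klein form up to the factor \<open>- 2 pi i\<close>. As a function of a lattice and a point it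
  needs no multiplier system: \<open>(x, y)\<close> are the coordinates of the point with respect to \<open>\<tau>, 1\<close>.\<close>

definition klein :: "real \<Rightarrow> real \<Rightarrow> complex \<Rightarrow> complex" where
  "klein x y \<tau> = qe (of_real x * (of_real x * \<tau> + of_real y) / 2) * theta (of_real x * \<tau> + of_real y) \<tau>"

lemma klein_plus_1_right:
  assumes "Im \<tau> > 0"
  shows "klein x (y + 1) \<tau> = - qe (of_real x / 2) * klein x y \<tau>"
proof -
  have "klein x (y + 1) \<tau> = qe (of_real x * (of_real x * \<tau> + of_real y) / 2 + of_real x / 2) *
      theta (of_real x * \<tau> + of_real y + 1) \<tau>"
    by (simp add: klein_def add_ac add_divide_distrib distrib_left)
  then show ?thesis
    by (simp only: theta_plus_1[OF assms] qe_add klein_def mult_ac mult_minus_left mult_minus_right)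
qed

lemma klein_plus_1_left:
  assumes "Im \<tau> > 0"
  shows "klein (x + 1) y \<tau> = - qe (- of_real y / 2) * klein x y \<tau>"
proof -
  let ?u = "of_real x * \<tau> + of_real y"
  have "klein (x + 1) y \<tau> = qe (of_real (x + 1) * (?u + \<tau>) / 2) * theta (?u + \<tau>) \<tau>"
    by (simp add: klein_def algebra_simps)
  also have "theta (?u + \<tau>) \<tau> = - qe (- \<tau> / 2 - ?u) * theta ?u \<tau>"
    by (rule theta_plus_tau[OF assms])
  also have "qe (of_real (x + 1) * (?u + \<tau>) / 2) * (- qe (- \<tau> / 2 - ?u) * theta ?u \<tau>) =
     - (qe (of_real (x + 1) * (?u + \<tau>) / 2) * qe (- \<tau> / 2 - ?u)) * theta ?u \<tau>" by simp
  also have "qe (of_real (x + 1) * (?u + \<tau>) / 2) * qe (- \<tau> / 2 - ?u) = qe (- of_real y / 2) * qe (of_real x * ?u / 2)"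
    unfolding qe_add[symmetric] by (intro arg_cong[where f = qe]) (simp add: field_simps)
  finally show ?thesis by (simp add: klein_def)
qed

lemma klein_minus:
  assumes "Im \<tau> > 0"
  shows "klein (- x) (- y) \<tau> = - klein x y \<tau>"
proof -
  have "of_real (- x) * \<tau> + of_real (- y) = - (of_real x * \<tau> + of_real y)" by simp
  moreover have "of_real (- x) * - (of_real x * \<tau> + of_real y) = of_real x * (of_real x * \<tau> + of_real y)"
    by (simp only: of_real_minus minus_mult_minus)
  ultimately show ?thesis unfolding klein_def by (simp only: theta_minus[OF assms] mult_minus_right)
qed

lemma klein_0_iff:
  assumes "Im \<tau> > 0"
  shows "klein x y \<tau> = 0 \<longleftrightarrow> x \<in> \<int> \<and> y \<in> \<int>"
proof -
  have "klein x y \<tau> = 0 \<longleftrightarrow> (\<exists>m n :: int. of_real x * \<tau> + of_real y = of_int m + of_int n * \<tau>)"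
    by (simp add: klein_def theta_0_iff[OF assms])
  also have "\<dots> \<longleftrightarrow> (\<exists>m n :: int. y = of_int m \<and> x = of_int n)"
    using assms by (intro ex_cong1) (auto simp: complex_eq_iff)
  finally show ?thesis by (auto elim!: Ints_cases)
qed

lemma klein_translate:
  assumes "Im \<tau> > 0"
  shows "klein x y (\<tau> + of_int n) = klein x (x * of_int n + y) \<tau>"
proof -
  have "theta u (\<tau> + of_int n) = theta u \<tau>" for u
    by (simp add: theta_def qe_add qe_diff)
  then show ?thesis by (simp add: klein_def algebra_simps)
qed

text \<open>The exponential prefactor of \<open>klein\<close> is chosen to absorb the Gaussian
  factor of \<open>theta_inversion\<close>: with u = y \<tau> - x one has (x u + u^2) / (2 \<tau>) =
  y u / 2. What remains is weight - 1 without any multiplier.\<close>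

lemma klein_invert:
  assumes "Im \<tau> > 0"
  shows "klein x y (- 1 / \<tau>) = klein y (- x) \<tau> / \<tau>"
proof -
  have \<tau>0: "\<tau> \<noteq> 0" using assms by auto
  let ?u = "of_real y * \<tau> + of_real (- x)"
  have u: "of_real x * (- 1 / \<tau>) + of_real y = ?u / \<tau>"
    using \<tau>0 by (simp add: field_simps)
  have "klein x y (- 1 / \<tau>) = qe (of_real x * (?u / \<tau>) / 2) * (qe (?u ^ 2 / (2 * \<tau>)) / \<tau> * theta ?u \<tau>)"
    unfolding klein_def u theta_inversion[OF assms] ..
  also have "\<dots> = qe (of_real x * (?u / \<tau>) / 2) * qe (?u ^ 2 / (2 * \<tau>)) * theta ?u \<tau> / \<tau>" by simp
  also have "qe (of_real x * (?u / \<tau>) / 2) * qe (?u ^ 2 / (2 * \<tau>)) = qe (of_real y * ?u / 2)"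
    unfolding qe_add[symmetric] using \<tau>0
    by (intro arg_cong[where f = qe]) (simp add: field_simps power2_eq_square)
  finally show ?thesis by (simp add: klein_def)
qed

text \<open>One unit shift multiplies by - \<open>qe (- y / 2)\<close>, whose power 2 N is
  \<open>qe (- N y)\<close> = 1. The 2 removes both the sign and the half.\<close>

lemma klein_shift_left:
  assumes "Im \<tau> > 0" "real N * y \<in> \<int>"
  shows "klein (x + 2 * real N * of_int i) y \<tau> = klein x y \<tau>"
proof -
  have *: "klein (x + of_nat n) y \<tau> = (- qe (- of_real y / 2)) ^ n * klein x y \<tau>" for x n
    using klein_plus_1_left[OF assms(1), of "x + of_nat _" y] by (induction n) (simp_all add: add_ac)
  obtain m where m: "real N * y = of_int m" using assms(2) by (auto elim: Ints_cases)
  have "(- qe (- of_real y / 2)) ^ (2 * N) = qe (- of_real (real N * y))"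
    by (simp add: qe_power)
  also have "\<dots> = 1" unfolding m by (simp add: qe_minus)
  finally have "(- qe (- of_real y / 2)) ^ (2 * N) = 1" .
  then have **: "klein (x + of_nat (2 * N * k)) y \<tau> = klein x y \<tau>" for x k
    unfolding * power_mult by simp
  show ?thesis
  proof (cases "i \<ge> 0")
    case True
    then show ?thesis using **[of x "nat i"] by simp
  next
    case False
    then show ?thesis using **[of "x + 2 * real N * of_int i" "nat (- i)"] by simp
  qed
qed

lemma klein_shift_right:
  assumes "Im \<tau> > 0" "real N * x \<in> \<int>"
  shows "klein x (y + 2 * real N * of_int i) \<tau> = klein x y \<tau>"
proof -
  have *: "klein x (y + of_nat n) \<tau> = (- qe (of_real x / 2)) ^ n * klein x y \<tau>" for y n
    using klein_plus_1_right[OF assms(1), of x "y + of_nat _"] by (induction n) (simp_all add: add_ac)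
  obtain m where m: "real N * x = of_int m" using assms(2) by (auto elim: Ints_cases)
  have "(- qe (of_real x / 2)) ^ (2 * N) = qe (of_real (real N * x))"
    by (simp add: qe_power)
  also have "\<dots> = 1" unfolding m by simp
  finally have "(- qe (of_real x / 2)) ^ (2 * N) = 1" .
  then have **: "klein x (y + of_nat (2 * N * k)) \<tau> = klein x y \<tau>" for y k
    unfolding * power_mult by simp
  show ?thesis
  proof (cases "i \<ge> 0")
    case True
    then show ?thesis using **[of y "nat i"] by simp
  next
    case False
    then show ?thesis using **[of "y + 2 * real N * of_int i" "nat (- i)"] by simp
  qed
qed

lemma norm_klein_shift:
  assumes "Im \<tau> > 0"
  shows "norm (klein (x + of_int m) y \<tau>) = norm (klein x y \<tau>)"
proof -
  have 1: "norm (klein (x + 1) y \<tau>) = norm (klein x y \<tau>)" for x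
    using klein_plus_1_left[OF assms, of x y] by (simp add: norm_mult norm_qe)
  have n: "norm (klein (x + of_nat n) y \<tau>) = norm (klein x y \<tau>)" for x n
    using 1[of "x + of_nat _"] by (induction n) (simp_all add: add_ac)
  show ?thesis
  proof (cases "m \<ge> 0")
    case True
    then show ?thesis using n[of x "nat m"] by simp
  next
    case False
    then show ?thesis using n[of "x + of_int m" "nat (- m)"] by simp
  qed
qed

lemma holomorphic_on_klein:
  "(\<lambda>\<tau>. klein x y \<tau>) holomorphic_on {\<tau>. Im \<tau> > 0}"
  unfolding klein_def by (intro holomorphic_intros open_halfspace_Im_gt) auto

text \<open>The exponent comes from \<open>|qe (x u / 2) qe (- u / 2)|\<close> with \<open>u = x \<tau> + y\<close>.\<close>

lemma norm_inverse_klein_le_frac: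
  assumes "\<not> (x \<in> \<int> \<and> y \<in> \<int>)" "0 \<le> x" "x < 1"
  shows "\<exists>C>0. \<forall>\<tau>. Im \<tau> \<ge> 1 / 2 \<longrightarrow> norm (inverse (klein x y \<tau>)) \<le> C * exp (- pi * x * (1 - x) * Im \<tau>)"
proof -
  define r where "r = exp (- pi)"
  have r: "0 \<le> r" "r < 1" by (auto simp: r_def)
  obtain C where C: "C > 0" "\<And>q X. norm q \<le> r \<Longrightarrow> norm X \<le> 1 \<Longrightarrow> norm (qpoch q X) \<le> C"
    using norm_qpoch_le[OF r] by blast
  have q: "norm (qe \<tau>) \<le> r" if "Im \<tau> \<ge> 1 / 2" for \<tau>
    using that by (simp add: norm_qe r_def)
  have lower: "\<exists>c>0. \<forall>\<tau>. Im \<tau> \<ge> 1 / 2 \<longrightarrow> c \<le> norm (qpoch (qe \<tau>) (qe (of_real s * \<tau> + of_real w)))"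
    if "s > 0" for s w
  proof -
    have "exp (- pi * s) < 1" using that by simp
    then obtain c where c: "c > 0" "\<And>q X. norm q \<le> r \<Longrightarrow> norm X \<le> exp (- pi * s) \<Longrightarrow> c \<le> norm (qpoch q X)"
      using norm_qpoch_ge[OF r, of "exp (- pi * s)"] by auto
    have "norm (qe (of_real s * \<tau> + of_real w)) \<le> exp (- pi * s)" if "Im \<tau> \<ge> 1 / 2" for \<tau>
    proof -
      have "pi * s * (1 / 2) \<le> pi * s * Im \<tau>" using that \<open>s > 0\<close> by (intro mult_left_mono) auto
      then show ?thesis by (simp add: norm_qe algebra_simps)
    qed
    then show ?thesis using c q by blast
  qed
  have "\<exists>c>0. \<forall>\<tau>. Im \<tau> \<ge> 1 / 2 \<longrightarrow> c \<le> norm (qpoch (qe \<tau>) (qe (of_real x * \<tau> + of_real y)))"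
  proof (cases "x = 0")
    case False
    then show ?thesis using lower[of x y] assms by simp
  next
    \<comment> \<open>For x = 0 the argument \<open>qe y\<close> has modulus 1, out of reach of
      \<open>lower\<close>. The first factor is a nonzero constant since y is not an integer; the
      rest is covered by \<open>lower\<close> with s = 1.\<close>
    case True
    then have "y \<notin> \<int>" using assms by simp
    then have "qe (of_real y) \<noteq> 1"
      unfolding qe_eq_1_iff by simp
    then have pos: "norm (1 - qe (of_real y)) > 0" by simp
    obtain c where c: "c > 0" "\<forall>\<tau>. Im \<tau> \<ge> 1 / 2 \<longrightarrow> c \<le> norm (qpoch (qe \<tau>) (qe (of_real 1 * \<tau> + of_real y)))"
      using lower[of 1 y] by auto
    have "norm (1 - qe (of_real y)) * c \<le> norm (qpoch (qe \<tau>) (qe (of_real x * \<tau> + of_real y)))"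
      if "Im \<tau> \<ge> 1 / 2" for \<tau>
    proof -
      have "qpoch (qe \<tau>) (qe (of_real x * \<tau> + of_real y)) = (1 - qe (of_real y)) * qpoch (qe \<tau>) (qe (of_real 1 * \<tau> + of_real y))"
        using qpoch_rec[of "qe \<tau>" "qe (of_real y)"] that True by (simp add: qe_add)
      then show ?thesis using c(2) that pos by (simp add: norm_mult)
    qed
    then show ?thesis using pos c(1) by (intro exI[of _ "norm (1 - qe (of_real y)) * c"]) auto
  qed
  then obtain c1 where c1: "c1 > 0" "\<And>\<tau>. Im \<tau> \<ge> 1 / 2 \<Longrightarrow> c1 \<le> norm (qpoch (qe \<tau>) (qe (of_real x * \<tau> + of_real y)))"
    by blast
  obtain c2 where c2: "c2 > 0" "\<And>\<tau>. Im \<tau> \<ge> 1 / 2 \<Longrightarrow> c2 \<le> norm (qpoch (qe \<tau>) (qe (of_real (1 - x) * \<tau> + of_real (- y))))"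
    using lower[of "1 - x" "- y"] assms by auto
  have "norm (inverse (klein x y \<tau>)) \<le> C ^ 2 / (c1 * c2) * exp (- pi * x * (1 - x) * Im \<tau>)"
    if \<tau>: "Im \<tau> \<ge> 1 / 2" for \<tau>
  proof -
    let ?u = "of_real x * \<tau> + of_real y"
    have "norm (qe (of_real x * ?u / 2)) * norm (qe (- ?u / 2)) = exp (pi * x * (1 - x) * Im \<tau>)"
      unfolding norm_qe exp_add[symmetric] by (simp add: field_simps)
    then have eq: "norm (inverse (klein x y \<tau>)) = norm (qpoch (qe \<tau>) (qe \<tau>)) ^ 2 /
       (exp (pi * x * (1 - x) * Im \<tau>) * (norm (qpoch (qe \<tau>) (qe ?u)) * norm (qpoch (qe \<tau>) (qe (\<tau> - ?u)))))"
      by (simp add: klein_def theta_def norm_mult norm_divide norm_power norm_inverse field_simps)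
    have "\<tau> - ?u = of_real (1 - x) * \<tau> + of_real (- y)" by (simp add: algebra_simps)
    then have "c2 \<le> norm (qpoch (qe \<tau>) (qe (\<tau> - ?u)))"
      using c2(2)[OF \<tau>] by (simp only:)
    then have "c1 * c2 \<le> norm (qpoch (qe \<tau>) (qe ?u)) * norm (qpoch (qe \<tau>) (qe (\<tau> - ?u)))"
      using c1(2)[OF \<tau>] c1(1) c2(1) by (intro mult_mono) simp_all
    moreover have "norm (qpoch (qe \<tau>) (qe \<tau>)) \<le> C"
      using C(2) q[OF \<tau>] r by (meson less_imp_le order_trans)
    ultimately have "norm (inverse (klein x y \<tau>)) \<le> C ^ 2 / (exp (pi * x * (1 - x) * Im \<tau>) * (c1 * c2))"
      unfolding eq using c1(1) c2(1) C(1)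
      by (intro frac_le power_mono mult_left_mono) auto
    moreover have "exp (- pi * x * (1 - x) * Im \<tau>) = inverse (exp (pi * x * (1 - x) * Im \<tau>))"
      by (simp add: exp_minus[symmetric])
    ultimately show ?thesis by (simp add: divide_inverse mult_ac)
  qed
  then show ?thesis using C(1) c1(1) c2(1) by (intro exI[of _ "C ^ 2 / (c1 * c2)"]) auto
qed

lemma norm_inverse_klein_le:
  assumes "\<not> (x \<in> \<int> \<and> y \<in> \<int>)"
  shows "\<exists>C>0. \<forall>\<tau>. Im \<tau> \<ge> 1 / 2 \<longrightarrow>
    norm (inverse (klein x y \<tau>)) \<le> C * exp (- pi * frac x * (1 - frac x) * Im \<tau>)"
proof -
  have "\<not> (frac x \<in> \<int> \<and> y \<in> \<int>)"
    using assms by (metis Ints_add Ints_of_int diff_add_cancel frac_def)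
  then obtain C where C: "C > 0" "\<forall>\<tau>. Im \<tau> \<ge> 1 / 2 \<longrightarrow>
      norm (inverse (klein (frac x) y \<tau>)) \<le> C * exp (- pi * frac x * (1 - frac x) * Im \<tau>)"
    using norm_inverse_klein_le_frac[of "frac x" y] frac_lt_1[of x] by auto
  have "norm (klein x y \<tau>) = norm (klein (frac x) y \<tau>)" if "Im \<tau> \<ge> 1 / 2" for \<tau>
    using norm_klein_shift[of \<tau> "frac x" "\<lfloor>x\<rfloor>" y] that by (simp add: frac_def)
  then show ?thesis using C by (auto simp: norm_inverse)
qed

lemma modular_family_inverse_klein: "modular_family 1 (\<lambda>x y \<tau>. inverse (klein x y \<tau>))"
proof (rule modular_familyI)
  fix x y :: real and \<tau> :: complex assume \<tau>: "Im \<tau> > 0"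
  show "inverse (klein x y (\<tau> + of_int n)) = inverse (klein x (x * of_int n + y) \<tau>)" for n
    by (simp only: klein_translate[OF \<tau>])
  show "inverse (klein x y (- 1 / \<tau>)) = \<tau> ^ 1 * inverse (klein y (- x) \<tau>)"
    unfolding klein_invert[OF \<tau>] by (simp add: divide_inverse)
qed

section \<open>Sturm's bound\<close>

text \<open>|h|^2 y^k is the quantity that weight k slash operators merely move around, so one
  global bound speaks about all cusps at once. The square keeps the exponent of y an
  integer.\<close>

definition weight_bounded :: "nat \<Rightarrow> (complex \<Rightarrow> complex) \<Rightarrow> bool" where
  "weight_bounded k h \<longleftrightarrow> (\<exists>C. \<forall>\<tau>. Im \<tau> > 0 \<longrightarrow> norm (h \<tau>) ^ 2 * Im \<tau> ^ k \<le> C)"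

lemma weight_bounded_add:
  assumes "weight_bounded k f" "weight_bounded k g"
  shows "weight_bounded k (\<lambda>\<tau>. f \<tau> + g \<tau>)"
proof -
  obtain C D where C: "\<And>\<tau>. Im \<tau> > 0 \<Longrightarrow> norm (f \<tau>) ^ 2 * Im \<tau> ^ k \<le> C"
    and D: "\<And>\<tau>. Im \<tau> > 0 \<Longrightarrow> norm (g \<tau>) ^ 2 * Im \<tau> ^ k \<le> D"
    using assms unfolding weight_bounded_def by blast
  have "norm (f \<tau> + g \<tau>) ^ 2 * Im \<tau> ^ k \<le> 2 * C + 2 * D" if "Im \<tau> > 0" for \<tau>
  proof -
    have "norm (f \<tau> + g \<tau>) ^ 2 \<le> (norm (f \<tau>) + norm (g \<tau>)) ^ 2"
      by (intro power_mono norm_triangle_ineq) auto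
    also have "\<dots> \<le> 2 * norm (f \<tau>) ^ 2 + 2 * norm (g \<tau>) ^ 2"
      using sum_squares_bound[of "norm (f \<tau>)" "norm (g \<tau>)"] by (simp add: power2_sum)
    finally have "norm (f \<tau> + g \<tau>) ^ 2 * Im \<tau> ^ k \<le> (2 * norm (f \<tau>) ^ 2 + 2 * norm (g \<tau>) ^ 2) * Im \<tau> ^ k"
      using that by (intro mult_right_mono) auto
    then show ?thesis using C[OF that] D[OF that] by (simp add: algebra_simps)
  qed
  then show ?thesis unfolding weight_bounded_def by blast
qed

lemma weight_bounded_cmult:
  assumes "weight_bounded k f"
  shows "weight_bounded k (\<lambda>\<tau>. c * f \<tau>)"
proof -
  obtain C where C: "\<And>\<tau>. Im \<tau> > 0 \<Longrightarrow> norm (f \<tau>) ^ 2 * Im \<tau> ^ k \<le> C"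
    using assms unfolding weight_bounded_def by blast
  have "norm (c * f \<tau>) ^ 2 * Im \<tau> ^ k \<le> norm c ^ 2 * C" if "Im \<tau> > 0" for \<tau>
    using mult_left_mono[OF C[OF that], of "norm c ^ 2"] by (simp add: norm_mult power_mult_distrib mult_ac)
  then show ?thesis unfolding weight_bounded_def by blast
qed

lemma weight_bounded_sum:
  "(\<And>i. i \<in> I \<Longrightarrow> weight_bounded k (f i)) \<Longrightarrow> weight_bounded k (\<lambda>\<tau>. \<Sum>i\<in>I. f i \<tau>)"
proof (induction I rule: infinite_finite_induct)
  case (insert i I)
  then show ?case by (simp add: weight_bounded_add)
qed (auto simp: weight_bounded_def)

text \<open>A cusp form of weight k for the principal congruence subgroup of level M; the growth
  condition replaces expansions at the individual cusps.\<close>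

definition level_form :: "nat \<Rightarrow> int \<Rightarrow> (complex \<Rightarrow> complex) \<Rightarrow> bool" where
  "level_form k M h \<longleftrightarrow> h holomorphic_on {\<tau>. Im \<tau> > 0} \<and>
     (\<forall>a b c d \<tau>. a * d - b * c = 1 \<longrightarrow> M dvd a - 1 \<longrightarrow> M dvd b \<longrightarrow> M dvd c \<longrightarrow> M dvd d - 1 \<longrightarrow>
        Im \<tau> > 0 \<longrightarrow> h (mob a b c d \<tau>) = jfac c d \<tau> ^ k * h \<tau>) \<and>
     weight_bounded k h"

lemma level_form_cmult: "level_form k M f \<Longrightarrow> level_form k M (\<lambda>\<tau>. c * f \<tau>)"
  unfolding level_form_def by (auto intro!: holomorphic_intros weight_bounded_cmult)

lemma level_form_sum:
  assumes "\<And>i. i \<in> I \<Longrightarrow> level_form k M (f i)"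
  shows "level_form k M (\<lambda>\<tau>. \<Sum>i\<in>I. f i \<tau>)"
  using assms unfolding level_form_def
  by (auto intro!: holomorphic_intros weight_bounded_sum simp: sum_distrib_left)

text \<open>The value 0 off the half-plane makes translates that agree on it equal as functions, so
  that orbits can be counted as sets.\<close>

definition slash :: "nat \<Rightarrow> (complex \<Rightarrow> complex) \<Rightarrow> int \<Rightarrow> int \<Rightarrow> int \<Rightarrow> int \<Rightarrow> complex \<Rightarrow> complex" where
  "slash k f a b c d = (\<lambda>\<tau>. if Im \<tau> > 0 then f (mob a b c d \<tau>) / jfac c d \<tau> ^ k else 0)"

lemma slash_slash:
  assumes "a' * d' - b' * c' = 1"
  shows "slash k (slash k f a b c d) a' b' c' d' = slash k f (a*a'+b*c') (a*b'+b*d') (c*a'+d*c') (c*b'+d*d')"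
proof
  fix \<tau>
  show "slash k (slash k f a b c d) a' b' c' d' \<tau> = slash k f (a*a'+b*c') (a*b'+b*d') (c*a'+d*c') (c*b'+d*d') \<tau>"
  proof (cases "Im \<tau> > 0")
    case True
    have "a' * d' - b' * c' > 0" using assms by simp
    note mm = Im_mob_pos[OF True this] mob_mob[OF True this] jfac_mob[OF True this]
    show ?thesis
      using True mm by (simp add: slash_def power_mult_distrib[symmetric] del: power_mult_distrib)
  qed (simp add: slash_def)
qed

lemma slash_1: "Im \<tau> > 0 \<Longrightarrow> slash k f 1 0 0 1 \<tau> = f \<tau>"
  by (simp add: slash_def)

lemma holomorphic_on_mob:
  assumes "a * d - b * c \<noteq> 0"
  shows "(\<lambda>\<tau>. mob a b c d \<tau>) holomorphic_on {\<tau>. Im \<tau> > 0}"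
  unfolding mob_def using jfac_nonzero_det[of _ a d b c] assms
  by (intro holomorphic_intros) (auto simp: jfac_def)

lemma holomorphic_on_mob_compose:
  assumes "f holomorphic_on {\<tau>. Im \<tau> > 0}" "a * d - b * c > 0"
  shows "(\<lambda>\<tau>. f (mob a b c d \<tau>) / jfac c d \<tau> ^ k) holomorphic_on {\<tau>. Im \<tau> > 0}"
proof -
  have "(f \<circ> mob a b c d) holomorphic_on {\<tau>. Im \<tau> > 0}"
    using assms Im_mob_pos[of _ a d b c]
    by (intro holomorphic_on_compose_gen[OF holomorphic_on_mob assms(1)]) auto
  then show ?thesis
    using jfac_nonzero_det[of _ a d b c] assms unfolding jfac_def o_def
    by (intro holomorphic_intros) auto
qed

lemma holomorphic_on_slash:
  assumes "f holomorphic_on {\<tau>. Im \<tau> > 0}" "a * d - b * c = 1"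
  shows "slash k f a b c d holomorphic_on {\<tau>. Im \<tau> > 0}"
  by (rule holomorphic_transform[OF holomorphic_on_mob_compose[OF assms(1), of a d b c k]])
    (use assms in \<open>simp_all add: slash_def\<close>)

lemma norm_slash:
  assumes "Im \<tau> > 0" "a * d - b * c = 1"
  shows "norm (slash k f a b c d \<tau>) ^ 2 * Im \<tau> ^ k = norm (f (mob a b c d \<tau>)) ^ 2 * Im (mob a b c d \<tau>) ^ k"
proof -
  have "jfac c d \<tau> \<noteq> 0" using jfac_nonzero_det[of _ a d b c] assms by auto
  then show ?thesis using assms(1)
    by (simp add: slash_def Im_mob assms norm_divide norm_power power_divide power_mult[symmetric] mult.commute)
qed

text \<open>Matrices congruent modulo M differ by a left factor from the principal congruence
  subgroup, which fixes h. Hence a translate depends only on the four residues of the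
  entries.\<close>

lemma finite_slash_orbit:
  assumes h: "level_form k M h" and M: "M > 0"
  defines "S \<equiv> {slash k h a b c d | a b c d. a * d - b * c = 1}"
  shows "finite S" "card S \<le> nat M ^ 4"
proof -
  let ?Q = "{(a,b,c,d). a * d - b * c = (1::int)}"
  let ?f = "\<lambda>(a,b,c,d). slash k h a b c d"
  let ?key = "\<lambda>(a,b,c,d). (a mod M, b mod M, c mod M, d mod M)"
  have S: "S = ?f ` ?Q" by (force simp: S_def)
  have eq: "?f x = ?f y" if xy: "x \<in> ?Q" "y \<in> ?Q" "?key x = ?key y" for x y
  proof -
    obtain a b c d where x: "x = (a,b,c,d)" by (metis prod_cases4)
    obtain a' b' c' d' where y: "y = (a',b',c',d')" by (metis prod_cases4)
    have det: "a * d - b * c = 1" "a' * d' - b' * c' = 1" using xy x y by auto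
    have cg: "M dvd a - a'" "M dvd b - b'" "M dvd c - c'" "M dvd d - d'"
      using xy(3) by (auto simp: x y mod_eq_dvd_iff)
    \<comment> \<open>The entries of the matrix (a b; c d) times the inverse of (a' b'; c'
      d').\<close>
    define p q r s where "p = a*d' - b*c'" and "q = b*a' - a*b'" and "r = c*d' - d*c'" and "s = d*a' - c*b'"
    have ps: "p * s - q * r = 1"
    proof -
      have "p * s - q * r = (a * d - b * c) * (a' * d' - b' * c')"
        by (simp add: p_def q_def r_def s_def algebra_simps)
      then show ?thesis using det by simp
    qed
    have "p - 1 = (a - a') * d' - (b - b') * c'" using det by (simp add: p_def algebra_simps)
    then have 1: "M dvd p - 1" using cg by simp
    have "q = (b - b') * a' - (a - a') * b'" by (simp add: q_def algebra_simps)
    then have 2: "M dvd q" using cg by simp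
    have "r = (c - c') * d' - (d - d') * c'" by (simp add: r_def algebra_simps)
    then have 3: "M dvd r" using cg by simp
    have "s - 1 = (d - d') * a' - (c - c') * b'" using det by (simp add: s_def algebra_simps)
    then have 4: "M dvd s - 1" using cg by simp
    have "a = p*a'+q*c'" "b = p*b'+q*d'" "c = r*a'+s*c'" "d = r*b'+s*d'"
    proof -
      have "p*a'+q*c' = a * (a' * d' - b' * c')" "p*b'+q*d' = b * (a' * d' - b' * c')"
        "r*a'+s*c' = c * (a' * d' - b' * c')" "r*b'+s*d' = d * (a' * d' - b' * c')"
        by (simp_all add: p_def q_def r_def s_def algebra_simps)
      then show "a = p*a'+q*c'" "b = p*b'+q*d'" "c = r*a'+s*c'" "d = r*b'+s*d'"
        using det by simp_all
    qed
    then have "?f x = slash k (slash k h p q r s) a' b' c' d'"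
      by (subst slash_slash[OF det(2)]) (simp add: x)
    also have "\<dots> = slash k h a' b' c' d'"
    proof
      fix \<tau>
      have "slash k h p q r s (mob a' b' c' d' \<tau>) = h (mob a' b' c' d' \<tau>)" if \<tau>: "Im \<tau> > 0"
      proof -
        have im: "Im (mob a' b' c' d' \<tau>) > 0" using det \<tau> by (intro Im_mob_pos) auto
        then have "h (mob p q r s (mob a' b' c' d' \<tau>)) = jfac r s (mob a' b' c' d' \<tau>) ^ k * h (mob a' b' c' d' \<tau>)"
          using h ps 1 2 3 4 unfolding level_form_def by blast
        moreover have "jfac r s (mob a' b' c' d' \<tau>) \<noteq> 0" using jfac_nonzero_det[OF im, of p s q r] ps by simp
        ultimately show ?thesis using im by (simp add: slash_def)
      qed
      then show "slash k (slash k h p q r s) a' b' c' d' \<tau> = slash k h a' b' c' d' \<tau>"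
        by (simp add: slash_def[of _ _ a' b' c' d'])
    qed
    finally show ?thesis by (simp add: y)
  qed
  let ?K = "{0..<M} \<times> {0..<M} \<times> {0..<M} \<times> {0..<M}"
  have sub: "?key ` ?Q \<subseteq> ?K" using M by auto
  have fin: "finite ?K" by simp
  have "S = (\<lambda>v. ?f (inv_into ?Q ?key v)) ` (?key ` ?Q)"
  proof -
    have "?f (inv_into ?Q ?key (?key x)) = ?f x" if "x \<in> ?Q" for x
      using that by (intro eq inv_into_into f_inv_into_f) auto
    then show ?thesis unfolding S image_image by (intro image_cong) auto
  qed
  then show "finite S" "card S \<le> nat M ^ 4"
  proof -
    assume *: "S = (\<lambda>v. ?f (inv_into ?Q ?key v)) ` (?key ` ?Q)"
    have fk: "finite (?key ` ?Q)" using sub fin by (rule finite_subset)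
    then show "finite S" using * by (metis finite_imageI)
    have "card S \<le> card (?key ` ?Q)" using * fk by (metis card_image_le)
    also have "\<dots> \<le> card ?K" using sub fin by (intro card_mono)
    also have "\<dots> = nat M ^ 4" by (simp add: card_cartesian_product power4_eq_xxxx)
    finally show "card S \<le> nat M ^ 4" .
  qed
qed

section \<open>Vanishing of rapidly decaying forms of level 1\<close>

lemma tendsto_exp_power_0:
  fixes c :: real
  assumes "c > 0"
  shows "((\<lambda>y. exp (- c * y) * y ^ K) \<longlongrightarrow> 0) at_top"
proof -
  have "filterlim (\<lambda>y. c * y) at_top at_top"
    using assms by (intro filterlim_tendsto_pos_mult_at_top[OF tendsto_const] filterlim_ident)
  then have "((\<lambda>y. (c * y) ^ K / exp (c * y)) \<longlongrightarrow> 0) at_top"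
    by (rule filterlim_compose[OF tendsto_power_div_exp_0])
  then have "((\<lambda>y. inverse (c ^ K) * ((c * y) ^ K / exp (c * y))) \<longlongrightarrow> inverse (c ^ K) * 0) at_top"
    by (intro tendsto_intros)
  moreover have "inverse (c ^ K) * ((c * y) ^ K / exp (c * y)) = exp (- c * y) * y ^ K" for y
    using assms by (simp add: power_mult_distrib exp_minus divide_inverse)
  ultimately show ?thesis by simp
qed

lemma attains_sup_periodic_decaying:
  fixes \<Psi> :: "complex \<Rightarrow> real"
  assumes cont: "continuous_on {\<tau>. Im \<tau> \<ge> y} \<Psi>"
    and per: "\<And>\<tau> n. Im \<tau> \<ge> y \<Longrightarrow> \<Psi> (\<tau> + of_int n) = \<Psi> \<tau>"
    and dec: "\<And>e. e > 0 \<Longrightarrow> \<exists>Y. \<forall>\<tau>. Im \<tau> \<ge> Y \<longrightarrow> \<Psi> \<tau> < e"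
    and pos: "Im \<tau>1 \<ge> y" "\<Psi> \<tau>1 > 0"
  shows "\<exists>\<tau>0. Im \<tau>0 \<ge> y \<and> (\<forall>\<tau>. Im \<tau> \<ge> y \<longrightarrow> \<Psi> \<tau> \<le> \<Psi> \<tau>0)"
proof -
  obtain Y where Y: "\<And>\<tau>. Im \<tau> \<ge> Y \<Longrightarrow> \<Psi> \<tau> < \<Psi> \<tau>1" using dec[OF pos(2)] by blast
  let ?K = "cbox (Complex 0 y) (Complex 1 Y)"
  have K: "\<tau> \<in> ?K \<longleftrightarrow> 0 \<le> Re \<tau> \<and> Re \<tau> \<le> 1 \<and> y \<le> Im \<tau> \<and> Im \<tau> \<le> Y" for \<tau>
    by (auto simp: in_cbox_complex_iff)
  have rep: "\<exists>\<tau>'\<in>?K. \<Psi> \<tau>' = \<Psi> \<tau>" if "y \<le> Im \<tau>" "Im \<tau> \<le> Y" for \<tau>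
    using that per[of \<tau> "- \<lfloor>Re \<tau>\<rfloor>"] by (intro bexI[of _ "\<tau> + of_int (- \<lfloor>Re \<tau>\<rfloor>)"]) (auto simp: K, linarith+)
  have "Im \<tau>1 \<le> Y" using Y[of \<tau>1] by (meson less_irrefl linear)
  then have "?K \<noteq> {}" using rep[of \<tau>1] pos by auto
  moreover have "continuous_on ?K \<Psi>" using cont by (rule continuous_on_subset) (auto simp: K)
  ultimately obtain \<tau>0 where \<tau>0: "\<tau>0 \<in> ?K" "\<And>\<tau>. \<tau> \<in> ?K \<Longrightarrow> \<Psi> \<tau> \<le> \<Psi> \<tau>0"
    using continuous_attains_sup[of ?K \<Psi>] compact_cbox by blast
  have le: "\<Psi> \<tau> \<le> \<Psi> \<tau>0" if "Im \<tau> \<ge> y" "Im \<tau> \<le> Y" for \<tau>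
    using rep[of \<tau>] that \<tau>0(2) by metis
  have "\<Psi> \<tau> \<le> \<Psi> \<tau>0" if "Im \<tau> \<ge> y" for \<tau>
    using le[OF that] Y[of \<tau>] le[of \<tau>1] \<open>Im \<tau>1 \<le> Y\<close> pos(1) by (cases "Im \<tau> \<le> Y") auto
  then show ?thesis using \<tau>0(1) K by blast
qed

text \<open>Compare the maximum point \<open>\<tau>0\<close> of the invariant function \<open>|P|\<^sup>2 y ^ K\<close> with the line at half its
  height: the maximum modulus principle for \<open>P qe (- m \<tau>)\<close> contradicts maximality as soon as
  \<open>exp (pi m) > 2 ^ K\<close>.\<close>

lemma level_one_vanishing:
  fixes P :: "complex \<Rightarrow> complex"
  assumes hol: "P holomorphic_on {\<tau>. Im \<tau> > 0}"
    and inv: "\<And>a b c d \<tau>. a * d - b * c = 1 \<Longrightarrow> Im \<tau> > 0 \<Longrightarrow> P (mob a b c d \<tau>) = jfac c d \<tau> ^ K * P \<tau>"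
    and dec: "\<And>\<tau>. Im \<tau> \<ge> 1 / 4 \<Longrightarrow> norm (P \<tau>) \<le> D * exp (- 2 * pi * \<beta> * Im \<tau>)"
    and \<beta>: "\<beta> > real K + 1"
    and \<tau>: "Im \<tau> > 0"
  shows "P \<tau> = 0"
proof (rule ccontr)
  assume nz: "P \<tau> \<noteq> 0"
  have contP: "continuous_on {\<tau>. Im \<tau> > 0} P" using hol by (rule holomorphic_on_imp_continuous_on)
  have per: "P (\<tau> + of_int n) = P \<tau>" if "Im \<tau> > 0" for \<tau> n
    using inv[of 1 1 n 0 \<tau>] that by simp
  define \<Phi> where "\<Phi> \<tau> = norm (P \<tau>) ^ 2 * Im \<tau> ^ K" for \<tau>
  have \<Phi>inv: "\<Phi> (mob a b c d \<tau>) = \<Phi> \<tau>" if "a * d - b * c = 1" "Im \<tau> > 0" for a b c d \<tau>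
  proof -
    have "jfac c d \<tau> \<noteq> 0" using jfac_nonzero_det[of _ a d b c] that by auto
    then show ?thesis using that
      by (simp add: \<Phi>_def Im_mob inv norm_mult norm_power power_mult_distrib power_divide power_mult[symmetric] mult.commute)
  qed
  have D: "D \<ge> 0"
  proof -
    have "0 \<le> D * exp (- 2 * pi * \<beta> * Im \<i>)" using order_trans[OF norm_ge_zero dec[of \<i>]] by simp
    then show ?thesis by (simp add: zero_le_mult_iff)
  qed
  obtain a b c d where abcd: "a * d - b * c = 1" "Im (mob a b c d \<tau>) \<ge> 1 / 2"
    using exists_mob_Im_ge_half[OF \<tau>] by blast
  have "\<Phi> (mob a b c d \<tau>) > 0" using \<Phi>inv[OF abcd(1) \<tau>] nz \<tau> by (simp add: \<Phi>_def)
  then have "\<exists>\<tau>0. Im \<tau>0 \<ge> 1 / 2 \<and> (\<forall>\<tau>. Im \<tau> \<ge> 1 / 2 \<longrightarrow> \<Phi> \<tau> \<le> \<Phi> \<tau>0)"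
  proof (intro attains_sup_periodic_decaying[OF _ _ _ abcd(2)])
    show "continuous_on {\<tau>. Im \<tau> \<ge> 1 / 2} \<Phi>"
      unfolding \<Phi>_def by (intro continuous_intros continuous_on_subset[OF contP]) auto
    show "\<Phi> (\<tau> + of_int n) = \<Phi> \<tau>" if "Im \<tau> \<ge> 1 / 2" for \<tau> n
      using that per[of \<tau> n] by (simp add: \<Phi>_def)
    fix e :: real assume e: "e > 0"
    have "((\<lambda>y. D ^ 2 * (exp (- (2 * pi * \<beta>) * y) ^ 2 * y ^ K)) \<longlongrightarrow> D ^ 2 * 0) at_top"
    proof (intro tendsto_mult tendsto_const)
      have "4 * pi * \<beta> > 0" using \<beta> by simp
      moreover have "exp (- (2 * pi * \<beta>) * y) ^ 2 = exp (- (4 * pi * \<beta>) * y)" for y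
        by (simp add: power2_eq_square exp_add[symmetric])
      ultimately show "((\<lambda>y. exp (- (2 * pi * \<beta>) * y) ^ 2 * y ^ K) \<longlongrightarrow> 0) at_top"
        using tendsto_exp_power_0[of "4 * pi * \<beta>" K] by simp
    qed
    then have "\<forall>\<^sub>F y in at_top. D ^ 2 * (exp (- (2 * pi * \<beta>) * y) ^ 2 * y ^ K) < e"
      using e by (simp add: order_tendstoD(2))
    then obtain Y where Y: "\<And>y. y \<ge> Y \<Longrightarrow> D ^ 2 * (exp (- (2 * pi * \<beta>) * y) ^ 2 * y ^ K) < e"
      unfolding eventually_at_top_linorder by blast
    have "\<Phi> \<tau> < e" if "Im \<tau> \<ge> max Y 1" for \<tau>
    proof -
      have "\<Phi> \<tau> \<le> (D * exp (- 2 * pi * \<beta> * Im \<tau>)) ^ 2 * Im \<tau> ^ K"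
        unfolding \<Phi>_def using that by (intro mult_right_mono power_mono dec) auto
      also have "\<dots> < e" using Y[of "Im \<tau>"] that by (simp add: power_mult_distrib mult_ac)
      finally show ?thesis .
    qed
    then show "\<exists>Y. \<forall>\<tau>. Im \<tau> \<ge> Y \<longrightarrow> \<Phi> \<tau> < e" by blast
  qed
  then obtain \<tau>0 where \<tau>0: "Im \<tau>0 \<ge> 1 / 2" "\<And>\<tau>. Im \<tau> \<ge> 1 / 2 \<Longrightarrow> \<Phi> \<tau> \<le> \<Phi> \<tau>0"
    by blast
  have \<tau>0max: "\<Phi> \<tau>' \<le> \<Phi> \<tau>0" if "Im \<tau>' > 0" for \<tau>'
  proof -
    obtain a b c d where "a * d - b * c = 1" "Im (mob a b c d \<tau>') \<ge> 1 / 2"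
      using exists_mob_Im_ge_half[OF \<open>Im \<tau>' > 0\<close>] by blast
    then show ?thesis using \<tau>0(2) \<Phi>inv that by metis
  qed
  have "\<Phi> \<tau> > 0" using nz \<tau> by (simp add: \<Phi>_def)
  then have P0: "P \<tau>0 \<noteq> 0" using \<tau>0max[OF \<tau>] by (auto simp: \<Phi>_def)
  \<comment> \<open>Two demands on m: it stays below \<beta>, so that \<open>G\<close> still decays
    at infinity, and it exceeds K, so that exp (4 pi m y1) beats 2^K, as y1 \<ge> 1/4 gives 4 pi y1
    \<ge> 1.\<close>
  define m where "m = real K + 1"
  define y1 where "y1 = Im \<tau>0 / 2"
  have y1: "y1 \<ge> 1 / 4" "y1 < Im \<tau>0" "y1 > 0" using \<tau>0(1) by (auto simp: y1_def)
  define G where "G \<tau> = P \<tau> * qe (- (of_real m * \<tau>))" for \<tau>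
  have nG: "norm (G \<tau>) = norm (P \<tau>) * exp (2 * pi * m * Im \<tau>)" for \<tau>
    by (simp add: G_def norm_mult norm_qe)
  have Gdec: "\<exists>Y. \<forall>\<tau>. Im \<tau> \<ge> Y \<longrightarrow> norm (G \<tau>) < e" if e: "e > 0" for e
  proof -
    have "((\<lambda>y. D * exp (- (2 * pi * (\<beta> - m)) * y)) \<longlongrightarrow> D * 0) at_top"
    proof (intro tendsto_mult tendsto_const)
      have "2 * pi * (\<beta> - m) > 0" using \<beta> by (simp add: m_def)
      then show "((\<lambda>y. exp (- (2 * pi * (\<beta> - m)) * y)) \<longlongrightarrow> 0) at_top"
        using tendsto_exp_power_0[of "2 * pi * (\<beta> - m)" 0] by simp
    qed
    then have "\<forall>\<^sub>F y in at_top. D * exp (- (2 * pi * (\<beta> - m)) * y) < e"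
      using e by (simp add: order_tendstoD(2))
    then obtain Y where Y: "\<And>y. y \<ge> Y \<Longrightarrow> D * exp (- (2 * pi * (\<beta> - m)) * y) < e"
      unfolding eventually_at_top_linorder by blast
    have "norm (G \<tau>) < e" if "Im \<tau> \<ge> max Y 1" for \<tau>
    proof -
      have "norm (G \<tau>) \<le> D * exp (- 2 * pi * \<beta> * Im \<tau>) * exp (2 * pi * m * Im \<tau>)"
        unfolding nG using that by (intro mult_right_mono dec) auto
      also have "\<dots> = D * exp (- (2 * pi * (\<beta> - m)) * Im \<tau>)"
        by (simp add: exp_add[symmetric] algebra_simps)
      also have "\<dots> < e" using Y[of "Im \<tau>"] that by simp
      finally show ?thesis .
    qed
    then show ?thesis by blast
  qed
  have Ghol: "G holomorphic_on {\<tau>. Im \<tau> > 0}"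
    unfolding G_def by (intro holomorphic_intros hol)
  have "\<exists>\<tau>2. Im \<tau>2 \<ge> y1 \<and> (\<forall>\<tau>. Im \<tau> \<ge> y1 \<longrightarrow> norm (G \<tau>) \<le> norm (G \<tau>2))"
  proof (rule attains_sup_periodic_decaying[OF _ _ Gdec])
    show "continuous_on {\<tau>. Im \<tau> \<ge> y1} (\<lambda>\<tau>. norm (G \<tau>))"
      using y1 by (intro continuous_intros continuous_on_subset[OF holomorphic_on_imp_continuous_on[OF Ghol]]) auto
    show "norm (G (\<tau> + of_int n)) = norm (G \<tau>)" if "Im \<tau> \<ge> y1" for \<tau> n
      using that per[of \<tau> n] y1 by (simp add: nG)
    show "Im \<tau>0 \<ge> y1" using y1 by simp
    show "norm (G \<tau>0) > 0" using P0 by (simp add: G_def)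
  qed
  then obtain \<tau>2 where \<tau>2: "Im \<tau>2 \<ge> y1" "\<And>\<tau>. Im \<tau> \<ge> y1 \<Longrightarrow> norm (G \<tau>) \<le> norm (G \<tau>2)"
    by blast
  have "Im \<tau>2 = y1"
  proof (rule ccontr)
    assume "Im \<tau>2 \<noteq> y1"
    then have "Im \<tau>2 > y1" using \<tau>2 by simp
    have "G constant_on {\<tau>. Im \<tau> > y1}"
    proof (rule maximum_modulus_principle)
      show "G holomorphic_on {\<tau>. Im \<tau> > y1}" using Ghol by (rule holomorphic_on_subset) (use y1 in auto)
      show "connected {\<tau>. Im \<tau> > y1}" by (intro convex_connected convex_halfspace_Im_gt)
      show "\<tau>2 \<in> {\<tau>. Im \<tau> > y1}" using \<open>Im \<tau>2 > y1\<close> by simp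
      show "norm (G z) \<le> norm (G \<tau>2)" if "z \<in> {\<tau>. Im \<tau> > y1}" for z using that \<tau>2(2) by simp
    qed (auto simp: open_halfspace_Im_gt)
    then obtain g where g: "\<And>\<tau>. Im \<tau> > y1 \<Longrightarrow> G \<tau> = g" by (auto simp: constant_on_def)
    have "norm g > 0" using g[of \<tau>0] y1 P0 by (auto simp: G_def)
    then obtain Y where "\<And>\<tau>. Im \<tau> \<ge> Y \<Longrightarrow> norm (G \<tau>) < norm g" using Gdec by blast
    from this[of "Complex 0 (max Y (y1 + 1))"] show False
      using g[of "Complex 0 (max Y (y1 + 1))"] by simp
  qed
  have "norm (G \<tau>0) \<le> norm (G \<tau>2)" using \<tau>2(2)[of \<tau>0] y1 by simp
  then have "norm (P \<tau>0) * exp (2 * pi * m * Im \<tau>0) \<le> norm (P \<tau>2) * exp (2 * pi * m * y1)"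
    unfolding nG \<open>Im \<tau>2 = y1\<close> .
  then have "(norm (P \<tau>0) * exp (2 * pi * m * Im \<tau>0)) ^ 2 * y1 ^ K \<le> (norm (P \<tau>2) * exp (2 * pi * m * y1)) ^ 2 * y1 ^ K"
    using y1 by (intro mult_right_mono power_mono) auto
  also have "\<dots> = \<Phi> \<tau>2 * exp (2 * pi * m * y1) ^ 2"
    by (simp add: \<Phi>_def \<open>Im \<tau>2 = y1\<close> power_mult_distrib)
  also have "\<dots> \<le> \<Phi> \<tau>0 * exp (2 * pi * m * y1) ^ 2"
    using \<tau>0max[of \<tau>2] y1 \<open>Im \<tau>2 = y1\<close> by (intro mult_right_mono) auto
  also have "\<dots> = norm (P \<tau>0) ^ 2 * (2 ^ K * y1 ^ K) * exp (2 * pi * m * y1) ^ 2"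
    by (simp add: \<Phi>_def y1_def power_mult_distrib[symmetric] del: power_mult_distrib)
  finally have "norm (P \<tau>0) ^ 2 * y1 ^ K * exp (2 * pi * m * Im \<tau>0) ^ 2 \<le>
      norm (P \<tau>0) ^ 2 * y1 ^ K * (2 ^ K * exp (2 * pi * m * y1) ^ 2)"
    by (simp add: power_mult_distrib mult_ac)
  then have "exp (2 * pi * m * Im \<tau>0) ^ 2 \<le> 2 ^ K * exp (2 * pi * m * y1) ^ 2"
    using P0 y1 by simp
  moreover have "exp (2 * pi * m * Im \<tau>0) ^ 2 = exp (2 * pi * m * y1) ^ 2 * exp (4 * pi * m * y1)"
    unfolding exp_double[symmetric] exp_of_nat_mult[symmetric] exp_add[symmetric]
    by (simp add: y1_def power2_eq_square exp_add[symmetric])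
  ultimately have "exp (4 * pi * m * y1) \<le> 2 ^ K"
    by (simp add: mult.commute)
  moreover have "2 ^ K < exp (4 * pi * m * y1)"
  proof -
    have "(2::real) ^ K \<le> exp 1 ^ K"
      using exp_ge_add_one_self[of 1] by (intro power_mono) auto
    also have "\<dots> = exp (real K)" by (simp add: exp_of_nat_mult[symmetric])
    also have "\<dots> < exp (4 * pi * m * y1)"
    proof -
      have "real K < m * 1" by (simp add: m_def)
      also have "m * 1 \<le> m * (pi * (4 * y1))"
      proof (intro mult_left_mono)
        have "1 * 1 \<le> pi * (4 * y1)" using y1 pi_ge_two by (intro mult_mono) auto
        then show "1 \<le> pi * (4 * y1)" by simp
      qed (simp add: m_def)
      finally show ?thesis by (simp add: mult_ac)
    qed
    finally show ?thesis .
  qed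
  ultimately show False by simp
qed

lemma powser_tail_bound:
  fixes a :: "nat \<Rightarrow> complex"
  assumes conv: "summable (\<lambda>n. a n * z ^ n)" and z: "0 \<le> r" "r < norm z" and zero: "\<And>n. n < B \<Longrightarrow> a n = 0"
  shows "\<exists>D\<ge>0. \<forall>w. norm w \<le> r \<longrightarrow> norm (\<Sum>n. a n * w ^ n) \<le> D * norm w ^ B"
proof -
  have summ: "summable (\<lambda>n. norm (a (n + B)) * r ^ n)"
  proof -
    have "summable (\<lambda>n. norm (a n * (of_real r) ^ n))"
      using powser_insidea[OF conv, of "of_real r"] z by simp
    then have "summable (\<lambda>n. norm (a (n + B) * (of_real r) ^ (n + B)))"
      by (subst summable_iff_shift)
    then have *: "summable (\<lambda>n. r ^ B * (norm (a (n + B)) * r ^ n))"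
      using z by (simp add: norm_mult norm_power power_add mult_ac)
    show ?thesis
    proof (cases "r = 0")
      case True
      show ?thesis unfolding True by (rule summable_finite[of "{0}"]) auto
    next
      case False
      then show ?thesis using * by (simp add: summable_cmult_iff)
    qed
  qed
  have "norm (\<Sum>n. a n * w ^ n) \<le> (\<Sum>n. norm (a (n + B)) * r ^ n) * norm w ^ B" if w: "norm w \<le> r" for w
  proof -
    have sw: "summable (\<lambda>n. a n * w ^ n)"
      using powser_inside[OF conv, of w] w z by simp
    have "(\<Sum>n. a n * w ^ n) = (\<Sum>n. a (n + B) * w ^ (n + B)) + (\<Sum>n<B. a n * w ^ n)"
      by (rule suminf_split_initial_segment[OF sw])
    also have "(\<Sum>n<B. a n * w ^ n) = 0" using zero by simp
    finally have eq: "(\<Sum>n. a n * w ^ n) = (\<Sum>n. a (n + B) * w ^ (n + B))" by simp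
    have bd: "norm (a (n + B) * w ^ (n + B)) \<le> norm w ^ B * (norm (a (n + B)) * r ^ n)" for n
    proof -
      have "norm (a (n + B) * w ^ (n + B)) = norm w ^ B * (norm (a (n + B)) * norm w ^ n)"
        by (simp add: norm_mult norm_power power_add mult_ac)
      also have "\<dots> \<le> norm w ^ B * (norm (a (n + B)) * r ^ n)"
        using w by (intro mult_left_mono power_mono) auto
      finally show ?thesis .
    qed
    have "norm (\<Sum>n. a (n + B) * w ^ (n + B)) \<le> (\<Sum>n. norm w ^ B * (norm (a (n + B)) * r ^ n))"
      by (rule norm_suminf_le[OF bd summable_mult[OF summ]])
    then show ?thesis using eq summ by (simp add: suminf_mult mult.commute)
  qed
  moreover have "(\<Sum>n. norm (a (n + B)) * r ^ n) \<ge> 0"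
    using summ z by (intro suminf_nonneg) auto
  ultimately show ?thesis by blast
qed

lemma fsigma_upper_half_plane: "fsigma {\<tau>. Im \<tau> > 0}"
proof -
  have "{\<tau>. Im \<tau> > 0} = (\<Union>n::nat. {\<tau>. Im \<tau> \<ge> inverse (real (Suc n))})"
    using reals_Archimedean by (auto intro: less_imp_le less_le_trans[of 0 "inverse (real (Suc _))"])
  then show ?thesis
    using fsigma.intros[of "\<lambda>n. {\<tau>. Im \<tau> \<ge> inverse (real (Suc n))}"] by (simp add: closed_halfspace_Im_ge)
qed

text \<open>The finitely many slash translates of \<open>h\<close> are permuted by the modular group, so their
  product is a form of level 1, and it inherits the decay of \<open>h\<close> at infinity.\<close>

theorem sturm_bound:
  fixes k :: nat and M :: int and L :: nat
  assumes M: "M > 0" and L: "L > 0"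
  shows "\<exists>B. \<forall>h a. level_form k M h \<longrightarrow>
           (\<forall>\<tau>. Im \<tau> > 0 \<longrightarrow> (\<lambda>n. a n * qe (\<tau> / of_nat L) ^ n) sums h \<tau>) \<longrightarrow>
           (\<forall>n<B. a n = 0) \<longrightarrow> (\<forall>\<tau>. Im \<tau> > 0 \<longrightarrow> h \<tau> = 0)"
proof (intro exI allI impI)
  fix h and a :: "nat \<Rightarrow> complex" and \<tau>
  \<comment> \<open>The product over the orbit has weight K \<le> k M^4. Vanishing of h to order B
    in the L-th root of q gives decay rate B / L = k M^4 + 2 > K + 1, as
    \<open>level_one_vanishing\<close> asks.\<close>
  define B where "B = L * (k * nat M ^ 4 + 2)"
  assume h: "level_form k M h"
    and ser: "\<forall>\<tau>. Im \<tau> > 0 \<longrightarrow> (\<lambda>n. a n * qe (\<tau> / of_nat L) ^ n) sums h \<tau>"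
    and a0: "\<forall>n < L * (k * nat M ^ 4 + 2). a n = 0"
    and \<tau>: "Im \<tau> > 0"
  let ?H = "{\<tau>. Im \<tau> > 0}"
  define S where "S = {slash k h a b c d | a b c d. a * d - b * c = 1}"
  have fin: "finite S" and card: "card S \<le> nat M ^ 4"
    unfolding S_def by (rule finite_slash_orbit[OF h M])+
  obtain C where C: "\<And>\<tau>. Im \<tau> > 0 \<Longrightarrow> norm (h \<tau>) ^ 2 * Im \<tau> ^ k \<le> C"
    using h by (auto simp: level_form_def weight_bounded_def)
  have Shol: "f holomorphic_on ?H" if "f \<in> S" for f
    using that h holomorphic_on_slash by (auto simp: S_def level_form_def)
  have Sbd: "norm (f \<tau>) ^ 2 * Im \<tau> ^ k \<le> C" if "f \<in> S" "Im \<tau> > 0" for f \<tau>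
    using that by (auto simp: S_def norm_slash Im_mob_pos intro!: C)
  define P where "P \<tau> = (\<Prod>f\<in>S. f \<tau>)" for \<tau>
  define K where "K = k * card S"
  have Pinv: "P (mob a b c d \<tau>) = jfac c d \<tau> ^ K * P \<tau>" if det: "a * d - b * c = 1" and \<tau>: "Im \<tau> > 0" for a b c d \<tau>
  proof -
    let ?s = "\<lambda>f. slash k f a b c d"
    have sub: "?s ` S \<subseteq> S"
    proof
      fix g assume "g \<in> ?s ` S"
      then obtain a' b' c' d' where g: "g = ?s (slash k h a' b' c' d')" and det': "a' * d' - b' * c' = 1"
        by (auto simp: S_def)
      have "(a'*a+b'*c) * (c'*b+d'*d) - (a'*b+b'*d) * (c'*a+d'*c) = (a' * d' - b' * c') * (a * d - b * c)"
        by (simp add: algebra_simps)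
      then have "(a'*a+b'*c) * (c'*b+d'*d) - (a'*b+b'*d) * (c'*a+d'*c) = 1" using det det' by simp
      then show "g \<in> S" unfolding g slash_slash[OF det] S_def by blast
    qed
    moreover have "S \<subseteq> ?s ` S"
    proof
      fix g assume "g \<in> S"
      then obtain a' b' c' d' where g: "g = slash k h a' b' c' d'" and det': "a' * d' - b' * c' = 1"
        by (auto simp: S_def)
      let ?g = "slash k h (a'*d-b'*c) (b'*a-a'*b) (c'*d-d'*c) (d'*a-c'*b)"
      have "(a'*d-b'*c) * (d'*a-c'*b) - (b'*a-a'*b) * (c'*d-d'*c) = (a' * d' - b' * c') * (a * d - b * c)"
        by (simp add: algebra_simps)
      then have "(a'*d-b'*c) * (d'*a-c'*b) - (b'*a-a'*b) * (c'*d-d'*c) = 1" using det det' by simp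
      then have "?g \<in> S" unfolding S_def by blast
      moreover have "?s ?g = g"
      proof -
        have "(a'*d-b'*c)*a+(b'*a-a'*b)*c = a' * (a * d - b * c)" "(a'*d-b'*c)*b+(b'*a-a'*b)*d = b' * (a * d - b * c)"
          "(c'*d-d'*c)*a+(d'*a-c'*b)*c = c' * (a * d - b * c)" "(c'*d-d'*c)*b+(d'*a-c'*b)*d = d' * (a * d - b * c)"
          by (simp_all add: algebra_simps)
        then show ?thesis unfolding slash_slash[OF det] g using det by simp
      qed
      ultimately show "g \<in> ?s ` S" by blast
    qed
    ultimately have "?s ` S = S" by blast
    then have "bij_betw ?s S S" using fin by (simp add: bij_betw_def eq_card_imp_inj_on)
    then have "(\<Prod>f\<in>S. ?s f \<tau>) = P \<tau>"
      unfolding P_def by (rule prod.reindex_bij_betw)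
    moreover have "f (mob a b c d \<tau>) = jfac c d \<tau> ^ k * ?s f \<tau>" for f
      using jfac_nonzero_det[of \<tau> a d b c] det \<tau> by (simp add: slash_def)
    then have "P (mob a b c d \<tau>) = (\<Prod>f\<in>S. jfac c d \<tau> ^ k * ?s f \<tau>)"
      unfolding P_def by (intro prod.cong refl)
    ultimately show ?thesis
      by (simp add: prod.distrib K_def power_mult)
  qed
  have hS: "slash k h 1 0 0 1 \<in> S" unfolding S_def by fastforce
  have "\<exists>D. \<forall>\<tau>. Im \<tau> \<ge> 1 / 4 \<longrightarrow> norm (P \<tau>) \<le> D * exp (- 2 * pi * (real B / real L) * Im \<tau>)"
  proof -
    have Im_div: "Im (\<tau> / of_nat L) = Im \<tau> / real L" for \<tau>
      by (simp add: Im_divide_of_nat)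
    define r where "r = exp (- 2 * pi * (1 / 4) / real L)"
    \<comment> \<open>Height 1/8 lies below 1/4, so summability there gives a disc strictly larger
      than the radius r belonging to height 1/4.\<close>
    have z: "summable (\<lambda>n. a n * qe (Complex 0 (1 / 8) / of_nat L) ^ n)"
      using ser[rule_format, of "Complex 0 (1/8)"] by (simp add: sums_iff)
    have r: "r < norm (qe (Complex 0 (1 / 8) / of_nat L))"
      using L unfolding r_def norm_qe Im_div by (simp add: field_simps)
    obtain D where D: "D \<ge> 0" "\<And>w. norm w \<le> r \<Longrightarrow> norm (\<Sum>n. a n * w ^ n) \<le> D * norm w ^ B"
      using powser_tail_bound[OF z _ r, of B] a0 unfolding B_def r_def by auto
    have hb: "norm (h \<tau>) \<le> D * exp (- 2 * pi * (real B / real L) * Im \<tau>)" if \<tau>: "Im \<tau> \<ge> 1 / 4" for \<tau>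
    proof -
      have "h \<tau> = (\<Sum>n. a n * qe (\<tau> / of_nat L) ^ n)"
        using ser[rule_format, of \<tau>] \<tau> by (simp add: sums_iff)
      moreover have "norm (qe (\<tau> / of_nat L)) \<le> r"
        using L \<tau> unfolding r_def norm_qe Im_div by (simp add: field_simps)
      ultimately have "norm (h \<tau>) \<le> D * norm (qe (\<tau> / of_nat L)) ^ B" using D(2) by simp
      also have "norm (qe (\<tau> / of_nat L)) ^ B = exp (- 2 * pi * (real B / real L) * Im \<tau>)"
        unfolding norm_qe Im_div exp_of_nat_mult[symmetric] by (simp add: field_simps)
      finally show ?thesis .
    qed
    \<comment> \<open>Nothing is known about the expansions of the other translates. The invariant
      bound C alone keeps them bounded above height 1/4, and the decay comes from the single factor
      h.\<close>
    have other: "norm (f \<tau>) \<le> 1 + C * 4 ^ k" if "f \<in> S" "Im \<tau> \<ge> 1 / 4" for f \<tau>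
    proof -
      have "norm (f \<tau>) ^ 2 * (1 / 4) ^ k \<le> norm (f \<tau>) ^ 2 * Im \<tau> ^ k"
        using that by (intro mult_left_mono power_mono) auto
      also have "\<dots> \<le> C" using Sbd that by simp
      finally have "norm (f \<tau>) ^ 2 \<le> C * 4 ^ k" by (simp add: power_divide field_simps)
      moreover have "norm (f \<tau>) \<le> 1 + norm (f \<tau>) ^ 2"
        using sum_squares_bound[of 1 "norm (f \<tau>)"] zero_le_power2[of "norm (f \<tau>)"]
        by (simp add: power2_eq_square) (smt (verit) mult_nonneg_nonneg norm_ge_zero)
      ultimately show ?thesis by simp
    qed
    have "norm (P \<tau>) \<le> (D * (\<Prod>f\<in>S - {slash k h 1 0 0 1}. 1 + C * 4 ^ k)) * exp (- 2 * pi * (real B / real L) * Im \<tau>)"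
      if \<tau>: "Im \<tau> \<ge> 1 / 4" for \<tau>
    proof -
      have "P \<tau> = slash k h 1 0 0 1 \<tau> * (\<Prod>f\<in>S - {slash k h 1 0 0 1}. f \<tau>)"
        unfolding P_def by (rule prod.remove[OF fin hS])
      then have "norm (P \<tau>) = norm (h \<tau>) * (\<Prod>f\<in>S - {slash k h 1 0 0 1}. norm (f \<tau>))"
        using \<tau> by (simp add: slash_1 norm_mult prod_norm)
      also have "\<dots> \<le> (D * exp (- 2 * pi * (real B / real L) * Im \<tau>)) * (\<Prod>f\<in>S - {slash k h 1 0 0 1}. 1 + C * 4 ^ k)"
        using \<tau> D(1) by (intro mult_mono prod_mono hb) (auto intro: other prod_nonneg)
      finally show ?thesis by (simp add: mult_ac)
    qed
    then show ?thesis by blast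
  qed
  then obtain D where D: "\<And>\<tau>. Im \<tau> \<ge> 1 / 4 \<Longrightarrow> norm (P \<tau>) \<le> D * exp (- 2 * pi * (real B / real L) * Im \<tau>)"
    by blast
  have "K \<le> k * nat M ^ 4" using card by (simp add: K_def)
  then have "real K \<le> real (k * nat M ^ 4)" by (simp only: of_nat_le_iff)
  then have \<beta>: "real B / real L > real K + 1"
    using L unfolding B_def of_nat_mult[of L] by simp
  have Phol: "P holomorphic_on ?H" unfolding P_def by (intro holomorphic_intros Shol)
  have P0: "P \<tau> = 0" if "Im \<tau> > 0" for \<tau>
    by (rule level_one_vanishing[OF Phol Pinv D \<beta> that])
  \<comment> \<open>A product that vanishes on the half-plane has a factor that does: otherwise the
    half-plane would be a finite union of countable zero sets.\<close>
  have "\<exists>f\<in>S. \<forall>\<tau>. Im \<tau> > 0 \<longrightarrow> f \<tau> = 0"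
  proof (rule ccontr)
    assume neg: "\<not> ?thesis"
    have "countable {z \<in> ?H. f z = 0}" if f: "f \<in> S" for f
    proof (cases "f constant_on ?H")
      case True
      then obtain c where c: "\<And>z. Im z > 0 \<Longrightarrow> f z = c" by (auto simp: constant_on_def)
      then have "c \<noteq> 0" using neg f by blast
      then have "{z \<in> ?H. f z = 0} = {}" using c by auto
      then show ?thesis by (metis countable_empty)
    next
      case False
      then show ?thesis
        using Shol[OF f] by (intro holomorphic_countable_zeros fsigma_upper_half_plane)
          (auto simp: open_halfspace_Im_gt convex_connected convex_halfspace_Im_gt)
    qed
    then have "countable (\<Union>f\<in>S. {z \<in> ?H. f z = 0})"
      using fin by (intro countable_UN) (auto intro: countable_finite)
    moreover have "?H \<subseteq> (\<Union>f\<in>S. {z \<in> ?H. f z = 0})"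
      using P0 fin by (auto simp: P_def prod_zero_iff)
    ultimately have "countable ?H" by (rule countable_subset[rotated])
    moreover have "ball \<i> 1 \<subseteq> ?H"
    proof
      fix z assume "z \<in> ball \<i> 1"
      then have "\<bar>Im (\<i> - z)\<bar> < 1" using abs_Im_le_cmod[of "\<i> - z"] by (simp add: dist_norm)
      then show "z \<in> ?H" by simp
    qed
    then have "uncountable ?H"
      using uncountable_ball[of 1 \<i>] countable_subset by auto
    ultimately show False by simp
  qed
  then obtain a b c d where det: "a * d - b * c = 1" and z: "\<And>\<tau>. Im \<tau> > 0 \<Longrightarrow> slash k h a b c d \<tau> = 0"
    by (auto simp: S_def)
  have "slash k (slash k h a b c d) d (- b) (- c) a = slash k h 1 0 0 1"
    using det by (subst slash_slash) (simp_all add: algebra_simps)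
  moreover have "slash k (slash k h a b c d) d (- b) (- c) a \<tau> = 0"
    using z[OF Im_mob_pos[OF \<tau>, of d a "- b" "- c"]] det by (simp add: slash_def[of _ _ d] mult.commute)
  ultimately show "h \<tau> = 0" using \<tau> by (simp add: slash_1)
qed

section \<open>Integral power series and regular partitions\<close>

text \<open>The expansion alone concerns a germ at 0. Holomorphy on the unit disc makes the series
  converge at every value of \<open>qe\<close> on the half-plane.\<close>

definition int_series :: "(complex \<Rightarrow> complex) \<Rightarrow> int fps \<Rightarrow> bool" where
  "int_series g F \<longleftrightarrow> g holomorphic_on ball 0 1 \<and> g has_fps_expansion Abs_fps (\<lambda>n. of_int (fps_nth F n))"

lemma int_series_sums:
  assumes "int_series g F" "norm w < 1"
  shows "(\<lambda>n. of_int (fps_nth F n) * w ^ n) sums g w"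
proof -
  have "(\<lambda>n. (deriv ^^ n) g 0 / fact n * (w - 0) ^ n) sums g w"
    using assms by (intro holomorphic_power_series[of g 0 1]) (auto simp: int_series_def)
  moreover have "(deriv ^^ n) g 0 / fact n = of_int (fps_nth F n)" for n
    using fps_nth_fps_expansion[of g "Abs_fps (\<lambda>n. of_int (fps_nth F n))" n] assms by (simp add: int_series_def)
  ultimately show ?thesis by simp
qed

lemma int_series_1: "int_series (\<lambda>_. 1) 1"
proof -
  have "Abs_fps (\<lambda>n. of_int (fps_nth 1 n)) = (1 :: complex fps)"
    by (rule fps_ext) simp
  then show ?thesis by (simp add: int_series_def)
qed

lemma fps_of_int_mult:
  "Abs_fps (\<lambda>n. of_int (fps_nth (F * G) n)) =
     (Abs_fps (\<lambda>n. of_int (fps_nth F n)) * Abs_fps (\<lambda>n. of_int (fps_nth G n)) :: complex fps)"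
  by (rule fps_ext) (simp add: fps_mult_nth)

lemma int_series_mult:
  assumes "int_series f F" "int_series g G"
  shows "int_series (\<lambda>w. f w * g w) (F * G)"
  using assms unfolding int_series_def fps_of_int_mult
  by (intro conjI holomorphic_intros has_fps_expansion_mult) auto

lemma int_series_inverse:
  assumes "int_series f F" "G * F = 1" "\<And>w. norm w < 1 \<Longrightarrow> f w \<noteq> 0"
  shows "int_series (\<lambda>w. inverse (f w)) G"
proof -
  let ?F = "Abs_fps (\<lambda>n. of_int (fps_nth F n)) :: complex fps"
  let ?G = "Abs_fps (\<lambda>n. of_int (fps_nth G n)) :: complex fps"
  have "?G * ?F = Abs_fps (\<lambda>n. of_int (fps_nth 1 n))"
    unfolding fps_of_int_mult[symmetric] assms(2) ..
  also have "\<dots> = 1" by (rule fps_ext) simp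
  finally have GF: "?G * ?F = 1" .
  then have "fps_nth (?G * ?F) 0 = 1" by simp
  then have F0: "fps_nth ?F 0 \<noteq> 0" by (auto simp: fps_mult_nth_0)
  have "?G = ?G * (?F * inverse ?F)" using inverse_mult_eq_1'[OF F0] by simp
  also have "\<dots> = inverse ?F" by (simp only: mult.assoc[symmetric] GF mult_1)
  finally have "?G = inverse ?F" .
  moreover have "(\<lambda>w. inverse (f w)) has_fps_expansion inverse ?F"
    using assms(1) F0 by (intro has_fps_expansion_inverse) (auto simp: int_series_def)
  ultimately show ?thesis
    using assms unfolding int_series_def by (auto intro!: holomorphic_intros)
qed

lemma int_series_inverse_ex:
  assumes "int_series f F" "fps_nth F 0 = 1" "\<And>w. norm w < 1 \<Longrightarrow> f w \<noteq> 0"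
  shows "\<exists>G. int_series (\<lambda>w. inverse (f w)) G \<and> fps_nth G 0 = 1"
proof -
  have "fps_right_inverse F 1 * F = 1"
    using fps_right_inverse[of F 1] assms(2) by (simp add: mult.commute)
  moreover have "fps_nth (fps_right_inverse F 1) 0 = 1" by simp
  ultimately show ?thesis using int_series_inverse[OF assms(1) _ assms(3)] by blast
qed

lemma int_series_power_ex:
  assumes "int_series f F" "fps_nth F 0 = 1"
  shows "\<exists>G. int_series (\<lambda>w. f w ^ n) G \<and> fps_nth G 0 = 1"
proof (induction n)
  case 0
  show ?case using int_series_1 by (auto intro!: exI[of _ 1])
next
  case (Suc n)
  then obtain G where "int_series (\<lambda>w. f w ^ n) G" "fps_nth G 0 = 1" by blast
  then show ?case using int_series_mult[OF assms(1), of _ G] assms(2)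
    by (intro exI[of _ "F * G"]) simp
qed

section \<open>Formal infinite products and their analytic values\<close>

definition trunc_prod :: "(nat \<Rightarrow> int) \<Rightarrow> (nat \<Rightarrow> nat) \<Rightarrow> nat \<Rightarrow> int fps" where
  "trunc_prod \<sigma> e m = (\<Prod>n<m. 1 + fps_const (\<sigma> n) * fps_X ^ e n)"

lemma trunc_prod_stable:
  assumes "\<And>n. e n \<ge> Suc n" "j \<le> m"
  shows "fps_nth (trunc_prod \<sigma> e m) j = fps_nth (trunc_prod \<sigma> e j) j"
  using assms(2)
proof (induction m rule: dec_induct)
  case (step m)
  have "fps_nth (trunc_prod \<sigma> e m * fps_X ^ e m) j = 0"
    using step assms(1)[of m] by (simp add: fps_X_power_mult_right_nth)
  moreover have "trunc_prod \<sigma> e (Suc m) = trunc_prod \<sigma> e m + fps_const (\<sigma> m) * (trunc_prod \<sigma> e m * fps_X ^ e m)"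
    by (simp add: trunc_prod_def algebra_simps)
  ultimately show ?case using step by simp
qed simp

lemma int_series_trunc_prod:
  "int_series (\<lambda>w. \<Prod>n<m. 1 + of_int (\<sigma> n) * w ^ e n) (trunc_prod \<sigma> e m)"
proof (induction m)
  case 0
  then show ?case using int_series_1 by (simp add: trunc_prod_def)
next
  case (Suc m)
  have "(\<lambda>w::complex. 1 + of_int (\<sigma> m) * w ^ e m) has_fps_expansion 1 + fps_const (of_int (\<sigma> m)) * fps_X ^ e m"
    by (intro fps_expansion_intros)
  moreover have "1 + fps_const (of_int (\<sigma> m)) * fps_X ^ e m =
      (Abs_fps (\<lambda>n. of_int (fps_nth (1 + fps_const (\<sigma> m) * fps_X ^ e m) n)) :: complex fps)"
    by (rule fps_ext) (simp add: fps_X_power_nth)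
  ultimately have "int_series (\<lambda>w. 1 + of_int (\<sigma> m) * w ^ e m) (1 + fps_const (\<sigma> m) * fps_X ^ e m)"
    unfolding int_series_def by (auto intro!: holomorphic_intros)
  from int_series_mult[OF Suc this] show ?case by (simp add: trunc_prod_def)
qed

text \<open>A diagonal choice: when \<open>e n\<close> > n, factors of index at least j leave
  coefficient j alone, so the partial product with j factors already has the final
  coefficient.\<close>

definition prod_fps :: "(nat \<Rightarrow> int) \<Rightarrow> (nat \<Rightarrow> nat) \<Rightarrow> int fps" where
  "prod_fps \<sigma> e = Abs_fps (\<lambda>j. fps_nth (trunc_prod \<sigma> e j) j)"

lemma prod_fps_nth_0 [simp]: "fps_nth (prod_fps \<sigma> e) 0 = 1"
  by (simp add: prod_fps_def trunc_prod_def)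

text \<open>The partial products are polynomials with integer coefficients that converge uniformly
  near 0, so their Taylor coefficients converge. Being eventually constant, these coefficients have
  the formal ones as limits.\<close>

lemma
  assumes e: "\<And>n. e n \<ge> Suc n" and \<sigma>: "\<And>n. \<bar>\<sigma> n\<bar> \<le> 1"
  shows int_series_prodinf: "int_series (\<lambda>w. \<Prod>n. 1 + of_int (\<sigma> n) * w ^ e n) (prod_fps \<sigma> e)"
    and LIMSEQ_prodinf_series: "\<And>w. norm w < 1 \<Longrightarrow>
      (\<lambda>m. \<Prod>n<m. 1 + of_int (\<sigma> n) * w ^ e n) \<longlonglongrightarrow> (\<Prod>n. 1 + of_int (\<sigma> n) * (w::complex) ^ e n)"
proof -
  let ?f = "\<lambda>n (w::complex). of_int (\<sigma> n) * w ^ e n"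
  let ?g = "\<lambda>w. \<Prod>n. 1 + ?f n w"
  have bd: "\<exists>d>0. \<exists>M. summable M \<and> (\<forall>z\<in>cball x d \<inter> ball 0 1. \<forall>n. norm (?f n z) \<le> M n)"
    if x: "x \<in> ball 0 1" for x
  proof -
    define d where "d = (1 - norm x) / 2"
    define \<rho> where "\<rho> = (1 + norm x) / 2"
    have d: "d > 0" "\<rho> < 1" "\<rho> \<ge> 0" using x by (auto simp: d_def \<rho>_def)
    have "norm (?f n z) \<le> \<rho> ^ n" if z: "z \<in> cball x d" for n z
    proof -
      have "norm z \<le> norm x + dist x z" by (metis dist_norm norm_minus_commute norm_triangle_sub)
      then have "norm z \<le> \<rho>" using z by (simp add: d_def \<rho>_def field_simps)
      have "norm (?f n z) = real_of_int \<bar>\<sigma> n\<bar> * norm z ^ e n" by (simp add: norm_mult norm_power)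
      also have "\<dots> \<le> 1 * \<rho> ^ e n"
        using \<sigma>[of n] \<open>norm z \<le> \<rho>\<close> by (intro mult_mono power_mono) auto
      also have "\<dots> \<le> \<rho> ^ n" using d e[of n] by (simp add: power_decreasing)
      finally show ?thesis .
    qed
    moreover have "summable (\<lambda>n. \<rho> ^ n)" using d by (intro summable_geometric) auto
    ultimately show ?thesis using d(1) by blast
  qed
  have hf: "?f n holomorphic_on ball 0 1" for n by (intro holomorphic_intros)
  note L = open_ball hf bd
  show "(\<lambda>m. \<Prod>n<m. 1 + ?f n w) \<longlonglongrightarrow> ?g w" if "norm w < 1" for w
  proof -
    have "convergent_prod (\<lambda>n. 1 + ?f n w)"
      using that by (intro convergent_prod_locally_bounded[OF L]) auto
    then have "(\<lambda>m. \<Prod>n\<le>m. 1 + ?f n w) \<longlonglongrightarrow> ?g w" by (rule convergent_prod_LIMSEQ)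
    then show ?thesis
      unfolding lessThan_Suc_atMost[symmetric] by (subst (asm) filterlim_sequentially_Suc)
  qed
  have hol: "?g holomorphic_on ball 0 1" by (rule holomorphic_on_prodinf_locally_bounded[OF L])
  have "\<exists>d>0. cball 0 d \<subseteq> ball (0::complex) 1 \<and>
      uniform_limit (cball 0 d) (\<lambda>N z. \<Prod>n<N. 1 + ?f n z) ?g sequentially"
    by (rule uniform_limit_prodinf_locally_bounded[OF L]) auto
  then obtain d where d: "d > 0" "cball 0 d \<subseteq> ball (0::complex) 1"
    and ul: "uniform_limit (cball 0 d) (\<lambda>N z. \<Prod>n<N. 1 + ?f n z) ?g sequentially" by blast
  have coeff: "(deriv ^^ j) ?g 0 / fact j = of_int (fps_nth (prod_fps \<sigma> e) j)" for j
  proof -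
    have "(\<lambda>N. (deriv ^^ j) (\<lambda>z. \<Prod>n<N. 1 + ?f n z) 0) \<longlonglongrightarrow> (deriv ^^ j) ?g 0"
      using d by (intro higher_deriv_complex_uniform_limit[where A = "ball 0 d"] uniform_limit_on_subset[OF ul])
        (auto intro!: always_eventually holomorphic_intros)
    then have "(\<lambda>N. (deriv ^^ j) (\<lambda>z. \<Prod>n<N. 1 + ?f n z) 0 / fact j) \<longlonglongrightarrow> (deriv ^^ j) ?g 0 / fact j"
      by (intro tendsto_intros) auto
    moreover have "(deriv ^^ j) (\<lambda>z. \<Prod>n<N. 1 + ?f n z) 0 / fact j = of_int (fps_nth (trunc_prod \<sigma> e N) j)" for N
      using int_series_trunc_prod[where m = N and \<sigma> = \<sigma> and e = e]
        fps_nth_fps_expansion[of "\<lambda>z. \<Prod>n<N. 1 + ?f n z" "Abs_fps (\<lambda>n. of_int (fps_nth (trunc_prod \<sigma> e N) n))" j]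
      by (simp add: int_series_def)
    ultimately have "(\<lambda>N. of_int (fps_nth (trunc_prod \<sigma> e N) j)) \<longlonglongrightarrow> (deriv ^^ j) ?g 0 / fact j" by simp
    moreover have "\<forall>\<^sub>F N in sequentially. of_int (fps_nth (trunc_prod \<sigma> e N) j) = (of_int (fps_nth (prod_fps \<sigma> e) j) :: complex)"
      by (rule eventually_mono[OF eventually_ge_at_top[of j]]) (auto simp: prod_fps_def intro: trunc_prod_stable[OF e])
    then have "(\<lambda>N. of_int (fps_nth (trunc_prod \<sigma> e N) j)) \<longlonglongrightarrow> (of_int (fps_nth (prod_fps \<sigma> e) j) :: complex)"
      by (rule tendsto_eventually)
    ultimately show ?thesis by (rule LIMSEQ_unique)
  qed
  have "fps_expansion ?g 0 = Abs_fps (\<lambda>n. of_int (fps_nth (prod_fps \<sigma> e) n))"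
    by (rule fps_ext) (simp add: fps_expansion_def coeff)
  then have "?g has_fps_expansion Abs_fps (\<lambda>n. of_int (fps_nth (prod_fps \<sigma> e) n))"
    using has_fps_expansion_fps_expansion[OF open_ball _ hol] by auto
  then show "int_series ?g (prod_fps \<sigma> e)" using hol by (simp add: int_series_def)
qed

text \<open>The sign s covers the arguments - z and - z^2 that occur in
  \<open>half_series\<close>.\<close>

lemma int_series_qpoch:
  assumes "a \<ge> 1" "b \<ge> 1" "\<bar>s\<bar> \<le> 1"
  shows "\<exists>F. int_series (\<lambda>w. qpoch (w ^ b) (of_int s * w ^ a)) F \<and> fps_nth F 0 = 1"
proof -
  have "a + b * n \<ge> Suc n" for n
    using assms mult_right_mono[of 1 b n] by linarith
  then have "int_series (\<lambda>w. \<Prod>n. 1 + of_int (- s) * w ^ (a + b * n)) (prod_fps (\<lambda>_. - s) (\<lambda>n. a + b * n))"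
    using assms by (intro int_series_prodinf) auto
  moreover have "1 + of_int (- s) * w ^ (a + b * n) = 1 - of_int s * w ^ a * (w ^ b) ^ n" for w :: complex and n
    by (simp add: power_add power_mult)
  ultimately have "int_series (\<lambda>w. qpoch (w ^ b) (of_int s * w ^ a)) (prod_fps (\<lambda>_. - s) (\<lambda>n. a + b * n))"
    unfolding qpoch_def by (simp only:)
  then show ?thesis using prod_fps_nth_0 by blast
qed

section \<open>The product f_1 / f_t and regular partitions\<close>

definition reg_sign :: "nat \<Rightarrow> nat \<Rightarrow> int" where
  "reg_sign t n = (if t dvd Suc n then 0 else - 1)"

text \<open>This is f_1 / f_t, the reciprocal of the generating function. The sign 0 turns the
  factors at multiples of t into 1, and index n stands for the part n + 1.\<close>

definition reg_prod :: "nat \<Rightarrow> complex \<Rightarrow> complex" where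
  "reg_prod t w = (\<Prod>n. 1 + of_int (reg_sign t n) * w ^ Suc n)"

definition bounded_regular :: "nat \<Rightarrow> nat \<Rightarrow> nat \<Rightarrow> nat multiset set" where
  "bounded_regular t m n = {P \<in> regular_partitions t n. \<forall>x\<in>#P. x \<le> m}"

lemma finite_bounded_regular: "finite (bounded_regular t m n)"
  unfolding bounded_regular_def using finite_regular_partitions by simp

lemma mem_bounded_regular:
  "P \<in> bounded_regular t m n \<longleftrightarrow> (\<forall>x\<in>#P. 0 < x \<and> \<not> t dvd x \<and> x \<le> m) \<and> sum_mset P = n"
  unfolding bounded_regular_def regular_partitions_def partitions_of_def by blast

lemma bounded_regular_0: "bounded_regular t 0 n = (if n = 0 then {{#}} else {})"
proof -
  have "P = {#}" if "\<forall>x\<in>#P. x \<le> 0" "\<forall>p\<in>#P. 0 < p" for P :: "nat multiset"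
    using that by (metis le_zero_eq less_irrefl multiset_nonemptyE)
  then have "P \<in> bounded_regular t 0 n \<longleftrightarrow> P = {#} \<and> n = 0" for P
    unfolding bounded_regular_def regular_partitions_def partitions_of_def by fastforce
  then show ?thesis by auto
qed

text \<open>Partitions containing the part m + 1 correspond to partitions of n - (m + 1) by removing
  one copy. This is the recursion of the factor 1 - q^(m+1).\<close>

lemma card_bounded_regular_Suc:
  "int (card (bounded_regular t (Suc m) n)) = int (card (bounded_regular t m n)) +
     (if t dvd Suc m \<or> n < Suc m then 0 else int (card (bounded_regular t (Suc m) (n - Suc m))))"
proof -
  let ?A = "{P \<in> bounded_regular t (Suc m) n. Suc m \<in># P}"
  have split: "bounded_regular t (Suc m) n = bounded_regular t m n \<union> ?A"
    by (auto simp: bounded_regular_def le_Suc_eq)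
  have disj: "bounded_regular t m n \<inter> ?A = {}"
    by (auto simp: bounded_regular_def)
  have card: "card (bounded_regular t (Suc m) n) = card (bounded_regular t m n) + card ?A"
    using disj finite_bounded_regular by (subst split, subst card_Un_disjoint) auto
  show ?thesis
  proof (cases "t dvd Suc m \<or> n < Suc m")
    case True
    have False if P: "P \<in> ?A" for P
    proof -
      have "n = Suc m + sum_mset (P - {#Suc m#})" "\<not> t dvd Suc m"
        using P sum_mset.remove[of "Suc m" P] by (simp_all add: bounded_regular_def regular_partitions_def partitions_of_def)
      then show False using True by simp
    qed
    then have "?A = {}" by blast
    then have "card ?A = 0" by (simp only: card.empty)
    then show ?thesis using card True by simp
  next
    case False
    have "bij_betw (add_mset (Suc m)) (bounded_regular t (Suc m) (n - Suc m)) ?A"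
    proof (rule bij_betw_byWitness[where f' = "\<lambda>P. P - {#Suc m#}"])
      show "add_mset (Suc m) ` bounded_regular t (Suc m) (n - Suc m) \<subseteq> ?A"
        using False by (clarsimp simp: mem_bounded_regular)
      show "(\<lambda>P. P - {#Suc m#}) ` ?A \<subseteq> bounded_regular t (Suc m) (n - Suc m)"
      proof clarify
        fix P assume P: "P \<in> bounded_regular t (Suc m) n" "Suc m \<in># P"
        have "sum_mset P = Suc m + sum_mset (P - {#Suc m#})"
          using P(2) by (rule sum_mset.remove)
        then show "P - {#Suc m#} \<in> bounded_regular t (Suc m) (n - Suc m)"
          using P(1) unfolding mem_bounded_regular by (auto dest: in_diffD)
      qed
    qed auto
    then have "card (bounded_regular t (Suc m) (n - Suc m)) = card ?A" by (rule bij_betw_same_card)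
    then show ?thesis using card False by simp
  qed
qed

lemma bounded_regular_fps:
  "Abs_fps (\<lambda>n. int (card (bounded_regular t m n))) * trunc_prod (reg_sign t) Suc m = 1"
proof (induction m)
  case 0
  show ?case by (rule fps_ext) (simp add: trunc_prod_def bounded_regular_0)
next
  case (Suc m)
  let ?P = "\<lambda>m. Abs_fps (\<lambda>n. int (card (bounded_regular t m n)))"
  have "?P (Suc m) * (1 + fps_const (reg_sign t m) * fps_X ^ Suc m) = ?P m"
  proof (rule fps_ext)
    fix n
    have "fps_nth (?P (Suc m) * (1 + fps_const (reg_sign t m) * fps_X ^ Suc m)) n =
        fps_nth (?P (Suc m)) n + reg_sign t m * fps_nth (?P (Suc m) * fps_X ^ Suc m) n"
      by (simp only: distrib_left mult_1_right fps_add_nth mult.left_commute[of "?P (Suc m)"] fps_mult_left_const_nth)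
    also have "\<dots> = fps_nth (?P m) n"
      using card_bounded_regular_Suc[of t m n] by (simp add: fps_X_power_mult_right_nth reg_sign_def del: power_Suc)
    finally show "fps_nth (?P (Suc m) * (1 + fps_const (reg_sign t m) * fps_X ^ Suc m)) n = fps_nth (?P m) n" .
  qed
  then have "?P (Suc m) * (1 + fps_const (reg_sign t m) * fps_X ^ Suc m) * trunc_prod (reg_sign t) Suc m = 1"
    using Suc by simp
  then show ?case by (simp add: trunc_prod_def mult_ac)
qed

text \<open>Coefficient n involves only partitions of numbers up to n, whose parts are at most n, so
  the identity for the truncated product suffices.\<close>

lemma regular_fps_mult_prod_fps:
  "Abs_fps (\<lambda>n. int (num_regular_partitions t n)) * prod_fps (reg_sign t) Suc = 1"
proof (rule fps_ext)
  fix n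
  have b: "num_regular_partitions t i = card (bounded_regular t n i)" if "i \<le> n" for i
  proof -
    have "x \<le> n" if "P \<in> regular_partitions t i" "x \<in># P" for P x
    proof -
      have "i = x + sum_mset (P - {#x#})"
        using that sum_mset.remove[of x P] by (simp add: regular_partitions_def partitions_of_def)
      then show ?thesis using \<open>i \<le> n\<close> by simp
    qed
    then show ?thesis unfolding num_regular_partitions_def bounded_regular_def by (intro arg_cong[where f = card]) blast
  qed
  have "fps_nth (Abs_fps (\<lambda>n. int (num_regular_partitions t n)) * prod_fps (reg_sign t) Suc) n =
      fps_nth (Abs_fps (\<lambda>i. int (card (bounded_regular t n i))) * trunc_prod (reg_sign t) Suc n) n"
    unfolding fps_mult_nth
    by (intro sum.cong refl) (simp add: b prod_fps_def trunc_prod_stable[of Suc _ n])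
  then show "fps_nth (Abs_fps (\<lambda>n. int (num_regular_partitions t n)) * prod_fps (reg_sign t) Suc) n = fps_nth 1 n"
    by (simp add: bounded_regular_fps)
qed

lemma abs_reg_sign: "\<bar>reg_sign t n\<bar> \<le> 1"
  by (simp add: reg_sign_def)

text \<open>Pairs c with N - c. The reflection has no fixed point: if c = N / 2, then t divides c
  because 2 t divides N.\<close>

lemma
  fixes N t :: nat
  assumes N: "N > 0" "2 * t dvd N"
  defines "A \<equiv> {a. a \<in> {1..<N} \<and> 2 * a < N \<and> \<not> t dvd a}"
  shows nonmultiples_eq: "{c \<in> {..<N}. \<not> t dvd c} = A \<union> (\<lambda>a. N - a) ` A" (is "?C = _")
    and inj_on_reflect: "inj_on (\<lambda>a. N - a) A"
    and reflect_disjoint: "A \<inter> (\<lambda>a. N - a) ` A = {}"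
    and finite_half_nonmultiples: "finite A"
proof -
  show "inj_on (\<lambda>a. N - a) A" by (rule inj_onI) (auto simp: A_def)
  show "A \<inter> (\<lambda>a. N - a) ` A = {}" by (auto simp: A_def)
  show "finite A" by (rule finite_subset[of _ "{..<N}"]) (auto simp: A_def)
  define C where "C = ?C"
  have tN: "t dvd N" using N(2) dvd_mult_right by blast
  have "C = A \<union> (\<lambda>a. N - a) ` A"
  proof -
    have "c \<in> A \<union> (\<lambda>a. N - a) ` A" if c: "c \<in> C" for c
    proof (cases "2 * c < N")
      case True
      then show ?thesis using c by (cases "c = 0") (auto simp: C_def A_def)
    next
      case False
      have "2 * c \<noteq> N"
      proof
        assume "2 * c = N"
        then have "t dvd c" using N(2) by (metis nat_mult_dvd_cancel1 zero_less_numeral)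
        then show False using c by (simp add: C_def)
      qed
      then have "2 * (N - c) < N" "N - c \<ge> 1" "N - (N - c) = c" using False c by (auto simp: C_def)
      moreover have "\<not> t dvd N - c"
        using c tN by (metis C_def dvd_diff_nat \<open>N - (N - c) = c\<close> mem_Collect_eq)
      ultimately have "N - c \<in> A" "c = N - (N - c)" using N c by (auto simp: A_def C_def)
      then show ?thesis by blast
    qed
    moreover have "N - a \<in> C" if a: "a \<in> A" for a
    proof -
      have "N - (N - a) = a" using a by (auto simp: A_def)
      then have "\<not> t dvd N - a" using a tN by (metis (mono_tags, lifting) A_def dvd_diff_nat mem_Collect_eq)
      then show ?thesis using a by (auto simp: C_def A_def)
    qed
    moreover have "A \<subseteq> C" by (auto simp: A_def C_def)
    ultimately show ?thesis by blast
  qed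
  then show "?C = A \<union> (\<lambda>a. N - a) ` A" by (simp add: C_def)
qed

text \<open>Exponents are sorted by residue modulo N, and residues a and N - a are paired because
  these two Pochhammer factors are the ones in \<open>theta\<close> at the point (a / N)
  \<tau>.\<close>

lemma reg_prod_eq_qpoch:
  assumes N: "N > 0" "2 * t dvd N" and w: "norm w < 1"
  shows "reg_prod t w = (\<Prod>a | a \<in> {1..<N} \<and> 2 * a < N \<and> \<not> t dvd a.
           qpoch (w ^ N) (w ^ a) * qpoch (w ^ N) (w ^ (N - a)))"
proof -
  define A where "A = {a. a \<in> {1..<N} \<and> 2 * a < N \<and> \<not> t dvd a}"
  define C where "C = {c \<in> {..<N}. \<not> t dvd c}"
  \<comment> \<open>Indexed by the exponent itself. Since t divides 0, \<open>h 0\<close> = 1, so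
    one extra trivial factor aligns the product with blocks of length N.\<close>
  define h where "h k = (if t dvd k then 1 else 1 - w ^ k)" for k
  have tN: "t dvd N" using N(2) dvd_mult_right by blast
  have finA: "finite A" unfolding A_def by (rule finite_half_nonmultiples[OF N])
  have finC: "finite C" by (simp add: C_def)
  have wN: "norm (w ^ N) < 1" using w N(1) by (simp add: norm_power power_less_one_iff)
  note C = nonmultiples_eq[OF N, folded A_def C_def]
  note inj = inj_on_reflect[OF N, folded A_def]
  note disj = reflect_disjoint[OF N, folded A_def]
  have fac: "(\<Prod>k<m * N. h k) = (\<Prod>c\<in>C. \<Prod>n<m. 1 - w ^ c * (w ^ N) ^ n)" for m
  proof -
    have "(\<Prod>k<m * N. h k) = (\<Prod>n<m. \<Prod>k = n * N..<n * N + N. h k)"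
      by (rule prod.nat_group[symmetric])
    also have "\<dots> = (\<Prod>n<m. \<Prod>c\<in>C. 1 - w ^ c * (w ^ N) ^ n)"
    proof (rule prod.cong[OF refl])
      fix n
      have "(\<Prod>k = n * N..<n * N + N. h k) = (\<Prod>c<N. h (c + n * N))"
        using prod.shift_bounds_nat_ivl[of h 0 "n * N" N] by (simp add: add.commute lessThan_atLeast0)
      also have "\<dots> = (\<Prod>c\<in>{..<N}. if \<not> t dvd c then 1 - w ^ c * (w ^ N) ^ n else 1)"
      proof (intro prod.cong refl)
        fix c
        have "t dvd c + n * N \<longleftrightarrow> t dvd c" using tN by (simp add: dvd_add_left_iff)
        then show "h (c + n * N) = (if \<not> t dvd c then 1 - w ^ c * (w ^ N) ^ n else 1)"
          by (simp add: h_def power_add power_mult[symmetric] mult.commute)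
      qed
      also have "\<dots> = (\<Prod>c\<in>C. 1 - w ^ c * (w ^ N) ^ n)"
        unfolding C_def by (subst prod.inter_filter[symmetric]) auto
      finally show "(\<Prod>k = n * N..<n * N + N. h k) = (\<Prod>c\<in>C. 1 - w ^ c * (w ^ N) ^ n)" .
    qed
    also have "\<dots> = (\<Prod>c\<in>C. \<Prod>n<m. 1 - w ^ c * (w ^ N) ^ n)" by (rule prod.swap)
    finally show ?thesis .
  qed
  have "(\<lambda>m. \<Prod>n<m. 1 + of_int (reg_sign t n) * w ^ Suc n) \<longlonglongrightarrow> reg_prod t w"
    unfolding reg_prod_def by (rule LIMSEQ_prodinf_series) (auto simp: abs_reg_sign w)
  moreover have "(\<Prod>n<m. 1 + of_int (reg_sign t n) * w ^ Suc n) = (\<Prod>k<Suc m. h k)" for m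
    by (subst prod.lessThan_Suc_shift) (auto simp: h_def reg_sign_def intro!: prod.cong)
  ultimately have "(\<lambda>m. \<Prod>k<Suc m. h k) \<longlonglongrightarrow> reg_prod t w" by simp
  then have "(\<lambda>m. \<Prod>k<m. h k) \<longlonglongrightarrow> reg_prod t w" by (subst (asm) filterlim_sequentially_Suc)
  moreover have "filterlim (\<lambda>m. m * N) at_top sequentially"
    using N(1) by (intro filterlim_subseq) (auto simp: strict_mono_def)
  ultimately have "(\<lambda>m. \<Prod>k<m * N. h k) \<longlonglongrightarrow> reg_prod t w" by (rule filterlim_compose)
  moreover have "(\<lambda>m. \<Prod>k<m * N. h k) \<longlonglongrightarrow> (\<Prod>c\<in>C. qpoch (w ^ N) (w ^ c))"
    unfolding fac by (intro tendsto_prod LIMSEQ_qpoch wN)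
  ultimately have "reg_prod t w = (\<Prod>c\<in>C. qpoch (w ^ N) (w ^ c))" by (rule LIMSEQ_unique)
  also have "\<dots> = (\<Prod>c\<in>A. qpoch (w ^ N) (w ^ c)) * (\<Prod>c\<in>(\<lambda>a. N - a) ` A. qpoch (w ^ N) (w ^ c))"
    unfolding C using finA disj by (intro prod.union_disjoint) auto
  also have "\<dots> = (\<Prod>a\<in>A. qpoch (w ^ N) (w ^ a) * qpoch (w ^ N) (w ^ (N - a)))"
    using inj by (simp add: prod.reindex prod.distrib)
  finally show ?thesis by (simp add: A_def)
qed

lemma
  assumes "norm w < 1" "t \<ge> 1"
  shows reg_prod_nonzero: "reg_prod t w \<noteq> 0"
proof -
  have nz: "qpoch (w ^ (2 * t)) (w ^ a) \<noteq> 0" if "a \<ge> 1" for a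
  proof -
    have "norm (w ^ a * (w ^ (2 * t)) ^ n) < 1" for n
      using assms that by (simp add: norm_mult norm_power power_mult[symmetric] power_add[symmetric] power_less_one_iff)
    moreover have "norm (w ^ (2 * t)) < 1" using assms by (simp add: norm_power power_less_one_iff)
    ultimately show ?thesis using qpoch_0_iff by (metis norm_one order_less_irrefl)
  qed
  show ?thesis
    using assms by (subst reg_prod_eq_qpoch[of "2 * t"]) (auto intro!: nz)
qed

lemma int_series_regular_partitions:
  assumes "t \<ge> 1"
  shows "int_series (\<lambda>w. inverse (reg_prod t w)) (Abs_fps (\<lambda>n. int (num_regular_partitions t n)))"
proof (rule int_series_inverse)
  show "int_series (reg_prod t) (prod_fps (reg_sign t) Suc)"
    unfolding reg_prod_def by (rule int_series_prodinf) (auto simp: abs_reg_sign)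
qed (use assms in \<open>auto simp: regular_fps_mult_prod_fps reg_prod_nonzero\<close>)

section \<open>Hecke operators on products of Klein forms\<close>

text \<open>At lattice points \<open>klein\<close> is 0 and so is its inverse by convention. The
  statement thus covers all points, and multiples of torsion points call for no distinction of
  cases.\<close>

lemma holomorphic_on_inverse_klein: "(\<lambda>\<tau>. inverse (klein x y \<tau>)) holomorphic_on {\<tau>. Im \<tau> > 0}"
proof (cases "x \<in> \<int> \<and> y \<in> \<int>")
  case True
  have "(\<lambda>\<tau>. 0) holomorphic_on {\<tau>. Im \<tau> > 0}" by simp
  then show ?thesis by (rule holomorphic_transform) (use True klein_0_iff in auto)
next
  case False
  then show ?thesis using klein_0_iff by (intro holomorphic_intros holomorphic_on_klein) auto
qed

lemma norm_inverse_klein_bounded: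
  "\<exists>C\<ge>0. \<forall>\<tau>. Im \<tau> \<ge> 1 / 2 \<longrightarrow> norm (inverse (klein x y \<tau>)) \<le> C"
proof (cases "x \<in> \<int> \<and> y \<in> \<int>")
  case True
  then show ?thesis using klein_0_iff[of _ x y] by (intro exI[of _ 0]) auto
next
  case False
  then obtain C where C: "C > 0" "\<And>\<tau>. Im \<tau> \<ge> 1 / 2 \<Longrightarrow>
      norm (inverse (klein x y \<tau>)) \<le> C * exp (- pi * frac x * (1 - frac x) * Im \<tau>)"
    using norm_inverse_klein_le[of x y] by blast
  have "norm (inverse (klein x y \<tau>)) \<le> C" if "Im \<tau> \<ge> 1 / 2" for \<tau>
  proof -
    have "0 \<le> pi * frac x * (1 - frac x) * Im \<tau>"
      using that frac_lt_1[of x] by (intro mult_nonneg_nonneg) auto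
    then have "C * exp (- pi * frac x * (1 - frac x) * Im \<tau>) \<le> C * 1"
      using C(1) by (intro mult_left_mono) auto
    then show ?thesis using C(2)[OF that] by linarith
  qed
  then show ?thesis using C(1) by (intro exI[of _ C]) auto
qed

text \<open>Up to a constant this is the discriminant: the three half periods are permuted by the
  modular group up to fourth roots of unity.\<close>

definition half_disc :: "complex \<Rightarrow> complex" where
  "half_disc \<tau> = (inverse (klein (1/2) 0 \<tau>) * inverse (klein 0 (1/2) \<tau>) * inverse (klein (1/2) (1/2) \<tau>)) ^ 4"

lemma holomorphic_on_half_disc: "half_disc holomorphic_on {\<tau>. Im \<tau> > 0}"
  unfolding half_disc_def by (intro holomorphic_intros holomorphic_on_inverse_klein)

lemma half_disc_plus_1:
  assumes "Im \<tau> > 0"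
  shows "half_disc (\<tau> + 1) = half_disc \<tau>"
proof -
  have "klein (1/2) 0 (\<tau> + 1) = klein (1/2) (1/2) \<tau>" "klein 0 (1/2) (\<tau> + 1) = klein 0 (1/2) \<tau>"
    using klein_translate[OF assms, of "1/2" 0 1] klein_translate[OF assms, of 0 "1/2" 1] by simp_all
  moreover have "klein (1/2) (1/2) (\<tau> + 1) = - qe (1/4) * klein (1/2) 0 \<tau>"
    using klein_translate[OF assms, of "1/2" "1/2" 1] klein_plus_1_right[OF assms, of "1/2" 0] by simp
  moreover have "qe (1/4) ^ 4 = 1" by (simp add: qe_power)
  ultimately show ?thesis
    by (simp add: half_disc_def power_mult_distrib power_inverse)
qed

lemma half_disc_invert:
  assumes "Im \<tau> > 0"
  shows "half_disc (- 1 / \<tau>) = \<tau> ^ 12 * half_disc \<tau>"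
proof -
  have "\<tau> \<noteq> 0" using assms by auto
  have 1: "klein (1/2) 0 (- 1 / \<tau>) = - klein 0 (1/2) \<tau> / \<tau>"
    using klein_invert[OF assms, of "1/2" 0] klein_minus[OF assms, of 0 "1/2"] by simp
  have 2: "klein 0 (1/2) (- 1 / \<tau>) = klein (1/2) 0 \<tau> / \<tau>"
    using klein_invert[OF assms, of 0 "1/2"] by simp
  have "klein (1/2) (1/2) \<tau> = - qe (1/4) * klein (1/2) (- (1/2)) \<tau>"
    using klein_plus_1_right[OF assms, of "1/2" "- (1/2)"] by simp
  then have 3: "- qe (1/4) * klein (1/2) (1/2) (- 1 / \<tau>) = klein (1/2) (1/2) \<tau> / \<tau>"
    using klein_invert[OF assms, of "1/2" "1/2"] by simp
  have "qe (1/4) ^ 4 = 1" by (simp add: qe_power)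
  then have "klein (1/2) (1/2) (- 1 / \<tau>) ^ 4 = (- qe (1/4) * klein (1/2) (1/2) (- 1 / \<tau>)) ^ 4"
    by (simp add: power_mult_distrib)
  also have "\<dots> = (klein (1/2) (1/2) \<tau> / \<tau>) ^ 4" by (simp only: 3)
  finally have 3: "klein (1/2) (1/2) (- 1 / \<tau>) ^ 4 = klein (1/2) (1/2) \<tau> ^ 4 / \<tau> ^ 4"
    by (simp add: power_divide)
  have "\<tau> ^ 12 = \<tau> ^ 4 * (\<tau> ^ 4 * \<tau> ^ 4)" by (simp flip: power_add)
  then show ?thesis
    unfolding half_disc_def power_mult_distrib power_inverse 1 2 3 using \<open>\<tau> \<noteq> 0\<close>
    by (simp add: power_divide field_simps)
qed

lemma half_disc_mob:
  assumes "a * d - b * c = 1" "Im \<tau> > 0"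
  shows "half_disc (mob a b c d \<tau>) = jfac c d \<tau> ^ 12 * half_disc \<tau>"
proof -
  have "modular_family 12 (\<lambda>x y. half_disc)"
  proof (rule modular_familyI)
    fix \<tau> :: complex and n :: int assume \<tau>: "Im \<tau> > 0"
    have *: "half_disc (\<tau> + of_nat m) = half_disc \<tau>" if "Im \<tau> > 0" for m \<tau>
      using that half_disc_plus_1[of "\<tau> + of_nat _"] by (induction m) (simp_all add: add_ac)
    show "half_disc (\<tau> + of_int n) = half_disc \<tau>"
    proof (cases "n \<ge> 0")
      case True then show ?thesis using *[OF \<tau>, of "nat n"] by simp
    next
      case False then show ?thesis using *[of "\<tau> + of_int n" "nat (- n)"] \<tau> by simp
    qed
  qed (rule half_disc_invert)
  from modular_familyD[OF this assms] show ?thesis .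
qed

text \<open>The two half periods with x = 1/2 contribute exp (- pi Im \<tau> / 4) each, the third is
  only bounded; the fourth power gives exp (- 2 pi Im \<tau>).\<close>

lemma norm_half_disc_le:
  "\<exists>C\<ge>0. \<forall>\<tau>. Im \<tau> \<ge> 1 / 2 \<longrightarrow> norm (half_disc \<tau>) \<le> C * exp (- 2 * pi * Im \<tau>)"
proof -
  have half: "frac (1 / 2 :: real) = 1 / 2" by (simp add: frac_def)
  have nonint: "(1 / 2 :: real) \<notin> \<int>" using half by (metis frac_eq_0_iff divide_eq_0_iff one_neq_zero zero_neq_numeral)
  obtain C1 where C1: "C1 > 0" "\<And>\<tau>. Im \<tau> \<ge> 1 / 2 \<Longrightarrow> norm (inverse (klein (1/2) 0 \<tau>)) \<le> C1 * exp (- pi * (1/2) * (1/2) * Im \<tau>)"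
    using norm_inverse_klein_le[of "1/2" 0] nonint unfolding half by force
  obtain C2 where C2: "C2 \<ge> 0" "\<And>\<tau>. Im \<tau> \<ge> 1 / 2 \<Longrightarrow> norm (inverse (klein 0 (1/2) \<tau>)) \<le> C2"
    using norm_inverse_klein_bounded[of 0 "1/2"] by blast
  obtain C3 where C3: "C3 > 0" "\<And>\<tau>. Im \<tau> \<ge> 1 / 2 \<Longrightarrow> norm (inverse (klein (1/2) (1/2) \<tau>)) \<le> C3 * exp (- pi * (1/2) * (1/2) * Im \<tau>)"
    using norm_inverse_klein_le[of "1/2" "1/2"] nonint unfolding half by force
  have "norm (half_disc \<tau>) \<le> (C1 * C2 * C3) ^ 4 * exp (- 2 * pi * Im \<tau>)" if \<tau>: "Im \<tau> \<ge> 1 / 2" for \<tau>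
  proof -
    let ?e = "exp (- pi * (1/2) * (1/2) * Im \<tau>)"
    have "norm (half_disc \<tau>) \<le> ((C1 * ?e) * C2 * (C3 * ?e)) ^ 4"
      unfolding half_disc_def norm_power norm_mult
      using C1 C2 C3 \<tau> by (intro power_mono mult_mono) auto
    also have "\<dots> = (C1 * C2 * C3) ^ 4 * (?e * ?e) ^ 4"
      by (simp add: power_mult_distrib[symmetric] mult_ac)
    also have "(?e * ?e) ^ 4 = exp (- 2 * pi * Im \<tau>)"
      by (simp add: exp_add[symmetric] exp_of_nat_mult[symmetric])
    finally show ?thesis .
  qed
  then show ?thesis using C1(1) C2(1) C3(1) by (intro exI[of _ "(C1 * C2 * C3) ^ 4"]) auto
qed

text \<open>A single term of the exponential series; it lets the decay of \<open>half_disc\<close>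
  absorb the power of the imaginary part.\<close>

lemma power_le_fact_exp:
  fixes y :: real
  assumes "y \<ge> 0"
  shows "y ^ k \<le> fact k * exp y"
proof -
  have "(\<Sum>n\<in>{k}. inverse (fact n) * y ^ n) \<le> (\<Sum>n. inverse (fact n) * y ^ n)"
    using assms summable_exp[of y] by (intro sum_le_suminf) auto
  also have "\<dots> = exp y" by (simp add: exp_def scaleR_conv_of_real)
  finally show ?thesis by (simp add: field_simps)
qed

lemma sum_periodic_affine:
  fixes f :: "int \<Rightarrow> 'a :: comm_monoid_add" and p u v :: int
  assumes per: "\<And>j m. f (j + p * m) = f j" and p: "p > 0" "coprime u p"
  shows "(\<Sum>j\<in>{0..<p}. f (u * j + v)) = (\<Sum>j\<in>{0..<p}. f j)"
proof -
  have fmod: "f (x mod p) = f x" for x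
    using per[of "x mod p" "x div p"] by simp
  let ?h = "\<lambda>j. (u * j + v) mod p"
  have "inj_on ?h {0..<p}"
  proof (rule inj_onI)
    fix i j assume ij: "i \<in> {0..<p}" "j \<in> {0..<p}" "?h i = ?h j"
    then have "p dvd u * (i - j)" by (simp add: mod_eq_dvd_iff algebra_simps)
    then have "p dvd i - j" using p(2) by (simp add: coprime_commute coprime_dvd_mult_right_iff)
    then show "i = j" using ij by (metis atLeastLessThan_iff mod_eq_dvd_iff mod_pos_pos_trivial)
  qed
  moreover have "?h ` {0..<p} \<subseteq> {0..<p}" using p by auto
  ultimately have "bij_betw ?h {0..<p} {0..<p}"
    by (simp add: bij_betw_def endo_inj_surj)
  then have "(\<Sum>j\<in>{0..<p}. f (?h j)) = (\<Sum>j\<in>{0..<p}. f j)"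
    by (rule sum.reindex_bij_betw)
  then show ?thesis by (simp add: fmod)
qed

section \<open>The form attached to t and r: weight, level and bounds\<close>

locale hecke_setup =
  fixes t r :: nat
  assumes t_ge: "t \<ge> 2" and r_ge: "r \<ge> 1"
begin

text \<open>The factor 48 makes \<open>N\<close> divisible by \<open>2 t\<close> and \<open>N / 2\<close> divisible by \<open>24 r\<close>.\<close>

definition N :: nat where "N = 48 * t * r"

definition A :: "nat set" where "A = {a. a \<in> {1..<N} \<and> 2 * a < N \<and> \<not> t dvd a}"

text \<open>Weight 1 from each inverse Klein form and weight 12 from
  \<open>half_disc\<close>.\<close>

definition wt :: nat where "wt = card A + 12"

text \<open>A matrix congruent to the identity modulo 2 N^2 moves coordinates i / N by multiples of
  2 N, which are periods of all Klein forms involved.\<close>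

definition lev :: int where "lev = 2 * int N ^ 2"

lemma N_pos: "N > 0" using t_ge r_ge by (simp add: N_def)

lemma lev_pos: "lev > 0" using N_pos by (simp add: lev_def)

lemma finite_A: "finite A"
  by (rule finite_subset[of _ "{..<N}"]) (auto simp: A_def)

text \<open>All factors depend on one torsion point through its multiples a x, a y, so the modular
  group and the Hecke sums act on (x, y) alone. \<open>half_disc\<close> is there for decay: an
  inverse Klein form with integral first coordinate is merely bounded at infinity.\<close>

definition \<phi> :: "real \<Rightarrow> real \<Rightarrow> complex \<Rightarrow> complex" where
  "\<phi> x y \<tau> = (\<Prod>a\<in>A. inverse (klein (real a * x) (real a * y) \<tau>)) * half_disc \<tau>"

lemma holomorphic_on_phi: "\<phi> x y holomorphic_on {\<tau>. Im \<tau> > 0}"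
  unfolding \<phi>_def by (intro holomorphic_intros holomorphic_on_inverse_klein holomorphic_on_half_disc)

lemma modular_family_phi: "modular_family wt \<phi>"
  unfolding modular_family_def
proof (intro allI impI)
  fix a b c d :: int and x y \<tau> assume det: "a * d - b * c = 1" and \<tau>: "Im \<tau> > 0"
  have "inverse (klein (real n * x) (real n * y) (mob a b c d \<tau>)) = jfac c d \<tau> *
      inverse (klein (real n * (x * of_int a + y * of_int c)) (real n * (x * of_int b + y * of_int d)) \<tau>)" for n
    using modular_familyD[OF modular_family_inverse_klein det \<tau>, of "real n * x" "real n * y"]
    by (simp add: algebra_simps)
  then show "\<phi> x y (mob a b c d \<tau>) = jfac c d \<tau> ^ wt * \<phi> (x * of_int a + y * of_int c) (x * of_int b + y * of_int d) \<tau>"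
    by (simp add: \<phi>_def wt_def half_disc_mob[OF det \<tau>] prod.distrib power_add mult_ac)
qed

lemma phi_shift:
  assumes "Im \<tau> > 0" "x = of_int i / real N" "y = of_int j / real N"
  shows "\<phi> (x + 2 * real N * of_int m) (y + 2 * real N * of_int n) \<tau> = \<phi> x y \<tau>"
proof -
  have int: "real N * (real a * x) \<in> \<int>" "real N * (real a * y + 2 * real N * of_int (int a * n)) \<in> \<int>" for a
    using N_pos by (simp_all add: assms distrib_left)
  have "klein (real a * (x + 2 * real N * of_int m)) (real a * (y + 2 * real N * of_int n)) \<tau> =
      klein (real a * x) (real a * y) \<tau>" for a
  proof -
    have eq: "real a * (x + 2 * real N * of_int m) = real a * x + 2 * real N * of_int (int a * m)"
      "real a * (y + 2 * real N * of_int n) = real a * y + 2 * real N * of_int (int a * n)"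
      by (simp_all add: algebra_simps)
    show ?thesis
      unfolding eq klein_shift_left[OF assms(1) int(2)] klein_shift_right[OF assms(1) int(1)] ..
  qed
  then show ?thesis by (simp add: \<phi>_def)
qed

text \<open>Uniform in i and j because only residues modulo \<open>lev\<close> matter, which leaves
  finitely many functions to be bounded above height 1/2. The modular group moves any \<tau> there
  at the price of changing the point, which uniformity permits.\<close>

lemma phi_weight_bound:
  "\<exists>C. \<forall>\<tau> i j. Im \<tau> > 0 \<longrightarrow> norm (\<phi> (of_int i / real N) (of_int j / real N) \<tau>) ^ 2 * Im \<tau> ^ wt \<le> C"
proof -
  have "\<exists>C. \<forall>\<tau>. Im \<tau> \<ge> 1 / 2 \<longrightarrow> norm (\<phi> x y \<tau>) ^ 2 * Im \<tau> ^ wt \<le> C" for x y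
  proof -
    have "\<forall>a. \<exists>C\<ge>0. \<forall>\<tau>. Im \<tau> \<ge> 1 / 2 \<longrightarrow> norm (inverse (klein (real a * x) (real a * y) \<tau>)) \<le> C"
      by (intro allI norm_inverse_klein_bounded)
    then obtain K where K: "\<And>a. K a \<ge> 0" "\<And>a \<tau>. Im \<tau> \<ge> 1 / 2 \<Longrightarrow> norm (inverse (klein (real a * x) (real a * y) \<tau>)) \<le> K a"
      by metis
    obtain D where D: "D \<ge> 0" "\<And>\<tau>. Im \<tau> \<ge> 1 / 2 \<Longrightarrow> norm (half_disc \<tau>) \<le> D * exp (- 2 * pi * Im \<tau>)"
      using norm_half_disc_le by blast
    let ?B = "(\<Prod>a\<in>A. K a) * D"
    have "norm (\<phi> x y \<tau>) ^ 2 * Im \<tau> ^ wt \<le> ?B ^ 2 * fact wt" if \<tau>: "Im \<tau> \<ge> 1 / 2" for \<tau>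
    proof -
      have "norm (\<phi> x y \<tau>) \<le> (\<Prod>a\<in>A. K a) * (D * exp (- 2 * pi * Im \<tau>))"
        unfolding \<phi>_def norm_mult prod_norm[symmetric] using K D(2) \<tau>
        by (intro mult_mono prod_mono prod_nonneg) auto
      then have "norm (\<phi> x y \<tau>) ^ 2 * Im \<tau> ^ wt \<le> (?B * exp (- 2 * pi * Im \<tau>)) ^ 2 * (fact wt * exp (Im \<tau>))"
        using \<tau> by (intro mult_mono power_mono power_le_fact_exp) (auto simp: mult_ac)
      also have "\<dots> = ?B ^ 2 * fact wt * exp (- 4 * pi * Im \<tau> + Im \<tau>)"
        unfolding exp_add by (simp add: power_mult_distrib exp_of_nat_mult[symmetric] power2_eq_square exp_add[symmetric])
      also have "\<dots> \<le> ?B ^ 2 * fact wt * 1"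
      proof (intro mult_left_mono)
        have "1 * Im \<tau> \<le> 4 * pi * Im \<tau>" using \<tau> pi_ge_two by (intro mult_right_mono) auto
        then show "exp (- 4 * pi * Im \<tau> + Im \<tau>) \<le> 1" by simp
      qed auto
      finally show ?thesis by simp
    qed
    then show ?thesis by blast
  qed
  then obtain C where C: "\<And>x y \<tau>. Im \<tau> \<ge> 1 / 2 \<Longrightarrow> norm (\<phi> x y \<tau>) ^ 2 * Im \<tau> ^ wt \<le> C x y"
    by metis
  let ?I = "{0..<lev} \<times> {0..<lev}"
  define C' where "C' = Max ((\<lambda>(i, j). C (of_int i / real N) (of_int j / real N)) ` ?I)"
  have high: "norm (\<phi> (of_int i / real N) (of_int j / real N) \<tau>) ^ 2 * Im \<tau> ^ wt \<le> C'"
    if \<tau>: "Im \<tau> \<ge> 1 / 2" for \<tau> i j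
  proof -
    have red: "of_int k / real N = of_int (k mod lev) / real N + 2 * real N * of_int (k div lev)" for k
    proof -
      have "k = k mod lev + 2 * int N ^ 2 * (k div lev)"
        unfolding lev_def by (metis add.commute mult_div_mod_eq)
      then have "real_of_int k = of_int (k mod lev) + 2 * real N ^ 2 * of_int (k div lev)"
        by (metis (no_types, lifting) of_int_add of_int_mult of_int_numeral of_int_of_nat_eq of_int_power)
      then show ?thesis using N_pos by (simp add: field_simps power2_eq_square)
    qed
    have "\<phi> (of_int i / real N) (of_int j / real N) \<tau> = \<phi> (of_int (i mod lev) / real N) (of_int (j mod lev) / real N) \<tau>"
      using phi_shift[of \<tau> _ "i mod lev" _ "j mod lev" "i div lev" "j div lev"] \<tau> red[of i] red[of j] by simp
    moreover have "C (of_int (i mod lev) / real N) (of_int (j mod lev) / real N) \<le> C'"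
      unfolding C'_def using lev_pos by (intro Max_ge) (auto intro!: image_eqI[of _ _ "(i mod lev, j mod lev)"])
    ultimately show ?thesis using C[OF \<tau>] order_trans by metis
  qed
  have "norm (\<phi> (of_int i / real N) (of_int j / real N) \<tau>) ^ 2 * Im \<tau> ^ wt \<le> C'"
    if \<tau>: "Im \<tau> > 0" for \<tau> i j
  proof -
    obtain a b c d where det: "a * d - b * c = 1" and im: "Im (mob a b c d \<tau>) \<ge> 1 / 2"
      using exists_mob_Im_ge_half[OF \<tau>] by blast
    \<comment> \<open>The row vector (i, j) times the inverse matrix, so that the transformation law
      returns to (i, j).\<close>
    let ?i = "i * d - j * c" and ?j = "- i * b + j * a"
    have "norm (\<phi> (of_int ?i / real N) (of_int ?j / real N) (mob a b c d \<tau>)) ^ 2 * Im (mob a b c d \<tau>) ^ wt \<le> C'"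
      by (rule high[OF im])
    moreover have "\<phi> (of_int ?i / real N) (of_int ?j / real N) (mob a b c d \<tau>) = jfac c d \<tau> ^ wt * \<phi> (of_int i / real N) (of_int j / real N) \<tau>"
    proof -
      have "?i * a + ?j * c = i * (a * d - b * c)" "?i * b + ?j * d = j * (a * d - b * c)"
        by (simp_all add: algebra_simps)
      then have 1: "?i * a + ?j * c = i" "?i * b + ?j * d = j" using det by simp_all
      have "of_int ?i / real N * of_int a + of_int ?j / real N * of_int c = of_int (?i * a + ?j * c) / real N"
        "of_int ?i / real N * of_int b + of_int ?j / real N * of_int d = of_int (?i * b + ?j * d) / real N"
        by (simp_all add: add_divide_distrib)
      then show ?thesis
        using modular_familyD[OF modular_family_phi det \<tau>, of "of_int ?i / real N" "of_int ?j / real N"] by (simp only: 1)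
    qed
    moreover have "jfac c d \<tau> \<noteq> 0" using jfac_nonzero_det[of _ a d b c] \<tau> det by auto
    ultimately show ?thesis using \<tau> det
      by (simp add: Im_mob norm_mult norm_power power_mult_distrib power_divide power_mult[symmetric] mult.commute)
  qed
  then show ?thesis by blast
qed

text \<open>The contribution of one overlattice: a matrix of determinant \<open>p\<close> describes its basis, and the
  adjugate matrix gives the coordinates of the same point with respect to that basis.\<close>

definition hecke_term :: "real \<Rightarrow> real \<Rightarrow> int \<Rightarrow> int \<Rightarrow> int \<Rightarrow> int \<Rightarrow> complex \<Rightarrow> complex" where
  "hecke_term x y a b c d \<tau> = \<phi> (x * of_int d - y * of_int c) (- x * of_int b + y * of_int a) (mob a b c d \<tau>) / jfac c d \<tau> ^ wt"

text \<open>Multiplication on the left changes the basis of the overlattice but neither the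
  overlattice nor the point, so the value stays.\<close>

lemma hecke_term_left:
  assumes \<tau>: "Im \<tau> > 0" and det: "a * d - b * c > 0" and det': "e * h - f * g = 1"
  shows "hecke_term x y (e*a+f*c) (e*b+f*d) (g*a+h*c) (g*b+h*d) \<tau> = hecke_term x y a b c d \<tau>"
proof -
  let ?u = "x * of_int (g*b+h*d) - y * of_int (g*a+h*c)"
  let ?v = "- x * of_int (e*b+f*d) + y * of_int (e*a+f*c)"
  have im: "Im (mob a b c d \<tau>) > 0" by (rule Im_mob_pos[OF \<tau> det])
  have nz: "jfac g h (mob a b c d \<tau>) \<noteq> 0"
    using jfac_nonzero_det[OF im, of e h f g] det' by simp
  have d: "of_int e * of_int h - of_int f * of_int g = (1::real)"
    using det' by (metis of_int_1 of_int_diff of_int_mult)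
  have "?u * of_int e + ?v * of_int g = (x * of_int d - y * of_int c) * (of_int e * of_int h - of_int f * of_int g)"
    "?u * of_int f + ?v * of_int h = (- x * of_int b + y * of_int a) * (of_int e * of_int h - of_int f * of_int g)"
    by (simp_all add: algebra_simps)
  then have uv: "?u * of_int e + ?v * of_int g = x * of_int d - y * of_int c"
    "?u * of_int f + ?v * of_int h = - x * of_int b + y * of_int a"
    unfolding d by simp_all
  have "\<phi> ?u ?v (mob e f g h (mob a b c d \<tau>)) =
      jfac g h (mob a b c d \<tau>) ^ wt * \<phi> (x * of_int d - y * of_int c) (- x * of_int b + y * of_int a) (mob a b c d \<tau>)"
    using modular_familyD[OF modular_family_phi det' im, of ?u ?v] by (simp only: uv)
  then show ?thesis
    unfolding hecke_term_def using nz
    by (simp add: mob_mob[OF \<tau> det, symmetric] jfac_mob[OF \<tau> det, symmetric] power_mult_distrib)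
qed

text \<open>Multiplication on the right changes the basis of the original lattice; the coordinates
  of the point follow and the weight factor appears.\<close>

lemma hecke_term_right:
  assumes \<tau>: "Im \<tau> > 0" and det: "e * h - f * g = 1"
  shows "hecke_term x y a b c d (mob e f g h \<tau>) = jfac g h \<tau> ^ wt *
    hecke_term (x * of_int e + y * of_int g) (x * of_int f + y * of_int h) (a*e+b*g) (a*f+b*h) (c*e+d*g) (c*f+d*h) \<tau>"
proof -
  have det0: "e * h - f * g > 0" using det by simp
  have nz: "jfac g h \<tau> \<noteq> 0" using jfac_nonzero_det[OF \<tau>, of e h f g] det by simp
  have dd: "of_int e * of_int h - of_int f * of_int g = (1::real)"
    using det by (metis of_int_1 of_int_diff of_int_mult)
  have "(x * of_int e + y * of_int g) * of_int (c*f+d*h) - (x * of_int f + y * of_int h) * of_int (c*e+d*g) =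
      (x * of_int d - y * of_int c) * (of_int e * of_int h - of_int f * of_int g)"
    "- (x * of_int e + y * of_int g) * of_int (a*f+b*h) + (x * of_int f + y * of_int h) * of_int (a*e+b*g) =
      (- x * of_int b + y * of_int a) * (of_int e * of_int h - of_int f * of_int g)"
    by (simp_all add: algebra_simps)
  then have "(x * of_int e + y * of_int g) * of_int (c*f+d*h) - (x * of_int f + y * of_int h) * of_int (c*e+d*g) =
      x * of_int d - y * of_int c"
    "- (x * of_int e + y * of_int g) * of_int (a*f+b*h) + (x * of_int f + y * of_int h) * of_int (a*e+b*g) =
      - x * of_int b + y * of_int a"
    unfolding dd by simp_all
  then show ?thesis
    unfolding hecke_term_def mob_mob[OF \<tau> det0] jfac_mob[OF \<tau> det0, symmetric] using nz
    by (simp add: power_mult_distrib)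
qed

lemma hecke_term_translate:
  assumes "Im \<tau> > 0"
  shows "hecke_term x y a b c d (\<tau> + of_int n) = hecke_term x (x * of_int n + y) a (a * n + b) c (c * n + d) \<tau>"
  using hecke_term_right[OF assms, of 1 1 n 0 x y a b c d] by simp

lemma hecke_term_invert:
  assumes "Im \<tau> > 0"
  shows "hecke_term x y a b c d (- 1 / \<tau>) = \<tau> ^ wt * hecke_term y (- x) b (- a) d (- c) \<tau>"
  using hecke_term_right[OF assms, of 0 0 "-1" 1 x y a b c d] by simp

lemma holomorphic_on_hecke_term:
  assumes "a * d - b * c > 0"
  shows "hecke_term x y a b c d holomorphic_on {\<tau>. Im \<tau> > 0}"
  unfolding hecke_term_def by (rule holomorphic_on_mob_compose[OF holomorphic_on_phi assms])

lemma weight_bounded_hecke_term: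
  assumes det: "a * d - b * c > 0"
  shows "weight_bounded wt (hecke_term (of_int i / real N) (of_int j / real N) a b c d)"
proof -
  obtain C where C: "\<And>\<tau> i j. Im \<tau> > 0 \<Longrightarrow> norm (\<phi> (of_int i / real N) (of_int j / real N) \<tau>) ^ 2 * Im \<tau> ^ wt \<le> C"
    using phi_weight_bound by blast
  have "norm (hecke_term (of_int i / real N) (of_int j / real N) a b c d \<tau>) ^ 2 * Im \<tau> ^ wt \<le> C / of_int (a * d - b * c) ^ wt"
    if \<tau>: "Im \<tau> > 0" for \<tau>
  proof -
    let ?D = "real_of_int (a * d - b * c)"
    have D: "?D > 0" using det by (simp only: of_int_0_less_iff)
    have "jfac c d \<tau> \<noteq> 0" using jfac_nonzero_det[of _ a d b c] \<tau> det by auto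
    then have "norm (hecke_term (of_int i / real N) (of_int j / real N) a b c d \<tau>) ^ 2 * Im \<tau> ^ wt * ?D ^ wt =
        norm (\<phi> (of_int (i * d - j * c) / real N) (of_int (- i * b + j * a) / real N) (mob a b c d \<tau>)) ^ 2 * Im (mob a b c d \<tau>) ^ wt"
      unfolding hecke_term_def Im_mob[OF \<tau>]
      by (simp add: norm_divide norm_power power_divide power_mult_distrib power_mult[symmetric] mult.commute
          diff_divide_distrib[symmetric] add_divide_distrib[symmetric] minus_divide_left[symmetric] del: minus_divide_left)
    also have "\<dots> \<le> C" by (rule C[OF Im_mob_pos[OF \<tau> det]])
    finally show ?thesis using D by (simp only: pos_le_divide_eq[OF zero_less_power[OF D]])
  qed
  then show ?thesis unfolding weight_bounded_def by blast
qed

end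

section \<open>The Hecke operator at a prime\<close>

locale hecke_prime = hecke_setup +
  fixes p :: nat
  assumes p: "prime p"
begin

text \<open>One upper triangular matrix for each of the p + 1 overlattices of index p. The
  normalising power of p is supplied only when coefficients are computed.\<close>

definition hecke :: "real \<Rightarrow> real \<Rightarrow> complex \<Rightarrow> complex" where
  "hecke x y \<tau> = (\<Sum>j\<in>{0..<int p}. hecke_term x y 1 j 0 (int p) \<tau>) + hecke_term x y (int p) 0 0 1 \<tau>"

lemma p_pos: "int p > 0" using p by (simp add: prime_gt_0_nat)

lemma hecke_term_periodic:
  assumes "Im \<tau> > 0"
  shows "hecke_term x y 1 (j + int p * m) 0 (int p) \<tau> = hecke_term x y 1 j 0 (int p) \<tau>"
  using hecke_term_left[OF assms, of 1 "int p" j 0 1 1 m 0 x y] p_pos by (simp add: mult.commute)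

lemma hecke_translate:
  assumes \<tau>: "Im \<tau> > 0"
  shows "hecke x y (\<tau> + of_int n) = hecke x (x * of_int n + y) \<tau>"
proof -
  let ?f = "\<lambda>j. hecke_term x (x * of_int n + y) 1 j 0 (int p) \<tau>"
  have "(\<Sum>j\<in>{0..<int p}. hecke_term x y 1 j 0 (int p) (\<tau> + of_int n)) = (\<Sum>j\<in>{0..<int p}. ?f (1 * j + n))"
    by (simp add: hecke_term_translate[OF \<tau>] add.commute)
  also have "\<dots> = (\<Sum>j\<in>{0..<int p}. ?f j)"
    by (rule sum_periodic_affine) (use p_pos hecke_term_periodic[OF \<tau>] in auto)
  finally show ?thesis
    using hecke_term_left[OF \<tau>, of "int p" 1 0 0 1 1 "n * int p" 0 x "x * of_int n + y"] p_pos
    by (simp add: hecke_def hecke_term_translate[OF \<tau>] mult.commute)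
qed

text \<open>Inversion permutes the p + 1 overlattices: the two diagonal matrices are exchanged, and
  a nonzero j goes to the residue j' with j j' congruent to - 1 modulo p.\<close>

lemma hecke_invert:
  assumes \<tau>: "Im \<tau> > 0"
  shows "hecke x y (- 1 / \<tau>) = \<tau> ^ wt * hecke y (- x) \<tau>"
proof -
  let ?F = "hecke_term y (- x)"
  let ?P = "\<lambda>j j'. j' \<in> {1..<int p} \<and> int p dvd 1 + j * j'"
  have prime: "prime (int p)" using p by simp
  have ex: "\<exists>j'. ?P j j'" if j: "j \<in> {1..<int p}" for j
  proof -
    have "\<not> int p dvd j" using j zdvd_imp_le[of "int p" j] by auto
    then have "coprime j (int p)" using prime by (metis coprime_commute prime_imp_coprime)
    then obtain k where k: "[j * k = 1] (mod int p)" using cong_solve_coprime_int by blast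
    let ?j = "(- k) mod int p"
    have "[1 + j * ?j = 1 + j * (- k)] (mod int p)"
      by (intro cong_add cong_mult cong_refl) (simp add: cong_def)
    also have "[1 + j * (- k) = 1 - 1] (mod int p)"
      using cong_diff[OF cong_refl[of 1] k] by simp
    finally have dv: "int p dvd 1 + j * ?j" by (simp add: cong_0_iff)
    have "?j \<noteq> 0"
    proof
      assume "?j = 0"
      then have "int p dvd 1" using dv by simp
      then show False using prime not_prime_unit by blast
    qed
    then have "?j \<in> {1..<int p}" using p_pos pos_mod_bound[of "int p" "- k"] pos_mod_sign[of "int p" "- k"]
      unfolding atLeastLessThan_iff by linarith
    then show ?thesis using dv by blast
  qed
  have uniq: "j1 = j2" if "j \<in> {1..<int p}" "?P j j1" "?P j j2" for j j1 j2
  proof -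
    have "int p dvd (1 + j * j1) - (1 + j * j2)" using that by (intro dvd_diff) auto
    then have "int p dvd j * (j1 - j2)" by (simp add: algebra_simps)
    then have "int p dvd j1 - j2"
      using prime prime_dvd_mult_iff[of "int p"] that(1) zdvd_imp_le[of "int p" j] by auto
    then show ?thesis using that by (metis atLeastLessThan_iff dual_order.strict_trans2 int_one_le_iff_zero_less
      less_imp_le mod_eq_dvd_iff mod_pos_pos_trivial)
  qed
  obtain J where J: "\<And>j. j \<in> {1..<int p} \<Longrightarrow> ?P j (J j)" using ex by metis
  have JJ: "J (J j) = j" if j: "j \<in> {1..<int p}" for j
    using uniq[of "J j" "J (J j)" j] J[OF j] J[of "J j"] j by (simp add: mult.commute)
  have split: "(\<Sum>j\<in>{0..<int p}. f j) = f 0 + (\<Sum>j\<in>{1..<int p}. f j)" for f :: "int \<Rightarrow> complex"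
  proof -
    have "{0..<int p} = insert 0 {1..<int p}" using p_pos by auto
    then show ?thesis by simp
  qed
  have inner: "hecke_term y (- x) j (- 1) (int p) 0 \<tau> = ?F 1 (J j) 0 (int p) \<tau>" if j: "j \<in> {1..<int p}" for j
  proof -
    \<comment> \<open>With this g the unimodular matrix (j, - g; p, - J j) times (1, J j; 0, p)
      equals (j, - 1; p, 0), the matrix produced by inversion.\<close>
    obtain g where g: "1 + j * J j = int p * g" using J[OF j] by auto
    have "j * (- J j) - (- g) * int p = 1" using g by (simp add: algebra_simps)
    note left = hecke_term_left[OF \<tau> _ this, of 1 "int p" "J j" 0 y "- x"]
    have "j * 1 + (- g) * 0 = j" "j * J j + (- g) * int p = - 1" "int p * 1 + (- J j) * 0 = int p"
      "int p * J j + (- J j) * int p = 0" using g by (simp_all add: algebra_simps)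
    note eqs = this
    show ?thesis using left p_pos unfolding eqs by simp
  qed
  have "hecke x y (- 1 / \<tau>) = \<tau> ^ wt * ((\<Sum>j\<in>{0..<int p}. ?F j (- 1) (int p) 0 \<tau>) + ?F 0 (- int p) 1 0 \<tau>)"
    by (simp only: hecke_def hecke_term_invert[OF \<tau>] sum_distrib_left distrib_left minus_zero)
  also have "(\<Sum>j\<in>{0..<int p}. ?F j (- 1) (int p) 0 \<tau>) = ?F 0 (- 1) (int p) 0 \<tau> + (\<Sum>j\<in>{1..<int p}. ?F 1 (J j) 0 (int p) \<tau>)"
    unfolding split by (simp add: inner)
  also have "(\<Sum>j\<in>{1..<int p}. ?F 1 (J j) 0 (int p) \<tau>) = (\<Sum>j\<in>{1..<int p}. ?F 1 j 0 (int p) \<tau>)"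
    by (rule sum.reindex_bij_witness[where i = J and j = J]) (use J JJ in auto)
  also have "?F 0 (- 1) (int p) 0 \<tau> = ?F (int p) 0 0 1 \<tau>"
    using hecke_term_left[OF \<tau>, of "int p" 1 0 0 0 0 "-1" 1 y "- x"] p_pos by simp
  also have "?F 0 (- int p) 1 0 \<tau> = ?F 1 0 0 (int p) \<tau>"
    using hecke_term_left[OF \<tau>, of 1 "int p" 0 0 0 0 "-1" 1 y "- x"] p_pos by simp
  finally show ?thesis by (simp add: hecke_def split algebra_simps)
qed

lemma modular_family_hecke: "modular_family wt hecke"
  by (rule modular_familyI[OF hecke_translate hecke_invert])

text \<open>Overlattice coordinates are integral linear forms in (x, y), so shifts by 2 N become
  shifts by multiples of 2 N, whatever p is.\<close>

lemma hecke_shift: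
  assumes \<tau>: "Im \<tau> > 0"
  shows "hecke (of_int i / real N + 2 * real N * of_int m) (of_int j / real N + 2 * real N * of_int n) \<tau> =
    hecke (of_int i / real N) (of_int j / real N) \<tau>"
proof -
  have "hecke_term (of_int i / real N + 2 * real N * of_int m) (of_int j / real N + 2 * real N * of_int n) a b c d \<tau> =
      hecke_term (of_int i / real N) (of_int j / real N) a b c d \<tau>" if "a * d - b * c > 0" for a b c d
  proof -
    have eq: "(of_int i / real N + 2 * real N * of_int m) * of_int d - (of_int j / real N + 2 * real N * of_int n) * of_int c =
        of_int (i * d - j * c) / real N + 2 * real N * of_int (m * d - n * c)"
      "- (of_int i / real N + 2 * real N * of_int m) * of_int b + (of_int j / real N + 2 * real N * of_int n) * of_int a =
        of_int (- i * b + j * a) / real N + 2 * real N * of_int (- m * b + n * a)"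
      "of_int i / real N * of_int d - of_int j / real N * of_int c = of_int (i * d - j * c) / real N"
      "- (of_int i / real N) * of_int b + of_int j / real N * of_int a = of_int (- i * b + j * a) / real N"
      using N_pos by (simp_all add: field_simps)
    show ?thesis
      unfolding hecke_term_def eq by (subst phi_shift[OF Im_mob_pos[OF \<tau> that] refl refl]) (rule refl)
  qed
  then show ?thesis using p_pos by (simp add: hecke_def)
qed

lemma level_form_hecke: "level_form wt lev (hecke (of_int i / real N) (of_int j / real N))"
  unfolding level_form_def
proof (intro conjI allI impI)
  show "hecke (of_int i / real N) (of_int j / real N) holomorphic_on {\<tau>. Im \<tau> > 0}"
    unfolding hecke_def using p_pos by (intro holomorphic_intros holomorphic_on_hecke_term) auto
  show "weight_bounded wt (hecke (of_int i / real N) (of_int j / real N))"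
    unfolding hecke_def using p_pos by (intro weight_bounded_add weight_bounded_sum weight_bounded_hecke_term) auto
  fix a b c d \<tau>
  assume det: "a * d - b * c = 1" and dv: "lev dvd a - 1" "lev dvd b" "lev dvd c" "lev dvd d - 1" and \<tau>: "Im \<tau> > 0"
  obtain a' b' c' d' where abcd: "a = 1 + lev * a'" "b = lev * b'" "c = lev * c'" "d = 1 + lev * d'"
    using dv by (auto simp: dvd_def algebra_simps)
  have lev: "real_of_int lev = 2 * real N * real N" by (simp add: lev_def power2_eq_square)
  have eq: "of_int i / real N * of_int a + of_int j / real N * of_int c = of_int i / real N + 2 * real N * of_int (i * a' + j * c')"
    "of_int i / real N * of_int b + of_int j / real N * of_int d = of_int j / real N + 2 * real N * of_int (i * b' + j * d')"
    using N_pos by (simp_all add: abcd lev field_simps)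
  show "hecke (of_int i / real N) (of_int j / real N) (mob a b c d \<tau>) = jfac c d \<tau> ^ wt * hecke (of_int i / real N) (of_int j / real N) \<tau>"
    using modular_familyD[OF modular_family_hecke det \<tau>, of "of_int i / real N" "of_int j / real N"]
    unfolding eq hecke_shift[OF \<tau>] .
qed

end

section \<open>Power series expansions\<close>

text \<open>Used with Q = p to keep the exponents divisible by p in the Hecke sum, and with Q = 24 r
  to isolate a residue class.\<close>

lemma sum_qe_roots:
  fixes m :: int
  assumes Q: "Q > 0"
  shows "(\<Sum>i<Q. qe (of_int m * of_nat i / of_nat Q)) = (if int Q dvd m then of_nat Q else 0)"
proof -
  define \<zeta> where "\<zeta> = qe (of_int m / of_nat Q)"
  have pow: "qe (of_int m * of_nat i / of_nat Q) = \<zeta> ^ i" for i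
    by (simp add: \<zeta>_def qe_power mult.commute)
  have "\<zeta> = 1 \<longleftrightarrow> int Q dvd m"
  proof
    assume "\<zeta> = 1"
    then obtain k where "of_int m / of_nat Q = (of_int k :: complex)"
      by (auto simp: \<zeta>_def qe_eq_1_iff elim: Ints_cases)
    then have "(of_int m :: complex) = of_int (k * int Q)" using Q by (simp add: field_simps)
    then have "m = k * int Q" by (simp only: of_int_eq_iff)
    then show "int Q dvd m" by simp
  next
    assume "int Q dvd m"
    then obtain k where "m = int Q * k" by blast
    then show "\<zeta> = 1" using Q by (simp add: \<zeta>_def)
  qed
  moreover have "\<zeta> ^ Q = 1" using Q by (simp add: \<zeta>_def qe_power)
  ultimately show ?thesis
    unfolding pow by (auto simp: sum_gp_strict)
qed

lemma klein_shift_nat_0: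
  assumes "Im \<tau> > 0"
  shows "klein (x + of_nat m) 0 \<tau> = (- 1) ^ m * klein x 0 \<tau>"
  using klein_plus_1_left[OF assms, of "x + of_nat _" 0] by (induction m) (simp_all add: add_ac)

lemma int_series_of_sums:
  assumes "\<And>w. norm w < 1 \<Longrightarrow> (\<lambda>n. of_int (fps_nth F n) * w ^ n) sums g w"
  shows "int_series g F"
  unfolding int_series_def
proof
  let ?F = "Abs_fps (\<lambda>n. of_int (fps_nth F n)) :: complex fps"
  show "g holomorphic_on ball 0 1"
    using assms by (intro power_series_holomorphic[of 0 1 "\<lambda>n. of_int (fps_nth F n)"]) auto
  have "fps_conv_radius ?F \<ge> 1"
    unfolding fps_conv_radius_def using assms
    by (intro conv_radius_geI_ex') (auto simp: sums_iff simp del: of_int_eq_iff)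
  moreover have "eval_fps ?F w = g w" if "norm w < 1" for w
    using assms[OF that] by (simp add: eval_fps_def sums_iff)
  then have "\<forall>\<^sub>F w in nhds 0. eval_fps ?F w = g w"
    by (intro eventually_mono[OF eventually_nhds_in_open[of "ball 0 1"]]) auto
  ultimately show "g has_fps_expansion ?F"
    by (auto simp: has_fps_expansion_def intro: less_le_trans[of _ 1])
qed

lemma int_series_compose_power:
  assumes "int_series f G" "R > 0"
  shows "int_series (\<lambda>w. f (w ^ R)) (Abs_fps (\<lambda>n. if R dvd n then fps_nth G (n div R) else 0))"
proof (rule int_series_of_sums)
  fix w :: complex assume w: "norm w < 1"
  then have wR: "norm (w ^ R) < 1" using assms(2) by (simp add: norm_power power_less_one_iff)
  let ?F = "\<lambda>n. of_int (fps_nth (Abs_fps (\<lambda>n. if R dvd n then fps_nth G (n div R) else 0)) n) * w ^ n"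
  have "(\<lambda>n. ?F (R * n)) sums f (w ^ R)"
    using int_series_sums[OF assms(1) wR] assms(2) by (simp add: power_mult)
  moreover have "strict_mono (\<lambda>n. R * n)" using assms(2) by (simp add: strict_mono_def)
  moreover have "?F n = 0" if "n \<notin> range (\<lambda>n. R * n)" for n
    using that by (auto simp: dvd_def)
  ultimately show "?F sums f (w ^ R)" using sums_mono_reindex[of "\<lambda>n. R * n" ?F] by simp
qed

text \<open>With z^2 = \<open>qe \<tau>\<close> this is - 16 times \<open>half_disc \<tau>\<close>
  divided by \<open>qe \<tau>\<close>. The exponent 6 collects the squared denominators of three
  theta functions.\<close>

definition half_series :: "complex \<Rightarrow> complex" where
  "half_series z = (qpoch (z ^ 2) (z ^ 2) ^ 6 *
     inverse (qpoch (z ^ 2) z ^ 2 * (qpoch (z ^ 2) (- (z ^ 2)) ^ 2 * qpoch (z ^ 2) (- z) ^ 2))) ^ 4"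

lemma qpoch_power_nonzero:
  assumes "norm z < 1" "norm X < 1"
  shows "qpoch (z ^ 2) X \<noteq> 0"
proof -
  have "norm (z ^ 2) < 1" using assms by (simp add: norm_power power_less_one_iff)
  moreover have "norm (X * (z ^ 2) ^ n) < 1" for n
  proof -
    have "norm (z ^ 2) ^ n \<le> 1" using assms by (intro power_le_one) (auto simp: norm_power intro: power_le_one)
    then have "norm X * norm (z ^ 2) ^ n \<le> norm X * 1" by (intro mult_left_mono) auto
    then show ?thesis using assms(2) by (simp add: norm_mult norm_power)
  qed
  ultimately show ?thesis using qpoch_0_iff by (metis norm_one order_less_irrefl)
qed

lemma int_series_half_series: "\<exists>G. int_series half_series G \<and> fps_nth G 0 = 1"
proof -
  obtain F0 where F0: "int_series (\<lambda>z. qpoch (z ^ 2) (z ^ 2) ^ 6) F0" "fps_nth F0 0 = 1"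
    using int_series_qpoch[of 2 2 1] int_series_power_ex[of "\<lambda>z. qpoch (z ^ 2) (z ^ 2)" _ 6] by auto
  obtain F1 where F1: "int_series (\<lambda>z. qpoch (z ^ 2) z ^ 2) F1" "fps_nth F1 0 = 1"
    using int_series_qpoch[of 1 2 1] int_series_power_ex[of "\<lambda>z. qpoch (z ^ 2) z" _ 2] by auto
  obtain F2 where F2: "int_series (\<lambda>z. qpoch (z ^ 2) (- (z ^ 2)) ^ 2) F2" "fps_nth F2 0 = 1"
    using int_series_qpoch[of 2 2 "- 1"] int_series_power_ex[of "\<lambda>z. qpoch (z ^ 2) (- (z ^ 2))" _ 2] by auto
  obtain F3 where F3: "int_series (\<lambda>z. qpoch (z ^ 2) (- z) ^ 2) F3" "fps_nth F3 0 = 1"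
    using int_series_qpoch[of 1 2 "- 1"] int_series_power_ex[of "\<lambda>z. qpoch (z ^ 2) (- z)" _ 2] by auto
  have "int_series (\<lambda>z. qpoch (z ^ 2) z ^ 2 * (qpoch (z ^ 2) (- (z ^ 2)) ^ 2 * qpoch (z ^ 2) (- z) ^ 2)) (F1 * (F2 * F3))"
    by (intro int_series_mult F1 F2 F3)
  note int_series_inverse_ex[OF this]
  then have "\<exists>G. int_series (\<lambda>z. inverse (qpoch (z ^ 2) z ^ 2 * (qpoch (z ^ 2) (- (z ^ 2)) ^ 2 * qpoch (z ^ 2) (- z) ^ 2))) G \<and> fps_nth G 0 = 1"
    using F1(2) F2(2) F3(2) by (auto simp: qpoch_power_nonzero norm_power power_less_one_iff)
  then obtain G where G: "int_series (\<lambda>z. inverse (qpoch (z ^ 2) z ^ 2 * (qpoch (z ^ 2) (- (z ^ 2)) ^ 2 * qpoch (z ^ 2) (- z) ^ 2))) G"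
    "fps_nth G 0 = 1" by blast
  show ?thesis
    using int_series_power_ex[OF int_series_mult[OF F0(1) G(1)], of 4] F0(2) G(2)
    unfolding half_series_def by simp
qed

text \<open>The power 16 = 2^4 comes from the factor 1 - (- 1) at the half period 1/2, the minus
  sign from the fourth power of a prefactor at the half period (\<tau> + 1) / 2, and
  \<open>qe \<tau>\<close> from the two half periods involving \<tau>.\<close>

lemma half_disc_eq:
  assumes \<tau>: "Im \<tau> > 0"
  shows "half_disc \<tau> = - (1 / 16) * qe \<tau> * half_series (qe (\<tau> / 2))"
proof -
  let ?z = "qe (\<tau> / 2)"
  have q: "qe \<tau> = ?z ^ 2" by (simp add: qe_power)
  have k1: "klein (1/2) 0 \<tau> ^ 4 = inverse (qe (\<tau> / 2)) * (qpoch (?z ^ 2) ?z ^ 2 / qpoch (?z ^ 2) (?z ^ 2) ^ 2) ^ 4"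
  proof -
    have "klein (1/2) 0 \<tau> = qe (- \<tau> / 8) * (qpoch (?z ^ 2) ?z ^ 2 / qpoch (?z ^ 2) (?z ^ 2) ^ 2)"
    proof -
      have "qe ((1/2) * ((1/2) * \<tau>) / 2) * qe (- ((1/2) * \<tau>) / 2) = qe (- \<tau> / 8)"
        unfolding qe_add[symmetric] by (intro arg_cong[where f = qe]) simp
      moreover have "\<tau> - \<tau> / 2 = \<tau> / 2" by simp
      ultimately show ?thesis
        unfolding klein_def theta_def q[symmetric] by (simp add: power2_eq_square mult.assoc[symmetric])
    qed
    moreover have "qe (- \<tau> / 8) ^ 4 = inverse (qe (\<tau> / 2))"
      unfolding qe_minus[symmetric] by (simp add: qe_power)
    ultimately show ?thesis by ((simp only: power_mult_distrib), (simp; fail)?)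
  qed
  have k2: "klein 0 (1/2) \<tau> ^ 4 = 16 * (qpoch (?z ^ 2) (- (?z ^ 2)) ^ 2 / qpoch (?z ^ 2) (?z ^ 2) ^ 2) ^ 4"
  proof -
    have "qe (\<tau> - 1 / 2) = - qe \<tau>" by (simp add: qe_diff)
    moreover have "qpoch (qe \<tau>) (- 1) = 2 * qpoch (qe \<tau>) (- qe \<tau>)"
      using qpoch_rec[of "qe \<tau>" "- 1"] \<tau> by simp
    ultimately have "klein 0 (1/2) \<tau> = qe (- 1 / 4) * 2 * (qpoch (?z ^ 2) (- (?z ^ 2)) ^ 2 / qpoch (?z ^ 2) (?z ^ 2) ^ 2)"
      unfolding klein_def theta_def q[symmetric] by (simp add: power2_eq_square)
    moreover have "qe (- 1 / 4) ^ 4 = 1"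
    proof -
      have "qe (- 1 / 4) ^ 4 = qe (of_int (- 1))" unfolding qe_power by simp
      then show ?thesis by (simp only: qe_of_int)
    qed
    ultimately show ?thesis by ((simp only: power_mult_distrib), (simp; fail)?)
  qed
  have k3: "klein (1/2) (1/2) \<tau> ^ 4 = - inverse (qe (\<tau> / 2)) * (qpoch (?z ^ 2) (- ?z) ^ 2 / qpoch (?z ^ 2) (?z ^ 2) ^ 2) ^ 4"
  proof -
    have "klein (1/2) (1/2) \<tau> = qe (- \<tau> / 8 - 1 / 8) * (qpoch (?z ^ 2) (- ?z) ^ 2 / qpoch (?z ^ 2) (?z ^ 2) ^ 2)"
    proof -
      have "qe ((1/2) * ((1/2) * \<tau> + 1/2) / 2) * qe (- ((1/2) * \<tau> + 1/2) / 2) = qe (- \<tau> / 8 - 1 / 8)"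
        unfolding qe_add[symmetric] by (intro arg_cong[where f = qe]) (simp add: field_simps)
      moreover have "qe (\<tau> / 2 + 1 / 2) = - ?z" by (simp add: qe_add)
      moreover have "qe (\<tau> - (\<tau> / 2 + 1 / 2)) = - ?z"
      proof -
        have "\<tau> - (\<tau> / 2 + 1 / 2) = \<tau> / 2 - 1 / 2" by simp
        then show ?thesis by (simp only: qe_diff qe_half) simp
      qed
      ultimately show ?thesis
        unfolding klein_def theta_def q[symmetric] by (simp add: power2_eq_square mult.assoc[symmetric])
    qed
    moreover have "qe (- \<tau> / 8 - 1 / 8) ^ 4 = - inverse (qe (\<tau> / 2))"
    proof -
      have "qe (- \<tau> / 8 - 1 / 8) ^ 4 = qe (- (\<tau> / 2) - 1 / 2)" 
        unfolding qe_power by (intro arg_cong[where f = qe]) (simp add: field_simps)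
      then show ?thesis by (simp add: qe_diff qe_minus)
    qed
    ultimately show ?thesis by ((simp only: power_mult_distrib), (simp; fail)?)
  qed
  have alg: "inverse (inverse z * (a / d) ^ 4) * inverse (16 * (b / d) ^ 4) * inverse (- inverse z * (c / d) ^ 4) =
      - (1 / 16) * (z * z) * ((d * d * d) * inverse (a * (b * c))) ^ 4" for z a b c d :: complex
    by (simp only: divide_inverse power_mult_distrib power_inverse[symmetric] inverse_mult_distrib
        inverse_inverse_eq inverse_minus_eq mult_minus_left mult_minus_right mult_1_left) (simp only: mult_ac)
  have p6: "x ^ 6 = x ^ 2 * x ^ 2 * x ^ 2" for x :: complex by (simp flip: power_add)
  have "half_disc \<tau> = inverse (klein (1/2) 0 \<tau> ^ 4) * inverse (klein 0 (1/2) \<tau> ^ 4) * inverse (klein (1/2) (1/2) \<tau> ^ 4)"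
    by (simp add: half_disc_def power_mult_distrib power_inverse)
  also have "\<dots> = - (1 / 16) * (?z * ?z) * half_series ?z"
    unfolding k1 k2 k3 half_series_def p6 by (rule alg)
  also have "?z * ?z = qe \<tau>" by (simp add: q power2_eq_square)
  finally show ?thesis .
qed

context hecke_setup
begin

text \<open>The leading exponent of \<open>\<phi>\<close> at \<open>(1 / N, 0)\<close>, in units of \<open>1 / (24 N)\<close>.\<close>

definition E0 :: nat where "E0 = (t - 1) + 2 * N * card A + 24 * N"

definition bt :: "nat \<Rightarrow> int" where "bt n = int (num_regular_partitions t n)"

text \<open>By symmetry the sum over A is half the sum over nonmultiples of t below N = t m, that
  is, all residues minus multiples of t. In N (N^2 - 1) - t^2 m (m^2 - 1) the linear terms give N (t
  - 1), which is the origin of the factor t - 1.\<close>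

lemma twelve_sum_A: "12 * (\<Sum>a\<in>A. a * (N - a)) = N * (t - 1) + 2 * N ^ 2 * card A"
proof -
  define C where "C = {c \<in> {..<N}. \<not> t dvd c}"
  define m where "m = 48 * r"
  have Nm: "N = t * m" by (simp add: N_def m_def)
  have dvN: "2 * t dvd N" by (simp add: N_def)
  note C = nonmultiples_eq[OF N_pos dvN, folded A_def C_def]
  note inj = inj_on_reflect[OF N_pos dvN, folded A_def]
  note disj = reflect_disjoint[OF N_pos dvN, folded A_def]
  have le: "a \<le> N" if "a \<in> A" for a using that by (simp add: A_def)
  have cardC: "card C = 2 * card A"
    unfolding C using finite_A disj inj by (simp add: card_Un_disjoint card_image)
  have sumC: "(\<Sum>c\<in>C. f c) = 2 * (\<Sum>a\<in>A. f a)" if "\<And>a. a \<in> A \<Longrightarrow> f (N - a) = f a" for f :: "nat \<Rightarrow> int"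
    unfolding C using finite_A disj inj that by (simp add: sum.union_disjoint sum.reindex)
  define D where "D = (\<lambda>b. t * b) ` {..<m}"
  have injD: "inj_on (\<lambda>b. t * b) {..<m}" using t_ge by (auto intro: inj_onI)
  have D: "{..<N} = C \<union> D"
    using t_ge by (auto simp: C_def D_def Nm image_iff dvd_def)
  have CD: "C \<inter> D = {}" by (auto simp: C_def D_def)
  have finC: "finite C" by (simp add: C_def)
  have sq: "6 * (\<Sum>c<n. int c * (M - int c)) = 3 * M * int n * (int n - 1) - (int n - 1) * int n * (2 * int n - 1)" for n M
    by (induction n) (simp_all add: algebra_simps power2_eq_square)
  have "6 * (\<Sum>c<N. int c * (int N - int c)) = 6 * (\<Sum>c\<in>C. int c * (int N - int c)) + 6 * (\<Sum>c\<in>D. int c * (int N - int c))"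
    unfolding D using finC CD by (subst sum.union_disjoint) (auto simp: D_def)
  also have "(\<Sum>c\<in>D. int c * (int N - int c)) = int t ^ 2 * (\<Sum>b<m. int b * (int m - int b))"
    unfolding D_def sum.reindex[OF injD] Nm by (simp add: sum_distrib_left algebra_simps power2_eq_square)
  also have "(\<Sum>c\<in>C. int c * (int N - int c)) = 2 * (\<Sum>a\<in>A. int a * (int N - int a))"
    by (rule sumC) (auto simp: le of_nat_diff)
  finally have 1: "12 * (\<Sum>a\<in>A. int a * (int N - int a)) = 6 * (\<Sum>c<N. int c * (int N - int c)) - int t ^ 2 * (6 * (\<Sum>b<m. int b * (int m - int b)))"
    by simp
  have "card D = m" unfolding D_def using injD by (simp add: card_image)
  then have "N = card C + m" using card_Un_disjoint[OF finC _ CD] D by (simp add: D_def) (metis card_lessThan D_def)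
  then have cA: "2 * int (card A) = int N - int m" using cardC by simp
  have "12 * (\<Sum>a\<in>A. int a * (int N - int a)) = int N * (int t - 1) + int N ^ 2 * (2 * int (card A))"
    unfolding 1 sq cA unfolding Nm by (simp add: algebra_simps power2_eq_square power3_eq_cube)
  also have "\<dots> = int (N * (t - 1) + 2 * N ^ 2 * card A)"
    using t_ge by (simp add: of_nat_diff)
  also have "12 * (\<Sum>a\<in>A. int a * (int N - int a)) = int (12 * (\<Sum>a\<in>A. a * (N - a)))"
    by (simp add: of_nat_diff le)
  finally show ?thesis by (simp only: of_nat_eq_iff)
qed

text \<open>With x = a / N the exponential factors contribute the exponent x (1 - x) / 2 = a (N - a)
  / (2 N^2), written over 24 N^2 to fit \<open>twelve_sum_A\<close>.\<close>

lemma inverse_klein_A: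
  assumes \<tau>: "Im \<tau> > 0" and a: "a \<in> A"
  defines "w \<equiv> qe (\<tau> / of_nat N)"
  shows "inverse (klein (real a * (1 / real N)) (real a * 0) \<tau>) = qe (of_nat (12 * (a * (N - a))) * \<tau> / of_nat (24 * N ^ 2)) *
    qpoch (w ^ N) (w ^ N) ^ 2 * inverse (qpoch (w ^ N) (w ^ a) * qpoch (w ^ N) (w ^ (N - a)))"
proof -
  let ?x = "of_nat a / of_nat N :: complex"
  have le: "a \<le> N" using a by (simp add: A_def)
  have N0: "(of_nat N :: complex) \<noteq> 0" using N_pos by simp
  have wN: "w ^ N = qe \<tau>" using N_pos by (simp add: w_def qe_power)
  have wa: "w ^ a = qe (?x * \<tau>)" by (simp add: w_def qe_power)
  have wNa: "w ^ (N - a) = qe (\<tau> - ?x * \<tau>)"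
    using N0 le unfolding w_def qe_power by (intro arg_cong[where f = qe]) (simp add: of_nat_diff field_simps)
  have "klein (real a * (1 / real N)) (real a * 0) \<tau> = qe (?x * (?x * \<tau>) / 2) * (qe (- (?x * \<tau>) / 2) *
      qpoch (qe \<tau>) (qe (?x * \<tau>)) * qpoch (qe \<tau>) (qe (\<tau> - ?x * \<tau>)) / qpoch (qe \<tau>) (qe \<tau>) ^ 2)"
    by (simp add: klein_def theta_def)
  also have "\<dots> = (qe (?x * (?x * \<tau>) / 2) * qe (- (?x * \<tau>) / 2)) *
      (qpoch (w ^ N) (w ^ a) * qpoch (w ^ N) (w ^ (N - a)) / qpoch (w ^ N) (w ^ N) ^ 2)"
    unfolding wN wa wNa by simp
  also have "qe (?x * (?x * \<tau>) / 2) * qe (- (?x * \<tau>) / 2) = qe (- (of_nat (12 * (a * (N - a))) * \<tau> / of_nat (24 * N ^ 2)))"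
  proof -
    have alg: "\<alpha> / n * (\<alpha> / n * \<tau>) / 2 + - (\<alpha> / n * \<tau>) / 2 = - (12 * (\<alpha> * (n - \<alpha>)) * \<tau> / (24 * n ^ 2))"
      if "n \<noteq> 0" for \<alpha> n :: complex
    proof -
      have "\<alpha> / n = x \<Longrightarrow> x * (x * \<tau>) / 2 + - (x * \<tau>) / 2 = - (12 * (\<alpha> * (n - \<alpha>)) * \<tau> / (24 * n ^ 2))" for x
      proof -
        assume "\<alpha> / n = x"
        then have \<alpha>: "\<alpha> = x * n" using that by (simp add: field_simps)
        have eq: "12 * (\<alpha> * (n - \<alpha>)) * \<tau> = (24 * n ^ 2) * (x * (1 - x) * \<tau> / 2)"
          unfolding \<alpha> by (simp add: algebra_simps power2_eq_square)
        have nz: "24 * n ^ 2 \<noteq> 0" using that by simp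
        have "12 * (\<alpha> * (n - \<alpha>)) * \<tau> / (24 * n ^ 2) = x * (1 - x) * \<tau> / 2"
          unfolding eq by (rule nonzero_mult_div_cancel_left[OF nz])
        moreover have "x * (x * \<tau>) / 2 + - (x * \<tau>) / 2 = - (x * (1 - x) * \<tau> / 2)"
          by (simp add: algebra_simps diff_divide_distrib)
        ultimately show ?thesis by (simp only:)
      qed
      then show ?thesis by blast
    qed
    have "of_nat (12 * (a * (N - a))) = (12 * (of_nat a * (of_nat N - of_nat a)) :: complex)"
      using le by (simp add: of_nat_diff)
    moreover have "of_nat (24 * N ^ 2) = (24 * of_nat N ^ 2 :: complex)" by simp
    ultimately show ?thesis unfolding qe_add[symmetric] by (simp only: alg[OF N0])
  qed
  finally show ?thesis
    by (simp only: qe_minus divide_inverse inverse_mult_distrib inverse_inverse_eq mult_ac)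
qed

text \<open>All factors of the product that are series in \<open>qe (\<tau> / 2)\<close>. In w =
  \<open>qe (\<tau> / of_nat N)\<close> their exponents are multiples of N / 2, hence of r.\<close>

definition kernel_series :: "complex \<Rightarrow> complex" where
  "kernel_series z = qpoch (z ^ 2) (z ^ 2) ^ (2 * card A) * half_series z"

lemma phi_product:
  assumes \<tau>: "Im \<tau> > 0"
  shows "\<phi> (1 / real N) 0 \<tau> = - (1 / 16) * qe (\<tau> / of_nat (24 * N)) ^ E0 *
    (inverse (reg_prod t (qe (\<tau> / of_nat N))) * kernel_series (qe (\<tau> / of_nat N) ^ (N div 2)))"
proof -
  let ?w = "qe (\<tau> / of_nat N)"
  have N0: "(of_nat N :: complex) \<noteq> 0" using N_pos by simp
  have w: "norm ?w < 1" using \<tau> N_pos by (simp add: norm_qe Im_divide_of_nat)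
  have half: "N = 2 * (N div 2)" by (simp add: N_def)
  have wh: "?w ^ (N div 2) = qe (\<tau> / 2)"
  proof -
    have "(of_nat N :: complex) = 2 * of_nat (N div 2)"
      using half by (metis of_nat_mult of_nat_numeral)
    moreover from this have "of_nat (N div 2) \<noteq> (0 :: complex)" using N0 by auto
    ultimately have "of_nat (N div 2) * (\<tau> / of_nat N) = \<tau> / 2" by simp
    then show ?thesis by (simp only: qe_power)
  qed
  have wN: "?w ^ N = (?w ^ (N div 2)) ^ 2"
    using half by (metis mult.commute power_mult)
  have A2: "A = {a. a \<in> {1..<N} \<and> 2 * a < N \<and> \<not> t dvd a}" by (simp add: A_def)
  have div: "2 * t dvd N" by (simp add: N_def)
  have "(\<Prod>a\<in>A. inverse (klein (real a * (1 / real N)) (real a * 0) \<tau>)) =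
      (\<Prod>a\<in>A. qe (of_nat (12 * (a * (N - a))) * \<tau> / of_nat (24 * N ^ 2)) * qpoch (?w ^ N) (?w ^ N) ^ 2 *
        inverse (qpoch (?w ^ N) (?w ^ a) * qpoch (?w ^ N) (?w ^ (N - a))))"
    by (intro prod.cong refl inverse_klein_A \<tau>)
  also have "\<dots> = (\<Prod>a\<in>A. qe (of_nat (12 * (a * (N - a))) * \<tau> / of_nat (24 * N ^ 2))) *
      qpoch (?w ^ N) (?w ^ N) ^ (2 * card A) * inverse (reg_prod t ?w)"
    unfolding prod.distrib reg_prod_eq_qpoch[OF N_pos div w] A2[symmetric] prod_constant power_mult
      prod_inversef[unfolded o_def] ..
  also have "(\<Prod>a\<in>A. qe (of_nat (12 * (a * (N - a))) * \<tau> / of_nat (24 * N ^ 2))) = qe (\<tau> / of_nat (24 * N)) ^ (E0 - 24 * N)"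
  proof -
    have prodqe: "(\<Prod>a\<in>S. qe (f a)) = qe (\<Sum>a\<in>S. f a)" if "finite S" for f :: "nat \<Rightarrow> complex" and S
      using that by induction (simp_all add: qe_add)
    have "(\<Sum>a\<in>A. of_nat (12 * (a * (N - a))) * \<tau> / of_nat (24 * N ^ 2)) =
        (\<Sum>a\<in>A. of_nat (12 * (a * (N - a)))) * \<tau> / of_nat (24 * N ^ 2)"
      by (simp only: sum_distrib_right sum_divide_distrib)
    also have "(\<Sum>a\<in>A. of_nat (12 * (a * (N - a)))) = (of_nat (12 * (\<Sum>a\<in>A. a * (N - a))) :: complex)"
      by (simp only: sum_distrib_left of_nat_sum)
    also have "12 * (\<Sum>a\<in>A. a * (N - a)) = N * (E0 - 24 * N)"
      unfolding twelve_sum_A by (simp add: E0_def algebra_simps power2_eq_square)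
    also have "of_nat (N * (E0 - 24 * N)) * \<tau> / of_nat (24 * N ^ 2) = of_nat (E0 - 24 * N) * (\<tau> / of_nat (24 * N))"
      using N0 by (simp add: power2_eq_square)
    finally show ?thesis by (simp add: prodqe[OF finite_A] qe_power)
  qed
  finally have "\<phi> (1 / real N) 0 \<tau> = qe (\<tau> / of_nat (24 * N)) ^ (E0 - 24 * N) *
      qpoch (?w ^ N) (?w ^ N) ^ (2 * card A) * inverse (reg_prod t ?w) *
      (- (1 / 16) * qe \<tau> * half_series (qe (\<tau> / 2)))"
    unfolding \<phi>_def half_disc_eq[OF \<tau>] by (simp only:)
  moreover have "qe \<tau> = qe (\<tau> / of_nat (24 * N)) ^ (24 * N)"
    unfolding qe_power using N0 by simp
  moreover have "qe (\<tau> / of_nat (24 * N)) ^ E0 = qe (\<tau> / of_nat (24 * N)) ^ (E0 - 24 * N) * qe (\<tau> / of_nat (24 * N)) ^ (24 * N)"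
    by (simp add: E0_def power_add)
  ultimately show ?thesis
    unfolding kernel_series_def wN wh by (simp add: mult_ac)
qed

text \<open>The factor - 16 cancels the constant of \<open>half_disc_eq\<close>, which makes the
  coefficients integral.\<close>

definition phi_coeffs :: "(nat \<Rightarrow> int) \<Rightarrow> bool" where
  "phi_coeffs c \<longleftrightarrow> (\<forall>\<tau>. Im \<tau> > 0 \<longrightarrow>
     (\<lambda>n. of_int (c n) * qe (\<tau> / of_nat (24 * N)) ^ n) sums (- 16 * \<phi> (1 / real N) 0 \<tau>))"

text \<open>The last clause transfers divisibility from b_t to c: multiplying by a series in w^(N /
  2), with r dividing N / 2, combines only coefficients from the same class modulo r.\<close>

lemma phi_coeffs_ex:
  "\<exists>c. phi_coeffs c \<and> c E0 = 1 \<and> (\<forall>n. c n \<noteq> 0 \<longrightarrow> (\<exists>m. n = E0 + 24 * m)) \<and>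
     (\<forall>l m. (\<forall>i. i mod r = m mod r \<longrightarrow> l dvd bt i) \<longrightarrow> l dvd c (E0 + 24 * m))"
proof -
  let ?R = "N div 2"
  have R: "?R > 0" "r dvd ?R" using r_ge t_ge by (auto simp: N_def)
  obtain H where H: "int_series half_series H" "fps_nth H 0 = 1" using int_series_half_series by blast
  obtain F where F: "int_series (\<lambda>z. qpoch (z ^ 2) (z ^ 2) ^ (2 * card A)) F" "fps_nth F 0 = 1"
    using int_series_qpoch[of 2 2 1] int_series_power_ex[of "\<lambda>z. qpoch (z ^ 2) (z ^ 2)" _ "2 * card A"] by auto
  define G where "G = F * H"
  have G: "int_series kernel_series G" "fps_nth G 0 = 1"
    using int_series_mult[OF F(1) H(1)] F(2) H(2) unfolding G_def kernel_series_def by simp_all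
  define GR where "GR = Abs_fps (\<lambda>n. if ?R dvd n then fps_nth G (n div ?R) else 0)"
  have GR: "int_series (\<lambda>w. kernel_series (w ^ ?R)) GR"
    unfolding GR_def by (rule int_series_compose_power[OF G(1) R(1)])
  define B where "B = Abs_fps bt"
  have B: "int_series (\<lambda>w. inverse (reg_prod t w)) B"
    using int_series_regular_partitions[of t] t_ge by (simp add: B_def bt_def[abs_def])
  define \<beta> where "\<beta> = B * GR"
  have \<beta>: "int_series (\<lambda>w. inverse (reg_prod t w) * kernel_series (w ^ ?R)) \<beta>"
    unfolding \<beta>_def by (rule int_series_mult[OF B GR])
  define c where "c n = (if n \<ge> E0 \<and> 24 dvd n - E0 then fps_nth \<beta> ((n - E0) div 24) else 0)" for n
  have cE: "c (E0 + 24 * m) = fps_nth \<beta> m" for m by (simp add: c_def)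
  have "phi_coeffs c"
    unfolding phi_coeffs_def
  proof (intro allI impI)
    fix \<tau> assume \<tau>: "Im \<tau> > 0"
    let ?u = "qe (\<tau> / of_nat (24 * N))" and ?w = "qe (\<tau> / of_nat N)"
    have w: "norm ?w < 1" using \<tau> N_pos by (simp add: norm_qe Im_divide_of_nat)
    have wu: "?w = ?u ^ 24" unfolding qe_power by simp
    have "(\<lambda>m. ?u ^ E0 * (of_int (fps_nth \<beta> m) * ?w ^ m)) sums (?u ^ E0 * (inverse (reg_prod t ?w) * kernel_series (?w ^ ?R)))"
      by (intro sums_mult int_series_sums[OF \<beta> w])
    moreover have "?u ^ E0 * (of_int (fps_nth \<beta> m) * ?w ^ m) = of_int (c (E0 + 24 * m)) * ?u ^ (E0 + 24 * m)" for m
      unfolding cE wu by (simp add: power_add power_mult)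
    moreover have "?u ^ E0 * (inverse (reg_prod t ?w) * kernel_series (?w ^ ?R)) = - 16 * \<phi> (1 / real N) 0 \<tau>"
      unfolding phi_product[OF \<tau>] by simp
    ultimately have "(\<lambda>m. of_int (c (E0 + 24 * m)) * ?u ^ (E0 + 24 * m)) sums (- 16 * \<phi> (1 / real N) 0 \<tau>)"
      by simp
    moreover have "strict_mono (\<lambda>m. E0 + 24 * m)" by (simp add: strict_mono_def)
    moreover have "of_int (c n) * ?u ^ n = 0" if "n \<notin> range (\<lambda>m. E0 + 24 * m)" for n
    proof -
      have "\<not> (n \<ge> E0 \<and> 24 dvd n - E0)"
      proof
        assume *: "n \<ge> E0 \<and> 24 dvd n - E0"
        then obtain k where "n - E0 = 24 * k" by blast
        then have "n = E0 + 24 * k" using * by simp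
        then show False using that by blast
      qed
      then show ?thesis by (auto simp: c_def)
    qed
    ultimately show "(\<lambda>n. of_int (c n) * ?u ^ n) sums (- 16 * \<phi> (1 / real N) 0 \<tau>)"
      using sums_mono_reindex[of "\<lambda>m. E0 + 24 * m" "\<lambda>n. of_int (c n) * ?u ^ n"] by blast
  qed
  moreover have "c E0 = 1"
  proof -
    have "P = {#}" if P: "P \<in> regular_partitions t 0" for P
    proof (rule ccontr)
      assume "P \<noteq> {#}"
      then obtain x where x: "x \<in># P" by (meson multiset_nonemptyE)
      then have "sum_mset P = x + sum_mset (P - {#x#})" by (rule sum_mset.remove)
      then show False using P x by (auto simp: regular_partitions_def partitions_of_def)
    qed
    moreover have "{#} \<in> regular_partitions t 0" by (simp add: regular_partitions_def partitions_of_def)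
    ultimately have "regular_partitions t 0 = {{#}}" by blast
    then have "bt 0 = 1" by (simp add: bt_def num_regular_partitions_def)
    then show ?thesis using cE[of 0] G(2) by (simp add: \<beta>_def B_def GR_def)
  qed
  moreover have "\<exists>m. n = E0 + 24 * m" if "c n \<noteq> 0" for n
  proof -
    have "n \<ge> E0" "24 dvd n - E0" using that by (auto simp: c_def split: if_splits)
    then obtain k where "n - E0 = 24 * k" by blast
    then have "n = E0 + 24 * k" using \<open>n \<ge> E0\<close> by simp
    then show ?thesis by blast
  qed
  moreover have "l dvd c (E0 + 24 * m)" if l: "\<forall>i. i mod r = m mod r \<longrightarrow> l dvd bt i" for l m
  proof -
    have "l dvd fps_nth B i * fps_nth GR (m - i)" if "i \<in> {0..m}" for i
    proof (cases "?R dvd m - i")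
      case True
      then have "r dvd m - i" using R(2) dvd_trans by blast
      then have "i mod r = m mod r" using that by (metis atLeastAtMost_iff mod_eq_dvd_iff_nat)
      then show ?thesis using l by (simp add: B_def)
    qed (simp add: GR_def)
    then show ?thesis unfolding cE \<beta>_def fps_mult_nth by (intro dvd_sum) auto
  qed
  ultimately show ?thesis by blast
qed

text \<open>As in Gauss's lemma, A is a half system of the nonmultiples of t modulo N, and
  multiplication by p permutes it up to sign. With second coordinate 0, oddness and integer shifts
  of \<open>klein\<close> cost only signs.\<close>

lemma phi_mult_coprime:
  assumes p: "coprime p N"
  shows "\<exists>s::int. s \<in> {1, - 1} \<and> (\<forall>\<tau>. Im \<tau> > 0 \<longrightarrow> \<phi> (real p / real N) 0 \<tau> = of_int s * \<phi> (1 / real N) 0 \<tau>)"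
proof -
  \<comment> \<open>\<open>b a\<close> is the residue of p a, and \<open>\<pi> a\<close> is its
    representative in the half system.\<close>
  define b where "b a = (p * a) mod N" for a
  define \<pi> where "\<pi> a = (if 2 * b a < N then b a else N - b a)" for a
  have tN: "t dvd N" by (simp add: N_def)
  have tp: "coprime t p" using p tN coprime_divisors[of p p t N] by (simp add: coprime_commute)
  have half: "N = 2 * (N div 2)" "t dvd N div 2" by (simp_all add: N_def)
  have b: "b a < N" "\<not> t dvd b a" if "a \<in> A" for a
  proof -
    show "b a < N" using N_pos by (simp add: b_def)
    have "\<not> t dvd p * a" using that tp by (simp add: A_def coprime_dvd_mult_right_iff)
    then show "\<not> t dvd b a" using tN by (simp add: b_def dvd_mod_iff)
  qed
  have ne: "2 * b a \<noteq> N" if "a \<in> A" for a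
    using b(2)[OF that] half by (metis nat_mult_eq_cancel_disj zero_neq_numeral)
  have \<pi>A: "\<pi> a \<in> A" if a: "a \<in> A" for a
  proof -
    have "b a \<noteq> 0" using b(2)[OF a] by (metis dvd_0_right)
    moreover have "\<not> t dvd N - b a"
      using b[OF a] tN by (metis diff_diff_cancel dvd_diff_nat less_imp_le_nat)
    ultimately show ?thesis using b[OF a] ne[OF a] unfolding A_def \<pi>_def by auto
  qed
  have sgn: "\<exists>s::int. s \<in> {1, - 1} \<and> (\<forall>\<tau>. Im \<tau> > 0 \<longrightarrow>
      inverse (klein (real a * (real p / real N)) (real a * 0) \<tau>) = of_int s * inverse (klein (real (\<pi> a) * (1 / real N)) (real (\<pi> a) * 0) \<tau>))"
    if a: "a \<in> A" for a
  proof -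
    define m where "m = (p * a) div N"
    have "p * a = b a + m * N" unfolding b_def m_def by (rule mod_div_mult_eq[symmetric])
    then have "real p * real a = real (b a) + real m * real N" by (metis of_nat_add of_nat_mult)
    then have x: "real a * (real p / real N) = real (b a) / real N + real m"
      using N_pos by (simp add: field_simps)
    \<comment> \<open>If the residue lies in the upper half, the sign of the unit shift and the sign
      of oddness cancel; the sign that remains comes from the quotient m.\<close>
    have kb: "klein (real (b a) / real N) 0 \<tau> = klein (real (\<pi> a) / real N) 0 \<tau>" if \<tau>: "Im \<tau> > 0" for \<tau>
    proof (cases "2 * b a < N")
      case False
      have "real (b a) / real N = - (real (\<pi> a) / real N) + of_nat 1"
        using False b[OF a] N_pos by (simp add: \<pi>_def of_nat_diff field_simps)
      then have "klein (real (b a) / real N) 0 \<tau> = - klein (- (real (\<pi> a) / real N)) (- 0) \<tau>"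
        using klein_shift_nat_0[OF \<tau>, of "- (real (\<pi> a) / real N)" 1] by simp
      then show ?thesis using klein_minus[OF \<tau>, of "real (\<pi> a) / real N" 0] by simp
    qed (simp add: \<pi>_def)
    show ?thesis
    proof (intro exI[of _ "(- 1) ^ m"] conjI allI impI)
      show "(- 1) ^ m \<in> {1, - 1 :: int}" by (metis insert_iff neg_one_even_power neg_one_odd_power)
      fix \<tau> assume \<tau>: "Im \<tau> > 0"
      have "inverse ((- 1 :: complex) ^ m) = (- 1) ^ m" by (cases "even m") auto
      then show "inverse (klein (real a * (real p / real N)) (real a * 0) \<tau>) =
          of_int ((- 1) ^ m) * inverse (klein (real (\<pi> a) * (1 / real N)) (real (\<pi> a) * 0) \<tau>)"
        unfolding x using klein_shift_nat_0[OF \<tau>, of "real (b a) / real N" m] kb[OF \<tau>] by simp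
    qed
  qed
  have inj: "inj_on \<pi> A"
  proof (rule inj_onI)
    fix a a' assume aa: "a \<in> A" "a' \<in> A" "\<pi> a = \<pi> a'"
    have "int N dvd int p * (int a - int a') \<or> int N dvd int p * (int a + int a')"
    proof -
      have q: "[int (b a) = int p * int a] (mod int N)" "[int (b a') = int p * int a'] (mod int N)"
        by (simp_all add: b_def cong_def zmod_int)
      have "int (b a) = int (b a') \<or> int (b a) + int (b a') = int N"
        using aa(3) b[OF aa(1)] b[OF aa(2)] by (auto simp: \<pi>_def split: if_splits)
      then show ?thesis
      proof
        assume "int (b a) = int (b a')"
        then have "[int p * int a = int p * int a'] (mod int N)" using q by (metis cong_sym cong_trans)
        then show ?thesis by (simp add: cong_iff_dvd_diff right_diff_distrib)
      next
        assume *: "int (b a) + int (b a') = int N"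
        have "[int (b a) + int (b a') = int p * int a + int p * int a'] (mod int N)" using q by (rule cong_add)
        then have "[int p * int a + int p * int a' = 0] (mod int N)" unfolding * by (simp add: cong_def)
        then show ?thesis by (simp add: cong_0_iff distrib_left)
      qed
    qed
    moreover have cop: "coprime (int N) (int p)" using p by (simp add: coprime_commute)
    ultimately have "int N dvd int a - int a' \<or> int N dvd int a + int a'"
      by (simp add: coprime_dvd_mult_right_iff)
    moreover have "\<not> int N dvd int a + int a'"
      using aa zdvd_imp_le[of "int N" "int a + int a'"] by (auto simp: A_def)
    ultimately have "int N dvd int a - int a'" by blast
    moreover have "\<bar>int a - int a'\<bar> < int N" using aa by (auto simp: A_def)
    ultimately have "int a - int a' = 0" using dvd_imp_le_int[of "int a - int a'" "int N"] by linarith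
    then show "a = a'" by simp
  qed
  moreover have "\<pi> ` A = A" using endo_inj_surj[OF finite_A _ inj] \<pi>A by blast
  ultimately have bij: "bij_betw \<pi> A A" by (simp add: bij_betw_def)
  from bchoice[OF ballI[OF sgn]] obtain s :: "nat \<Rightarrow> int" where s': "\<forall>a\<in>A. s a \<in> {1, - 1} \<and> (\<forall>\<tau>. Im \<tau> > 0 \<longrightarrow>
      inverse (klein (real a * (real p / real N)) (real a * 0) \<tau>) =
        of_int (s a) * inverse (klein (real (\<pi> a) * (1 / real N)) (real (\<pi> a) * 0) \<tau>))" ..
  have s1: "s a \<in> {1, - 1}" if "a \<in> A" for a
    by (rule conjunct1[OF bspec[OF s' that]])
  have s2: "inverse (klein (real a * (real p / real N)) (real a * 0) \<tau>) =
       of_int (s a) * inverse (klein (real (\<pi> a) * (1 / real N)) (real (\<pi> a) * 0) \<tau>)"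
    if "a \<in> A" "Im \<tau> > 0" for a \<tau>
    by (rule conjunct2[OF bspec[OF s' that(1)], rule_format, OF that(2)])
  have "\<phi> (real p / real N) 0 \<tau> = of_int (\<Prod>a\<in>A. s a) * \<phi> (1 / real N) 0 \<tau>" if \<tau>: "Im \<tau> > 0" for \<tau>
  proof -
    have "(\<Prod>a\<in>A. inverse (klein (real a * (real p / real N)) (real a * 0) \<tau>)) =
        (\<Prod>a\<in>A. of_int (s a) * inverse (klein (real (\<pi> a) * (1 / real N)) (real (\<pi> a) * 0) \<tau>))"
      by (rule prod.cong[OF refl]) (rule s2[OF _ \<tau>])
    also have "\<dots> = of_int (\<Prod>a\<in>A. s a) * (\<Prod>a\<in>A. inverse (klein (real (\<pi> a) * (1 / real N)) (real (\<pi> a) * 0) \<tau>))"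
      by (simp only: prod.distrib of_int_prod)
    also have "(\<Prod>a\<in>A. inverse (klein (real (\<pi> a) * (1 / real N)) (real (\<pi> a) * 0) \<tau>)) =
        (\<Prod>a\<in>A. inverse (klein (real a * (1 / real N)) (real a * 0) \<tau>))"
      by (rule prod.reindex_bij_betw[OF bij])
    finally show ?thesis unfolding \<phi>_def by (simp only: mult.assoc)
  qed
  moreover have "(\<Prod>a\<in>S. s a) \<in> {1, - 1}" if "finite S" "S \<subseteq> A" for S
    using that
  proof (induction S rule: finite_induct)
    case (insert x F)
    then have "s x \<in> {1, - 1}" "(\<Prod>a\<in>F. s a) \<in> {1, - 1}" using s1 by auto
    then show ?case using insert by auto
  qed simp
  then have "(\<Prod>a\<in>A. s a) \<in> {1, - 1}" using finite_A by blast
  ultimately show ?thesis by blast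
qed

end

section \<open>Spreading nonvanishing along primes\<close>

text \<open>Fraction-free elimination: a row with nonzero entry in the last column serves as pivot
  and is removed together with that column.\<close>

lemma int_relation_nonzero:
  fixes a :: "'i \<Rightarrow> nat \<Rightarrow> int"
  assumes "finite I" "card I > B"
  shows "\<exists>c. (\<exists>i\<in>I. c i \<noteq> 0) \<and> (\<forall>n<B. (\<Sum>i\<in>I. c i * a i n) = 0)"
  using assms
proof (induction B arbitrary: I a)
  case 0
  then have "I \<noteq> {}" by auto
  then show ?case by (intro exI[of _ "\<lambda>_. 1"]) auto
next
  case (Suc B)
  show ?case
  proof (cases "\<forall>i\<in>I. a i B = 0")
    case True
    obtain c where c: "\<exists>i\<in>I. c i \<noteq> 0" "\<forall>n<B. (\<Sum>i\<in>I. c i * a i n) = 0"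
      using Suc.IH[of I a] Suc.prems by auto
    then have "\<forall>n<Suc B. (\<Sum>i\<in>I. c i * a i n) = 0" using True by (simp add: less_Suc_eq)
    then show ?thesis using c(1) by blast
  next
    case False
    then obtain j where j: "j \<in> I" "a j B \<noteq> 0" by blast
    let ?I = "I - {j}" and ?a = "\<lambda>i n. a j B * a i n - a i B * a j n"
    have "finite ?I" "card ?I > B" using Suc.prems j(1) by simp_all
    then obtain c where c: "\<exists>i\<in>?I. c i \<noteq> 0" "\<forall>n<B. (\<Sum>i\<in>?I. c i * ?a i n) = 0"
      using Suc.IH[of ?I ?a] by auto
    define c' where "c' = (\<lambda>i. if i = j then - (\<Sum>i\<in>?I. c i * a i B) else c i * a j B)"
    have "(\<Sum>i\<in>I. c' i * a i n) = (\<Sum>i\<in>?I. c i * ?a i n)" for n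
    proof -
      have "(\<Sum>i\<in>I. c' i * a i n) = c' j * a j n + (\<Sum>i\<in>?I. c' i * a i n)"
        by (rule sum.remove[OF Suc.prems(1) j(1)])
      also have "(\<Sum>i\<in>?I. c' i * a i n) = (\<Sum>i\<in>?I. c i * a j B * a i n)"
        by (intro sum.cong) (auto simp: c'_def)
      also have "c' j * a j n + (\<Sum>i\<in>?I. c i * a j B * a i n) = (\<Sum>i\<in>?I. c i * a j B * a i n) - (\<Sum>i\<in>?I. c i * a i B) * a j n"
        by (simp add: c'_def)
      also have "\<dots> = (\<Sum>i\<in>?I. c i * ?a i n)"
        unfolding sum_distrib_right sum_subtractf[symmetric] by (intro sum.cong refl) (simp add: algebra_simps)
      finally show ?thesis .
    qed
    then have "\<forall>n<Suc B. (\<Sum>i\<in>I. c' i * a i n) = 0"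
      using c(2) by (simp add: less_Suc_eq mult.commute)
    moreover have "\<exists>i\<in>I. c' i \<noteq> 0" using c(1) j(2) by (auto simp: c'_def)
    ultimately show ?thesis by blast
  qed
qed

text \<open>While all coefficients are divisible by l, dividing by l gives a smaller relation. A
  relation that survives reduction modulo l is what carries the bound from characteristic 0 to
  characteristic l.\<close>

lemma int_relation_primitive:
  fixes a :: "'i \<Rightarrow> nat \<Rightarrow> int" and l :: int
  assumes I: "finite I" "card I > B" and l: "l > 1"
  shows "\<exists>c. (\<exists>i\<in>I. \<not> l dvd c i) \<and> (\<forall>n<B. (\<Sum>i\<in>I. c i * a i n) = 0)"
proof -
  have "\<exists>c. (\<exists>i\<in>I. \<not> l dvd c i) \<and> (\<forall>n<B. (\<Sum>i\<in>I. c i * a i n) = 0)"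
    if "\<exists>i\<in>I. c i \<noteq> 0" "\<forall>n<B. (\<Sum>i\<in>I. c i * a i n) = 0" for c
    using that
  proof (induction "\<Sum>i\<in>I. nat \<bar>c i\<bar>" arbitrary: c rule: less_induct)
    case less
    show ?case
    proof (cases "\<forall>i\<in>I. l dvd c i")
      case True
      define d where "d i = c i div l" for i
      have cd: "c i = l * d i" if "i \<in> I" for i using True that by (simp add: d_def)
      obtain j where j: "j \<in> I" "c j \<noteq> 0" using less.prems by blast
      have "nat \<bar>d i\<bar> \<le> nat \<bar>c i\<bar>" if "i \<in> I" for i
        using cd[OF that] l mult_right_mono[of 1 l "\<bar>d i\<bar>"] by (simp add: abs_mult)
      moreover have "nat \<bar>d j\<bar> < nat \<bar>c j\<bar>"
        using cd[OF j(1)] j(2) l mult_strict_right_mono[of 1 l "\<bar>d j\<bar>"] by (simp add: abs_mult)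
      ultimately have "(\<Sum>i\<in>I. nat \<bar>d i\<bar>) < (\<Sum>i\<in>I. nat \<bar>c i\<bar>)"
        using I(1) j(1) by (intro sum_strict_mono_ex1) auto
      moreover have "\<exists>i\<in>I. d i \<noteq> 0" using cd j by auto
      moreover have "(\<Sum>i\<in>I. d i * a i n) = 0" if "n < B" for n
      proof -
        have "(\<Sum>i\<in>I. c i * a i n) = l * (\<Sum>i\<in>I. d i * a i n)"
          unfolding sum_distrib_left by (intro sum.cong refl) (simp add: cd)
        then show ?thesis using less.prems(2) that l by auto
      qed
      ultimately show ?thesis using less.hyps[of d] by blast
    qed (use less.prems in blast)
  qed
  then show ?thesis using int_relation_nonzero[OF I, of a] by blast
qed

text \<open>A nonzero power series has no zeros in a small punctured disc, whereas \<open>qe\<close>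
  takes nonzero values of arbitrarily small modulus.\<close>

lemma qe_series_eq_0:
  fixes d :: "nat \<Rightarrow> complex"
  assumes L: "L > 0" and d0: "d 0 = 0"
    and zero: "\<And>\<tau>. Im \<tau> > 0 \<Longrightarrow> (\<lambda>n. d n * qe (\<tau> / of_nat L) ^ n) sums 0"
  shows "d n = 0"
proof (rule ccontr)
  assume dn: "d n \<noteq> 0"
  then have "n > 0" using d0 by (cases n) auto
  have "norm w < exp (- 2 * pi / real L) \<Longrightarrow> (\<lambda>n. d n * w ^ n) sums (\<Sum>n. d n * w ^ n)" for w
  proof (rule summable_sums, rule powser_inside)
    show "summable (\<lambda>n. d n * qe (\<i> / of_nat L) ^ n)" using zero[of \<i>] by (simp add: sums_iff)
    assume "norm w < exp (- 2 * pi / real L)"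
    then show "norm w < norm (qe (\<i> / of_nat L))" by (simp add: norm_qe Im_divide_of_nat)
  qed
  then have sm: "norm (w - 0) < exp (- 2 * pi / real L) \<Longrightarrow> (\<lambda>n. d n * (w - 0) ^ n) sums (\<Sum>n. d n * w ^ n)" for w
    by simp
  have "(\<Sum>n. d n * 0 ^ n) = 0" using d0 by simp
  moreover have "exp (- 2 * pi / real L) > 0" by simp
  ultimately obtain e where e: "e > 0"
    "\<And>z. z \<in> cball 0 e - {0} \<Longrightarrow> (\<Sum>n. d n * z ^ n) \<noteq> 0"
    using powser_0_nonzero[OF _ sm _ dn \<open>n > 0\<close>] by metis
  \<comment> \<open>Large enough that - 2 pi y / L \<le> ln e, so the point falls into the disc of
    radius e.\<close>
  define y where "y = max 1 (real L * \<bar>ln e\<bar>)"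
  let ?z = "qe (Complex 0 y / of_nat L)"
  have "\<bar>ln e\<bar> \<le> y / real L" using L by (simp add: y_def field_simps)
  moreover have "1 * (y / real L) \<le> 2 * pi * (y / real L)"
    using pi_ge_two by (intro mult_right_mono) (auto simp: y_def)
  ultimately have "- 2 * pi * (y / real L) \<le> ln e" by linarith
  then have "exp (- 2 * pi * (y / real L)) \<le> exp (ln e)" by (subst exp_le_cancel_iff)
  then have "norm ?z \<le> e" using e(1) by (simp add: norm_qe Im_divide_of_nat)
  then have "(\<Sum>n. d n * ?z ^ n) \<noteq> 0" using e(2) by simp
  moreover have "(\<lambda>n. d n * ?z ^ n) sums 0" by (rule zero) (simp add: y_def)
  ultimately show False by (simp add: sums_iff)
qed

text \<open>The classical coefficient formula; s is meant to be the sign by which \<phi> changes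
  when its point (1 / N, 0) is multiplied by p.\<close>

definition (in hecke_setup) hecke_coeff :: "int \<Rightarrow> (nat \<Rightarrow> int) \<Rightarrow> nat \<Rightarrow> nat \<Rightarrow> int" where
  "hecke_coeff s c p n = s * c (p * n) + int p ^ (wt - 1) * (if p dvd n then c (n div p) else 0)"

text \<open>The Hecke image restricted to the exponents in the class of v modulo 24 r, together with
  the fact that this is still a form of level \<open>lev\<close>.\<close>

definition (in hecke_setup) class_form :: "(nat \<Rightarrow> int) \<Rightarrow> nat \<Rightarrow> int \<Rightarrow> int \<Rightarrow> (complex \<Rightarrow> complex) \<Rightarrow> bool" where
  "class_form c p v s h \<longleftrightarrow> level_form wt lev h \<and> (\<forall>\<tau>. Im \<tau> > 0 \<longrightarrow>
    (\<lambda>n. of_int (if int (24 * r) dvd int n - v then hecke_coeff s c p n else 0) * qe (\<tau> / of_nat (24 * N)) ^ n) sums h \<tau>)"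

section \<open>Coefficients of Hecke images and sieving by residue class\<close>

context hecke_prime
begin

lemma hecke_series:
  assumes cop: "coprime p N" and c: "phi_coeffs c"
  shows "\<exists>s::int. s \<in> {1, - 1} \<and> (\<forall>\<tau>. Im \<tau> > 0 \<longrightarrow>
    (\<lambda>n. of_int (hecke_coeff s c p n) * qe (\<tau> / of_nat (24 * N)) ^ n) sums
      (- 16 * of_nat p ^ (wt - 1) * hecke (1 / real N) 0 \<tau>))"
proof -
  obtain s :: int where s: "s \<in> {1, - 1}"
    and s\<phi>: "\<And>\<tau>. Im \<tau> > 0 \<Longrightarrow> \<phi> (real p / real N) 0 \<tau> = of_int s * \<phi> (1 / real N) 0 \<tau>"
    using phi_mult_coprime[OF cop] by blast
  have p0: "p > 0" using p by (simp add: prime_gt_0_nat)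
  have pc: "(of_nat p :: complex) \<noteq> 0" using p0 by simp
  have Nc: "(of_nat N :: complex) \<noteq> 0" using N_pos by simp
  have ptr: "coprime p (4 * t * r)"
    using cop coprime_divisors[of p p "4 * t * r" N] by (auto simp: N_def)
  have "(\<lambda>n. of_int (hecke_coeff s c p n) * qe (\<tau> / of_nat (24 * N)) ^ n) sums
      (- 16 * of_nat p ^ (wt - 1) * hecke (1 / real N) 0 \<tau>)" if \<tau>: "Im \<tau> > 0" for \<tau>
  proof -
    let ?u = "qe (\<tau> / of_nat (24 * N))"
    define v where "v = qe (\<tau> / of_nat (24 * N * p))"
    have vp: "v ^ p = ?u" unfolding v_def qe_power using pc by simp
    \<comment> \<open>The representatives j run through \<open>lev\<close> i instead of i. Their
      second coordinate - \<open>lev\<close> i / N is then a multiple of 2 N, hence a period, and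
      every term becomes \<phi> at the same point (p / N, 0).\<close>
    define \<tau>' where "\<tau>' i = (\<tau> + of_int lev * of_nat i) / of_nat p" for i :: nat
    have im: "Im (\<tau>' i) > 0" for i using \<tau> p0 by (simp add: \<tau>'_def Im_divide_of_nat)
    have term1: "hecke_term (1 / real N) 0 1 (lev * int i) 0 (int p) \<tau> = of_int s * \<phi> (1 / real N) 0 (\<tau>' i) / of_nat p ^ wt" for i
    proof -
      have y: "- (1 / real N) * of_int (lev * int i) + 0 * of_int 1 = of_int 0 / real N + 2 * real N * of_int (- int i)"
        using N_pos by (simp add: lev_def field_simps power2_eq_square)
      have x: "1 / real N * of_int (int p) - 0 * of_int 0 = of_int (int p) / real N + 2 * real N * of_int 0" by simp
      have mob: "mob 1 (lev * int i) 0 (int p) \<tau> = \<tau>' i" by (simp add: mob_def \<tau>'_def)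
      have "hecke_term (1 / real N) 0 1 (lev * int i) 0 (int p) \<tau> = \<phi> (of_int (int p) / real N) (of_int 0 / real N) (\<tau>' i) / jfac 0 (int p) \<tau> ^ wt"
        unfolding hecke_term_def x y mob by (subst phi_shift[OF im refl refl]) (rule refl)
      then show ?thesis using s\<phi>[OF im] by (simp add: jfac_def)
    qed
    have "(\<Sum>j\<in>{0..<int p}. hecke_term (1 / real N) 0 1 j 0 (int p) \<tau>) =
        (\<Sum>j\<in>{0..<int p}. hecke_term (1 / real N) 0 1 (lev * j + 0) 0 (int p) \<tau>)"
    proof (rule sum_periodic_affine[symmetric])
      have "coprime p 2" using cop coprime_divisors[of p p 2 N] by (simp add: N_def)
      then have "coprime (2 * N ^ 2) p" using cop by (simp add: coprime_commute)
      then have "coprime (int (2 * N ^ 2)) (int p)" by (simp only: coprime_int_iff)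
      then show "coprime lev (int p)" by (simp add: lev_def)
    qed (use p0 hecke_term_periodic[OF \<tau>] in auto)
    also have "\<dots> = (\<Sum>i<p. hecke_term (1 / real N) 0 1 (lev * int i) 0 (int p) \<tau>)"
      by (rule sum.reindex_bij_witness[where i = int and j = nat]) auto
    also have "\<dots> = of_int s / of_nat p ^ wt * (\<Sum>i<p. \<phi> (1 / real N) 0 (\<tau>' i))"
      unfolding term1 sum_distrib_left by simp
    finally have sum1: "(\<Sum>j\<in>{0..<int p}. hecke_term (1 / real N) 0 1 j 0 (int p) \<tau>) =
      of_int s / of_nat p ^ wt * (\<Sum>i<p. \<phi> (1 / real N) 0 (\<tau>' i))" .
    have qi: "qe (\<tau>' i / of_nat (24 * N)) ^ n = v ^ n * qe (of_int (int (n * (4 * t * r))) * of_nat i / of_nat p)" for i n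
    proof -
      have "of_int lev = (of_nat (24 * N) * of_nat (4 * t * r) :: complex)"
        by (simp add: lev_def N_def power2_eq_square)
      then have "\<tau>' i / of_nat (24 * N) = \<tau> / of_nat (24 * N * p) + of_nat (4 * t * r) * of_nat i / of_nat p"
        unfolding \<tau>'_def using pc Nc by (simp add: field_simps)
      then have "qe (\<tau>' i / of_nat (24 * N)) = v * qe (of_nat (4 * t * r) * of_nat i / of_nat p)"
        by (simp only: qe_add v_def)
      then show ?thesis by (simp add: power_mult_distrib qe_power mult_ac)
    qed
    have "(\<lambda>n. \<Sum>i<p. of_int (c n) * qe (\<tau>' i / of_nat (24 * N)) ^ n) sums (\<Sum>i<p. - 16 * \<phi> (1 / real N) 0 (\<tau>' i))"
      using c im unfolding phi_coeffs_def by (intro sums_sum) blast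
    moreover have "(\<Sum>i<p. of_int (c n) * qe (\<tau>' i / of_nat (24 * N)) ^ n) = (if p dvd n then of_nat p * (of_int (c n) * v ^ n) else 0)" for n
    proof -
      have "int p dvd int (n * (4 * t * r)) \<longleftrightarrow> p dvd n"
        unfolding int_dvd_int_iff using ptr by (rule coprime_dvd_mult_left_iff)
      moreover have "(\<Sum>i<p. of_int (c n) * qe (\<tau>' i / of_nat (24 * N)) ^ n) =
          of_int (c n) * v ^ n * (\<Sum>i<p. qe (of_int (int (n * (4 * t * r))) * of_nat i / of_nat p))"
        unfolding qi sum_distrib_left by (simp only: mult.assoc)
      ultimately show ?thesis unfolding sum_qe_roots[OF p0] by simp
    qed
    ultimately have S: "(\<lambda>n. if p dvd n then of_nat p * (of_int (c n) * v ^ n) else 0) sums (\<Sum>i<p. - 16 * \<phi> (1 / real N) 0 (\<tau>' i))"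
      by simp
    have mono: "strict_mono (\<lambda>n. p * n)" using p0 by (simp add: strict_mono_def)
    have "(\<lambda>n. of_nat p * (of_int (c (p * n)) * ?u ^ n)) sums (\<Sum>i<p. - 16 * \<phi> (1 / real N) 0 (\<tau>' i))"
    proof -
      have "(\<lambda>n. (\<lambda>n. if p dvd n then of_nat p * (of_int (c n) * v ^ n) else 0) (p * n)) sums (\<Sum>i<p. - 16 * \<phi> (1 / real N) 0 (\<tau>' i))"
        using S by (subst sums_mono_reindex[OF mono]) (auto simp: dvd_def)
      then show ?thesis by (simp add: power_mult vp)
    qed
    then have "(\<lambda>n. of_int s / of_nat p * (of_nat p * (of_int (c (p * n)) * ?u ^ n))) sums (of_int s / of_nat p * (\<Sum>i<p. - 16 * \<phi> (1 / real N) 0 (\<tau>' i)))"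
      by (rule sums_mult)
    then have A: "(\<lambda>n. of_int (s * c (p * n)) * ?u ^ n) sums (- 16 * of_nat p ^ (wt - 1) * (\<Sum>j\<in>{0..<int p}. hecke_term (1 / real N) 0 1 j 0 (int p) \<tau>))"
    proof -
      have "wt = Suc (wt - 1)" by (simp add: wt_def)
      then have "(of_nat p :: complex) ^ wt = of_nat p * of_nat p ^ (wt - 1)" by (metis power_Suc)
      then have "of_int s / of_nat p * (\<Sum>i<p. - 16 * \<phi> (1 / real N) 0 (\<tau>' i)) =
          - 16 * of_nat p ^ (wt - 1) * (of_int s / of_nat p ^ wt * (\<Sum>i<p. \<phi> (1 / real N) 0 (\<tau>' i)))"
        using pc by (simp add: sum_distrib_left[symmetric] sum_negf)
      moreover have "of_int s / of_nat p * (of_nat p * (of_int (c (p * n)) * ?u ^ n)) = of_int (s * c (p * n)) * ?u ^ n" for n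
        using pc by simp
      ultimately show ?thesis unfolding sum1
        using \<open>(\<lambda>n. of_int s / of_nat p * (of_nat p * (of_int (c (p * n)) * ?u ^ n))) sums _\<close> by (simp only:)
    qed
    have imp: "Im (of_nat p * \<tau>) > 0" using \<tau> p0 by simp
    have "(\<lambda>n. of_int (c n) * qe (of_nat p * \<tau> / of_nat (24 * N)) ^ n) sums (- 16 * \<phi> (1 / real N) 0 (of_nat p * \<tau>))"
      using c imp unfolding phi_coeffs_def by blast
    moreover have "qe (of_nat p * \<tau> / of_nat (24 * N)) ^ n = ?u ^ (p * n)" for n
      unfolding qe_power by (intro arg_cong[where f = qe]) simp
    ultimately have "(\<lambda>n. (\<lambda>n. of_int (if p dvd n then c (n div p) else 0) * ?u ^ n) (p * n)) sums (- 16 * \<phi> (1 / real N) 0 (of_nat p * \<tau>))"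
      using p0 by simp
    then have "(\<lambda>n. of_int (if p dvd n then c (n div p) else 0) * ?u ^ n) sums (- 16 * \<phi> (1 / real N) 0 (of_nat p * \<tau>))"
      by (subst (asm) sums_mono_reindex[OF mono]) (auto simp: dvd_def)
    moreover have "hecke_term (1 / real N) 0 (int p) 0 0 1 \<tau> = \<phi> (1 / real N) 0 (of_nat p * \<tau>)"
      by (simp add: hecke_term_def mob_def)
    ultimately have "(\<lambda>n. of_nat p ^ (wt - 1) * (of_int (if p dvd n then c (n div p) else 0) * ?u ^ n)) sums
        (of_nat p ^ (wt - 1) * (- 16 * hecke_term (1 / real N) 0 (int p) 0 0 1 \<tau>))"
      by (simp only: sums_mult)
    from sums_add[OF A this] show ?thesis
      by (simp add: hecke_def hecke_coeff_def algebra_simps)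
  qed
  then show ?thesis using s by blast
qed

lemma hecke_class_form:
  assumes cop: "coprime p N" and c: "phi_coeffs c"
  shows "\<exists>s h. class_form c p v s h"
proof -
  let ?Q = "24 * r"
  have Q: "?Q > 0" using r_ge by simp
  obtain s :: int where s: "s \<in> {1, - 1}" and ser: "\<And>\<tau>. Im \<tau> > 0 \<Longrightarrow>
    (\<lambda>n. of_int (hecke_coeff s c p n) * qe (\<tau> / of_nat (24 * N)) ^ n) sums
      (- 16 * of_nat p ^ (wt - 1) * hecke (1 / real N) 0 \<tau>)"
    using hecke_series[OF cop c] by blast
  define a where "a = hecke_coeff s c p"
  \<comment> \<open>Since 24 N = 48 t times 24 r, translation by 48 t i multiplies u =
    \<open>qe (\<tau> / of_nat (24 * N))\<close> by a root of unity of order dividing 24 r.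
    Averaging against \<open>K\<close> keeps the class of v, and \<open>hecke_translate\<close>
    turns each translate into the Hecke image at another N-division point.\<close>
  define K where "K i = qe (- of_int v * of_nat i / of_nat ?Q) / of_nat ?Q" for i :: nat
  define h where "h \<tau> = (\<Sum>i<?Q. K i * (- 16 * of_nat p ^ (wt - 1) * hecke (of_int 1 / real N) (of_int (int (48 * t * i)) / real N) \<tau>))" for \<tau>
  have lf: "level_form wt lev h"
    unfolding h_def by (intro level_form_sum level_form_cmult level_form_hecke)
  have "(\<lambda>n. of_int (if int ?Q dvd int n - v then a n else 0) * qe (\<tau> / of_nat (24 * N)) ^ n) sums h \<tau>" if \<tau>: "Im \<tau> > 0" for \<tau>
  proof -
    let ?u = "qe (\<tau> / of_nat (24 * N))"
    let ?\<tau> = "\<lambda>i. \<tau> + of_int (int (48 * t * i))"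
    have tr: "hecke (1 / real N) 0 (?\<tau> i) = hecke (of_int 1 / real N) (of_int (int (48 * t * i)) / real N) \<tau>" for i
      unfolding hecke_translate[OF \<tau>] by simp
    have "(\<lambda>n. \<Sum>i<?Q. K i * (of_int (a n) * qe (?\<tau> i / of_nat (24 * N)) ^ n)) sums
        (\<Sum>i<?Q. K i * (- 16 * of_nat p ^ (wt - 1) * hecke (1 / real N) 0 (?\<tau> i)))"
      unfolding a_def using \<tau> by (intro sums_sum sums_mult ser) simp
    moreover have "(\<Sum>i<?Q. K i * (of_int (a n) * qe (?\<tau> i / of_nat (24 * N)) ^ n)) =
        of_int (if int ?Q dvd int n - v then a n else 0) * ?u ^ n" for n
    proof -
      have "K i * (of_int (a n) * qe (?\<tau> i / of_nat (24 * N)) ^ n) =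
          of_int (a n) * ?u ^ n / of_nat ?Q * qe (of_int (int n - v) * of_nat i / of_nat ?Q)" for i
      proof -
        have "of_nat (24 * N) = (of_nat (48 * t) * of_nat ?Q :: complex)" by (simp add: N_def)
        moreover have "(of_nat (48 * t) :: complex) \<noteq> 0" using t_ge by simp
        moreover have "of_int (int (48 * t * i)) = (of_nat (48 * t) * of_nat i :: complex)" by simp
        ultimately have "of_int (int (48 * t * i)) / of_nat (24 * N) = (of_nat i / of_nat ?Q :: complex)"
          by (simp only: mult_divide_mult_cancel_left not_False_eq_True)
        then have q1: "qe (?\<tau> i / of_nat (24 * N)) = ?u * qe (of_nat i / of_nat ?Q)"
          by (simp only: add_divide_distrib qe_add)
        have q2: "qe (of_int (int n - v) * of_nat i / of_nat ?Q) = qe (of_nat i / of_nat ?Q) ^ n * qe (- of_int v * of_nat i / of_nat ?Q)"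
          unfolding qe_power qe_add[symmetric]
          by (intro arg_cong[where f = qe]) (simp add: left_diff_distrib diff_divide_distrib)
        show ?thesis
          unfolding q1 q2 K_def power_mult_distrib by (simp only: divide_inverse mult_ac)
      qed
      then have "(\<Sum>i<?Q. K i * (of_int (a n) * qe (?\<tau> i / of_nat (24 * N)) ^ n)) =
          of_int (a n) * ?u ^ n / of_nat ?Q * (\<Sum>i<?Q. qe (of_int (int n - v) * of_nat i / of_nat ?Q))"
        unfolding sum_distrib_left by (intro sum.cong refl)
      then show ?thesis unfolding sum_qe_roots[OF Q] using Q by simp
    qed
    ultimately show ?thesis unfolding h_def tr by simp
  qed
  then show ?thesis using lf unfolding a_def class_form_def by blast
qed

end

section \<open>Good classes under multiplication by primes\<close>

context hecke_setup
begin

definition good :: "int \<Rightarrow> (nat \<Rightarrow> int) \<Rightarrow> int \<Rightarrow> bool" where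
  "good l c x \<longleftrightarrow> (\<exists>n. int (24 * r) dvd int n - (int t - 1) * x ^ 2 \<and> \<not> l dvd c n)"

lemma good_cong:
  assumes "int (24 * r) dvd x - y" "good l c x"
  shows "good l c y"
proof -
  obtain n where n: "int (24 * r) dvd int n - (int t - 1) * x ^ 2" "\<not> l dvd c n"
    using assms(2) by (auto simp: good_def)
  have "int n - (int t - 1) * y ^ 2 = (int n - (int t - 1) * x ^ 2) + (x - y) * ((int t - 1) * (x + y))"
    by (simp add: algebra_simps power2_eq_square)
  then have "int (24 * r) dvd int n - (int t - 1) * y ^ 2"
    using n(1) assms(1) by (metis dvd_add dvd_mult2)
  then show ?thesis using n(2) by (auto simp: good_def)
qed

text \<open>If infinitely many primes \<open>p\<close> led from the good class \<open>x\<close> to bad classes, the images under the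
  Hecke operators would be congruent to unit multiples of \<open>f (q\<^sup>p)\<close> for one fixed nonconstant
  \<open>f\<close>, hence linearly independent modulo \<open>l\<close>, in a space of bounded dimension.\<close>

lemma finite_bad_primes:
  fixes l :: nat
  assumes l: "prime l" and c: "phi_coeffs c" and c0: "c 0 = 0" and x: "good (int l) c x"
  shows "finite {p. prime p \<and> coprime p N \<and> p \<noteq> l \<and> \<not> good (int l) c (int p * x)}"
proof (rule ccontr)
  let ?Bad = "{p. prime p \<and> coprime p N \<and> p \<noteq> l \<and> \<not> good (int l) c (int p * x)}"
  let ?Q = "int (24 * r)"
  assume inf: "infinite ?Bad"
  define cls where "cls n \<longleftrightarrow> ?Q dvd int n - (int t - 1) * x ^ 2 \<and> \<not> int l dvd c n" for n
  \<comment> \<open>The lowest exponent of the class of (t - 1) x^2 that survives modulo l. It is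
    positive because \<open>c 0\<close> = 0.\<close>
  define m where "m = (LEAST n. cls n)"
  have "\<exists>n. cls n" using x by (auto simp: good_def cls_def)
  then have m: "cls m" unfolding m_def by (rule LeastI_ex)
  have m_least: "int l dvd c n" if "n < m" "?Q dvd int n - (int t - 1) * x ^ 2" for n
    using not_less_Least[of n cls] that by (auto simp: m_def cls_def)
  have m0: "m > 0" using m c0 by (cases m) (auto simp: cls_def)
  have L: "24 * N > 0" using N_pos by simp
  obtain B where B: "\<And>h a. level_form wt lev h \<Longrightarrow>
      (\<forall>\<tau>. Im \<tau> > 0 \<longrightarrow> (\<lambda>n. a n * qe (\<tau> / of_nat (24 * N)) ^ n) sums h \<tau>) \<Longrightarrow>
      (\<forall>n<B. a n = 0) \<Longrightarrow> (\<forall>\<tau>. Im \<tau> > 0 \<longrightarrow> h \<tau> = 0)"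
    using sturm_bound[OF lev_pos L, of wt] by blast
  \<comment> \<open>One prime more than Sturm's bound demands: the relation is imposed on
    coefficients below \<open>Suc B\<close>, so that it includes coefficient 0 even if B = 0, as
    \<open>qe_series_eq_0\<close> requires.\<close>
  obtain I where I: "finite I" "card I = Suc (Suc B)" "I \<subseteq> ?Bad"
    using infinite_arbitrarily_large[OF inf] by blast
  define v where "v p = (int t - 1) * int p * x ^ 2" for p :: nat
  have "\<exists>s h. class_form c p (v p) s h" if "p \<in> I" for p
  proof -
    have pp: "prime p" "coprime p N" using that I by auto
    interpret hecke_prime t r p by unfold_locales (use pp in auto)
    show ?thesis by (rule hecke_class_form[OF pp(2) c])
  qed
  then obtain sg h where sh: "\<And>p. p \<in> I \<Longrightarrow> class_form c p (v p) (sg p) (h p)" by metis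
  define a where "a p n = (if ?Q dvd int n - v p then hecke_coeff (sg p) c p n else 0)" for p n
  have lf: "level_form wt lev (h p)" if "p \<in> I" for p
    using sh[OF that] by (simp add: class_form_def)
  have ser: "(\<lambda>n. of_int (a p n) * qe (\<tau> / of_nat (24 * N)) ^ n) sums h p \<tau>" if "p \<in> I" "Im \<tau> > 0" for p \<tau>
    using sh[OF that(1)] that(2) unfolding a_def class_form_def by blast
  have "card I > Suc B" using I by simp
  from int_relation_primitive[OF I(1) this, of "int l" a]
  obtain C where C: "\<exists>p\<in>I. \<not> int l dvd C p" "\<forall>n<Suc B. (\<Sum>p\<in>I. C p * a p n) = 0"
    using prime_gt_1_nat[OF l] by auto
  define d where "d n = (\<Sum>p\<in>I. C p * a p n)" for n
  define H where "H \<tau> = (\<Sum>p\<in>I. of_int (C p) * h p \<tau>)" for \<tau>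
  have Hser: "(\<lambda>n. of_int (d n) * qe (\<tau> / of_nat (24 * N)) ^ n) sums H \<tau>" if \<tau>: "Im \<tau> > 0" for \<tau>
  proof -
    have "(\<lambda>n. \<Sum>p\<in>I. of_int (C p) * (of_int (a p n) * qe (\<tau> / of_nat (24 * N)) ^ n)) sums H \<tau>"
      unfolding H_def using \<tau> by (intro sums_sum sums_mult ser) auto
    then show ?thesis by (simp add: d_def sum_distrib_right mult.assoc)
  qed
  have "level_form wt lev H" unfolding H_def by (intro level_form_sum level_form_cmult lf)
  then have H0: "H \<tau> = 0" if "Im \<tau> > 0" for \<tau>
    using B[of H "\<lambda>n. of_int (d n)"] Hser C(2) that by (simp add: d_def)
  have d0: "d n = 0" for n
  proof -
    have "(of_int (d n) :: complex) = 0"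
    proof (rule qe_series_eq_0[OF L, of "\<lambda>n. of_int (d n)"])
      show "of_int (d 0) = (0 :: complex)" using C(2) by (simp add: d_def)
      show "(\<lambda>n. of_int (d n) * qe (\<tau> / of_nat (24 * N)) ^ n) sums 0" if "Im \<tau> > 0" for \<tau>
        using Hser[OF that] unfolding H0[OF that] .
    qed
    then show ?thesis by simp
  qed
  \<comment> \<open>The smallest prime whose coefficient in the relation is prime to l. Modulo l its
    series starts at p0 m, below the start p m of every other series that counts.\<close>
  define p0 where "p0 = Min {p \<in> I. \<not> int l dvd C p}"
  have fin: "finite {p \<in> I. \<not> int l dvd C p}" and ne: "{p \<in> I. \<not> int l dvd C p} \<noteq> {}" using I(1) C(1) by auto
  have p0: "p0 \<in> I" "\<not> int l dvd C p0" using Min_in[OF fin ne] by (auto simp: p0_def)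
  have p0_le: "p0 \<le> p" if "p \<in> I" "\<not> int l dvd C p" for p
    unfolding p0_def using fin that by (intro Min_le) auto
  \<comment> \<open>If n lies in the class of (t - 1) p x^2, then p n lies in the class of (t - 1)(p
    x)^2, which is bad. So only the summand c (n / p) is left modulo l.\<close>
  have bad: "int l dvd c (p * n)" if "p \<in> I" "?Q dvd int n - v p" for p n
  proof -
    have "int (p * n) - (int t - 1) * (int p * x) ^ 2 = int p * (int n - v p)"
      by (simp add: v_def algebra_simps power2_eq_square)
    then have "?Q dvd int (p * n) - (int t - 1) * (int p * x) ^ 2" using that(2) by simp
    then show ?thesis using that(1) I(3) unfolding good_def by blast
  qed
  \<comment> \<open>For p > p0 dividing n, the quotient n / p is below m and lies in the class of x,
    so minimality of m kills its coefficient modulo l. For p0 the quotient is m, and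
    p0^(\<open>wt\<close> - 1) is a unit since p0 differs from l.\<close>
  define n where "n = p0 * m"
  have others: "int l dvd C p * a p n" if p: "p \<in> I - {p0}" for p
  proof (cases "int l dvd C p")
    case False
    have pI: "p \<in> I" using p by blast
    then have pp: "prime p" "coprime p N" using I(3) by auto
    have "p0 < p" using p0_le[OF pI False] p by (simp add: order_le_less)
    have "int l dvd a p n"
    proof (cases "?Q dvd int n - v p")
      case True
      have "int l dvd (if p dvd n then c (n div p) else 0)"
      proof (cases "p dvd n")
        case dv: True
        define k where "k = n div p"
        have k: "n = p * k" using dv by (simp add: k_def)
        have "p * k < p * m" using k m0 \<open>p0 < p\<close> unfolding n_def by (metis mult_less_mono1)
        then have "k < m" by simp
        have "int n - v p = int p * (int k - (int t - 1) * x ^ 2)"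
          by (simp add: v_def k algebra_simps)
        then have "?Q dvd int p * (int k - (int t - 1) * x ^ 2)" using True by simp
        moreover have "coprime (24 * r) p"
          using pp(2) coprime_divisors[of "24 * r" N p p] by (auto simp: N_def coprime_commute)
        then have "coprime ?Q (int p)" by (simp only: coprime_int_iff)
        ultimately have "?Q dvd int k - (int t - 1) * x ^ 2"
          by (simp only: coprime_dvd_mult_right_iff)
        then show ?thesis using m_least[OF \<open>k < m\<close>] dv by (simp add: k_def)
      qed simp
      then show ?thesis using bad[OF pI True] True by (simp add: a_def hecke_coeff_def)
    qed (simp add: a_def)
    then show ?thesis by simp
  qed simp
  have "\<not> int l dvd a p0 n"
  proof -
    have pp: "prime p0" "p0 \<noteq> l" using I(3) p0(1) by auto
    have "int n - v p0 = int p0 * (int m - (int t - 1) * x ^ 2)"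
      by (simp add: v_def n_def algebra_simps)
    then have Qn: "?Q dvd int n - v p0" using m by (simp add: cls_def)
    have "n div p0 = m" "p0 dvd n" using prime_gt_0_nat[OF pp(1)] by (simp_all add: n_def)
    then have eq: "a p0 n = sg p0 * c (p0 * n) + int p0 ^ (wt - 1) * c m"
      using Qn by (simp add: a_def hecke_coeff_def)
    have il: "prime (int l)" using l by simp
    have "\<not> int l dvd int p0"
      using l pp primes_dvd_imp_eq[of l p0] by auto
    then have "\<not> int l dvd int p0 ^ (wt - 1)" using il prime_dvd_power by blast
    then have "\<not> int l dvd int p0 ^ (wt - 1) * c m"
      using il m by (simp add: prime_dvd_mult_iff cls_def)
    then show ?thesis unfolding eq using bad[OF p0(1) Qn] by (simp add: dvd_add_right_iff)
  qed
  then have "\<not> int l dvd C p0 * a p0 n"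
    using p0(2) l by (simp add: prime_dvd_mult_iff)
  moreover have "int l dvd (\<Sum>p\<in>I - {p0}. C p * a p n)" using others by (intro dvd_sum)
  moreover have "d n = C p0 * a p0 n + (\<Sum>p\<in>I - {p0}. C p * a p n)"
    unfolding d_def by (rule sum.remove[OF I(1) p0(1)])
  ultimately show False using d0[of n] by (metis dvd_0_right dvd_add_left_iff)
qed

lemma good_coprime:
  fixes l :: nat
  assumes l: "prime l" and c: "phi_coeffs c" and c0: "c 0 = 0" and one: "good (int l) c 1"
    and d: "coprime d (int N)"
  shows "good (int l) c d"
proof -
  let ?Q = "24 * r"
  have QN: "?Q dvd N" by (simp add: N_def)
  have Q0: "?Q > 0" using r_ge by simp
  define Bad where "Bad x = {p. prime p \<and> coprime p N \<and> p \<noteq> l \<and> \<not> good (int l) c (int p * x)}" for x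
  \<comment> \<open>Goodness depends on x modulo 24 r only, so the exceptional primes of finitely
    many residues account for all x.\<close>
  define P0 where "P0 = (\<Union>x\<in>{x \<in> {0..<int ?Q}. good (int l) c x}. Bad x)"
  have "finite P0" unfolding P0_def
  proof (rule finite_UN_I)
    show "finite {x \<in> {0..<int ?Q}. good (int l) c x}" by (rule finite_subset[of _ "{0..<int ?Q}"]) auto
    show "finite (Bad x)" if "x \<in> {x \<in> {0..<int ?Q}. good (int l) c x}" for x
      unfolding Bad_def using that by (intro finite_bad_primes[OF l c c0]) simp
  qed
  have step: "good (int l) c (int p * x)" if p: "prime p" "coprime p N" "p \<noteq> l" "p \<notin> P0" and x: "good (int l) c x" for p x
  proof -
    let ?x = "x mod int ?Q"
    have "good (int l) c ?x" by (rule good_cong[OF _ x]) (simp add: minus_mod_eq_mult_div)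
    moreover have "?x \<in> {0..<int ?Q}" using Q0 by simp
    ultimately have "p \<notin> Bad ?x" using p(4) by (auto simp: P0_def)
    then have "good (int l) c (int p * ?x)" using p by (simp add: Bad_def)
    moreover have "int ?Q dvd int p * ?x - int p * x"
    proof -
      have "int ?Q dvd ?x - x" by (metis dvd_minus_mod dvd_diff_commute)
      then show ?thesis by (metis dvd_mult right_diff_distrib)
    qed
    ultimately show ?thesis using good_cong by blast
  qed
  define S where "S = {p \<in> insert l P0. prime p \<and> coprime p N}"
  have finS: "finite S" using \<open>finite P0\<close> by (simp add: S_def)
  have "coprime N (\<Prod>S)" unfolding S_def by (rule prod_coprime_right) (auto simp: coprime_commute)
  \<comment> \<open>The congruence to 1 keeps the exceptional primes and l from dividing D, while
    the congruence modulo N keeps D prime to N. So every prime factor of D preserves goodness, and D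
    itself is reached from 1.\<close>
  then obtain D where D: "[D = nat (d mod int N)] (mod N)" "[D = 1] (mod \<Prod>S)"
    using binary_chinese_remainder_nat by blast
  have Dd: "int N dvd int D - d"
  proof -
    have "[int D = int (nat (d mod int N))] (mod int N)" using D(1) by (simp only: cong_int_iff)
    then have "[int D = d mod int N] (mod int N)" using N_pos by simp
    then show ?thesis by (simp add: cong_iff_dvd_diff[symmetric] cong_def)
  qed
  have cop: "coprime D N"
  proof -
    have "[int D = d] (mod int N)" using Dd by (simp add: cong_iff_dvd_diff)
    then have "coprime (int D) (int N)" using d cong_imp_coprime cong_sym by blast
    then show ?thesis by (simp only: coprime_int_iff)
  qed
  have "N \<ge> 48" using t_ge r_ge by (simp add: N_def)
  then have "D \<noteq> 0" using cop by (cases "D = 0") auto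
  have pd: "good (int l) c (int p * x)" if p: "prime p" "p dvd D" and x: "good (int l) c x" for p x
  proof -
    have pN: "coprime p N" using cop p(2) coprime_divisors[of p D N N] by simp
    have "p \<notin> insert l P0"
    proof
      assume "p \<in> insert l P0"
      then have "p \<in> S" using p(1) pN by (simp add: S_def)
      then have "p dvd \<Prod>S" using finS dvd_prod_eqI by blast
      then have "[D = 1] (mod p)" using D(2) by (rule cong_dvd_modulus_nat[rotated])
      then have "[0 = 1] (mod p)" using p(2) by (metis cong_0_iff cong_sym cong_trans)
      then show False using prime_gt_1_nat[OF p(1)] by (simp add: cong_def)
    qed
    then show ?thesis using step p(1) pN x by blast
  qed
  have "good (int l) c (int (prod_mset M) * 1)" if "\<forall>p\<in>#M. prime p \<and> p dvd D" for M
    using that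
  proof (induction M)
    case empty
    then show ?case using one by simp
  next
    case (add p M)
    then show ?case using pd[of p "int (prod_mset M)"] by simp
  qed
  from this[of "prime_factorization D"] have "good (int l) c (int D)"
    using \<open>D \<noteq> 0\<close> by (auto simp: prod_mset_prime_factorization_nat in_prime_factors_iff)
  moreover have "int ?Q dvd int D - d"
    using Dd QN by (meson dvd_trans int_dvd_int_iff)
  ultimately show ?thesis using good_cong by blast
qed

end

section \<open>Nonvanishing in the classes (t - 1)(d^2 - 1) / 24 modulo r\<close>

lemma coprime_6_square_mod_24:
  fixes d :: int
  assumes "coprime d 6"
  shows "24 dvd d ^ 2 - 1"
proof -
  have "\<not> 2 dvd d" "\<not> 3 dvd d"
    using assms coprime_common_divisor[of d 6 2] coprime_common_divisor[of d 6 3] by auto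
  then have "d mod 24 \<in> {1, 5, 7, 11, 13, 17, 19, 23}" by (simp; presburger)
  then have "(d mod 24) ^ 2 mod 24 = 1" by auto
  then have "d ^ 2 mod 24 = 1 mod 24" by (simp add: power_mod)
  then show ?thesis by (simp only: mod_eq_dvd_iff)
qed

theorem theorem1p10:
  fixes l t r s :: nat
  assumes "prime l" and "t \<ge> 2" and "r \<ge> 1" and "s \<in> {0..r - 1}"
    and "\<exists>d::int. gcd d (6 * int t * int r) = 1 \<and>
           [int s = (int t - 1) * ((d\<^sup>2 - 1) div 24)] (mod int r)"
  shows "\<not> fps_zero_mod (int l) (Abs_fps (\<lambda>n. int (num_regular_partitions t (r * n + s))))"
proof
  assume zero: "fps_zero_mod (int l) (Abs_fps (\<lambda>n. int (num_regular_partitions t (r * n + s))))"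
  interpret hecke_setup t r by unfold_locales (use assms in auto)
  let ?Q = "int (24 * r)"
  from assms(5) obtain d :: int where
    "gcd d (6 * int t * int r) = 1 \<and> [int s = (int t - 1) * ((d\<^sup>2 - 1) div 24)] (mod int r)" ..
  then have d: "gcd d (6 * int t * int r) = 1" "[int s = (int t - 1) * ((d\<^sup>2 - 1) div 24)] (mod int r)"
    by simp_all
  obtain c where c: "phi_coeffs c" "c E0 = 1" and supp: "\<And>n. c n \<noteq> 0 \<Longrightarrow> \<exists>m. n = E0 + 24 * m"
    and div: "\<And>l m. \<forall>i. i mod r = m mod r \<longrightarrow> l dvd bt i \<Longrightarrow> l dvd c (E0 + 24 * m)"
    using phi_coeffs_ex by blast
  have "E0 > 0" using N_pos by (simp add: E0_def)
  then have c0: "c 0 = 0" using supp[of 0] by auto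
  \<comment> \<open>The leading exponent lies in the class of x = 1, where its coefficient 1 makes x
    = 1 good.\<close>
  have E0: "?Q dvd int E0 - (int t - 1)"
  proof -
    have "int E0 - (int t - 1) = ?Q * (4 * int t * int (card A) + 48 * int t)"
      using t_ge by (simp add: E0_def N_def of_nat_diff algebra_simps)
    then show ?thesis by simp
  qed
  have "good (int l) c 1"
    unfolding good_def using E0 c(2) prime_gt_1_nat[OF assms(1)] by (intro exI[of _ E0]) auto
  moreover have cop: "coprime d (6 * int t * int r)" using d(1) by (simp add: coprime_iff_gcd_eq_1)
  then have "coprime d (int N)"
  proof -
    have "int N = 2 ^ 3 * (6 * int t * int r)" by (simp add: N_def)
    moreover have "coprime d 2"
      using cop by (rule coprime_divisors[rotated 2]) auto
    ultimately show ?thesis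
      using cop by (simp only: coprime_mult_right_iff coprime_power_right_iff simp_thms)
  qed
  ultimately have "good (int l) c d" by (rule good_coprime[OF assms(1) c(1) c0])
  then obtain n where n: "?Q dvd int n - (int t - 1) * d ^ 2" "\<not> int l dvd c n" by (auto simp: good_def)
  then obtain m where m: "n = E0 + 24 * m" using supp[of n] by (metis dvd_0_right)
  have "coprime d 6" using cop by (rule coprime_divisors[rotated 2]) auto
  then obtain e where e: "d ^ 2 - 1 = 24 * e" using coprime_6_square_mod_24 by blast
  \<comment> \<open>Subtracting the congruence for the leading exponent leaves 24 m congruent to (t
    - 1)(d^2 - 1) modulo 24 r. As 24 divides d^2 - 1, cancelling 24 gives the class of s modulo
    r.\<close>
  have "?Q dvd (int n - (int t - 1) * d ^ 2) - (int E0 - (int t - 1))" using n(1) E0 by (rule dvd_diff)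
  also have "(int n - (int t - 1) * d ^ 2) - (int E0 - (int t - 1)) = 24 * int m - (int t - 1) * (d ^ 2 - 1)"
    by (simp add: m algebra_simps)
  also have "\<dots> = 24 * (int m - (int t - 1) * e)" unfolding e by (simp add: algebra_simps)
  finally have "24 * int r dvd 24 * (int m - (int t - 1) * e)" by simp
  then have "int r dvd int m - (int t - 1) * e"
    by (rule dvd_times_left_cancel_iff[THEN iffD1, rotated]) simp
  then have "[int m = (int t - 1) * e] (mod int r)" by (simp add: cong_iff_dvd_diff)
  moreover have "(d\<^sup>2 - 1) div 24 = e" using e by simp
  ultimately have "[int m = int s] (mod int r)" using d(2) by (metis cong_sym cong_trans)
  then have "[m = s] (mod r)" by (simp only: cong_int_iff)
  then have ms: "m mod r = s mod r" by (simp only: cong_def)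
  have "int l dvd bt i" if "i mod r = m mod r" for i
  proof -
    have "s mod r = s" using assms(3,4) by auto
    then have "i = r * (i div r) + s" using that ms by (metis mult_div_mod_eq)
    then show ?thesis using zero unfolding fps_zero_mod_def bt_def by (metis fps_nth_Abs_fps)
  qed
  then have "int l dvd c (E0 + 24 * m)" using div by blast
  then show False using n(2) m by simp
qed

end
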